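(* Let $x,y,z$ be non-negative integers and let $\mathbf a=(a_1,\dots,a_m)$, $\mathbf b=(b_1,\dots,b_n)$ be two sequences of non-negative integers with $m\ge1$ and $a_1\ge1$. Put $\mu=2\lfloor\frac{m+1}{2}\rfloor$, $\mu'=2\lceil\frac{m-1}{2}\rceil$, $\nu=2\lfloor\frac{n+1}{2}\rfloor$, $\nu'=2\lceil\frac{n-1}{2}\rceil$, and $$\mathbf t^{+}=(a_1,\dots,a_{\mu'},\,a_{\mu'+1}+x+y+b_{\nu},\,b_{\nu-1},\dots,b_1),\qquad \mathbf t^{-}=(0,a_1-1,a_2,\dots,a_{\mu-1},\,a_{\mu}+x+y+b_{\nu'+1},\,b_{\nu'},\dots,b_1,z).$$ Then $$M(NR^{(4)}_{x,y,z}(\mathbf a;\mathbf b))=\frac{M(NR^{(4)}_{x+y,0,z}(\mathbf a;\mathbf b))\,M(NR^{(4)}_{0,y,z}(\mathbf a;\mathbf b))}{M(NR^{(4)}_{y,0,z}(\mathbf a;\mathbf b))}\cdot\frac{T(x+1,2a+b+2y+z-2,y)\,T(x+a+1,b+2y+z-2,y)}{T(1,2a+b+2y+z-2,y)\,T(a+1,b+2y+z-2,y)}$$ $$=2^{-y}\,K'(\mathbf t^{+})\,Q(\mathbf t^{-})\cdot\frac{(a-1)!}{(a+y-1)!}\cdot\frac{H_2(2e_a+2o_b)\,H_2(2o_a+2e_b+2z-1)}{H_2(2e_a+2o_b+2y)\,H_2(2o_a+2e_b+2y+2z-1)}\cdot\frac{H(2a+b+2y+z-1)\,H(b+y+z)}{H(2a+b+y+z-1)\,H(b+z)}$$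 $$\cdot\frac{T(x+1,2a+b+2y+z-2,y)\,T(x+a+1,b+2y+z-2,y)}{T(1,2a+b+2y+z-2,y)\,T(a+1,b+2y+z-2,y)}.$$
   Context: Lattice and tilings. For real $u,k$ let $[u;k]$ be the point of the plane with Cartesian coordinates $(u,\frac{\sqrt3}{2}k)$. The triangular lattice has as vertices all $[u;k]$ with $k\in\mathbb Z$, $u-k/2\in\mathbb Z$; its faces are unit equilateral triangles, up-pointing or down-pointing. A region is a finite union of unit triangles. A lozenge is the union of two unit triangles sharing an edge; it is vertical if that edge is horizontal. A tiling of a region is a covering of it by lozenges contained in it, without gaps or overlaps. $M(R)$ is the sum of the weights of all tilings of $R$, the weight of a tiling being the product of the weights of its lozenges; lozenges have weight $1$ unless stated otherwise; $M(\emptyset)=1$. Sequences. $a=\sum a_i$, $b=\sum b_j$; $o_a,e_a$ are the sums of the $a_i$ with $i$ odd, resp. even; $o_b,e_b$ likewise. $a_i=0$ for $i>m$, $b_j=0$ for $j>n$; an empty $\mathbf b$ is treated as the one-term sequence $(0)$. Functions. $H(n)=\prod_{i=0}^{n-1}i!$; $H_2(n)=\prod_{i=1}^{\lfloor n/2\rfloor}(n-2i)!$; for $n\ge0$, $(x)_n=x(x+1)\cdots(x+n-1)$ ($1$ for $n=0$); $T(x,n,m)=\prod_{i=0}^{m-1}(x+i)_{n-2i}$. Empty products are $1$. Quartered hexagons. For a sequence $\mathbf t=(t_1,\dots,t_{2l})$ of non-negative integers let $s_k=t_1+\dots+t_k$, $o_t=\sum_{i\text{ odd}}t_i$, $e_t=\sum_{i\text{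 even}}t_i$. $Q(\mathbf t)$: take the region bounded by the base from $[0;0]$ to $[o_t+e_t;0]$, the segment from $[o_t+e_t;0]$ to $[o_t;2e_t]$, the north side from $[o_t;2e_t]$ to $[0;2e_t]$, and the west zigzag through $[0;0],[-\frac12;1],[0;2],[-\frac12;3],\dots,[0;2e_t]$; remove from it, for each $1\le i\le l$, the up-pointing triangle with base from $[s_{2i-1};0]$ to $[s_{2i};0]$. $Q(\mathbf t)$ is the number of tilings of the resulting region. $K'(\mathbf t)$: if $e_t\ge1$, take the region bounded by the base from $[0;0]$ to $[o_t+e_t;0]$, the segment from $[o_t+e_t;0]$ to $[o_t+\frac12;2e_t-1]$, the north side from there to $[\frac12;2e_t-1]$, and the west zigzag through $[0;0],[\frac12;1],[0;2],[\frac12;3],\dots,[\frac12;2e_t-1]$; remove the same up-pointing triangles; give weight $\frac12$ to each vertical lozenge whose two western (left) sides both lie on the west zigzag. $K'(\mathbf t)$ is $M$ of this weighted region; if $e_t=0$, $K'(\mathbf t)=1$. The region $NR^{(4)}_{x,y,z}(\mathbf a;\mathbf b)$ ($a_1\ge1$). Let $L=x+y+a+b$, $A=2(y+e_a+o_b)-1$, $B=2(y+z+o_a+e_b)-2$, and let $\ell$ be the line $k=0$. Upper part (empty if $A=-1$): bounded by $\ell$ between $[0;0]$ and $[L;0]$, the segment from $[L;0]$ to $[L-\frac A2;A]$, the horizontal north side at height $k=A$, and the west zigzag through the points $[\alpha(k);k]$, $0\le k\le A$, with $\alpha(k)=0$ for $k$ even and $\frac12$ for $k$ odd. Lower part: bounded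 by $\ell$ between $[1;0]$ and $[L;0]$, the segments from $[L;0]$ to $[L+\frac z2;-z]$ and from there to $[L+z-\frac B2;-B]$, the horizontal south side at $k=-B$, and the west zigzag through $[\beta(k);-k]$, $0\le k\le B$, with $\beta(k)=1$ for $k$ even and $\frac12$ for $k$ odd. The region is the union of the two parts (lozenges may cross $\ell$) after removing: (i) from the lower part, everything at points $[u;-k]$ with $u<a_1-k/2$ (the down-pointing half triangle); (ii) for $2\le i\le m$, the triangle of side $a_i$ having a side on $\ell$ from $[a_1+\dots+a_{i-1};0]$ to $[a_1+\dots+a_i;0]$, up-pointing (above $\ell$) if $i$ is even, down-pointing (below $\ell$) if $i$ is odd; (iii) for $1\le j\le n$, the triangle of side $b_j$ having a side on $\ell$ from $[L-b_1-\dots-b_j;0]$ to $[L-b_1-\dots-b_{j-1};0]$, up-pointing (above $\ell$) if $j$ is odd, down-pointing (below $\ell$) if $j$ is even. Each vertical lozenge whose two western (left) sides both lie on the upper west zigzag has weight $\frac12$; all others have weight $1$. *)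

theory Defs
  imports Complex_Main "HOL-Library.Disjoint_Sets"
begin

section \<open>Triangular lattice, regions and weighted lozenge tilings\<close>

text \<open>
  A point \<open>[u; k]\<close> of the plane is represented by the pair \<open>(u, k)\<close>; its Cartesian coordinates are
  \<open>(u, k * sqrt 3 / 2)\<close>.  Only points on the horizontal lattice lines (integral \<open>k\<close>) are needed.
\<close>

type_synonym point = "real \<times> int"

text \<open>
  \<open>Up j k\<close> and \<open>Down j k\<close> are the two unit triangles having as a side the horizontal lattice edge
  from \<open>[j + k/2; k]\<close> to \<open>[j + 1 + k/2; k]\<close>, lying above and below this edge respectively.
\<close>

datatype utriangle = Up int int | Down int int

fun corners :: "utriangle \<Rightarrow> point set" where
  "corners (Up j k) =
     {(of_int j + of_int k / 2, k), (of_int j + 1 + of_int k / 2, k),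
      (of_int j + of_int (k + 1) / 2, k + 1)}"
| "corners (Down j k) =
     {(of_int j + of_int k / 2, k), (of_int j + 1 + of_int k / 2, k),
      (of_int j + of_int (k + 1) / 2, k - 1)}"

text \<open>
  A region is identified with the set of its unit triangles.  \<open>triangles_in P\<close> are the unit triangles
  contained in a part of the plane whose points at integral heights are \<open>P\<close>.  It is only used for
  parts that meet every strip \<open>k \<le> height \<le> k + 1\<close> in the convex hull of their points at heights \<open>k\<close>
  and \<open>k + 1\<close> (zigzag boundaries included), so it suffices to test the corners.
\<close>

definition triangles_in :: "point set \<Rightarrow> utriangle set" where
  "triangles_in P = {t. corners t \<subseteq> P}"

text \<open>Distinct unit triangles share an edge iff they have exactly two corners in common.\<close>

definition lozenge :: "utriangle set \<Rightarrow> bool" where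
  "lozenge l \<longleftrightarrow> (\<exists>s t. s \<noteq> t \<and> card (corners s \<inter> corners t) = 2 \<and> l = {s, t})"

definition tilings :: "utriangle set \<Rightarrow> utriangle set set set" where
  "tilings R = {P. partition_on R P \<and> (\<forall>l\<in>P. lozenge l)}"

definition M :: "(utriangle set \<Rightarrow> real) \<Rightarrow> utriangle set \<Rightarrow> real" where
  "M w R = (\<Sum>P\<in>tilings R. \<Prod>l\<in>P. w l)"

text \<open>
  A zigzag is given by its set \<open>Z\<close> of lattice points, one at each height of an integer interval.  The
  vertical lozenge \<open>{Up j k, Down j k}\<close> has western sides joining its west corner
  \<open>[j + k/2; k]\<close> to its top and bottom corners \<open>[j + (k + 1)/2; k + 1]\<close> and \<open>[j + (k + 1)/2; k - 1]\<close>;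
  they lie on the zigzag iff these three corners do.
\<close>

definition zigzag_weight :: "point set \<Rightarrow> utriangle set \<Rightarrow> real" where
  "zigzag_weight Z l =
     (if \<exists>j k. l = {Up j k, Down j k} \<and>
          {(of_int j + of_int k / 2, k), (of_int j + of_int (k + 1) / 2, k + 1),
           (of_int j + of_int (k + 1) / 2, k - 1)} \<subseteq> Z
      then 1 / 2 else 1)"


section \<open>Sequences\<close>

text \<open>One-based indexing of a finite sequence, extended by zero.\<close>

definition seq :: "nat list \<Rightarrow> nat \<Rightarrow> nat" where
  "seq ts i = (if 1 \<le> i \<and> i \<le> length ts then ts ! (i - 1) else 0)"

definition psum :: "nat list \<Rightarrow> nat \<Rightarrow> nat" where
  "psum ts k = (\<Sum>i=1..k. seq ts i)"

definition osum :: "nat list \<Rightarrow> nat" where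
  "osum ts = (\<Sum>i | i \<in> {1..length ts} \<and> odd i. seq ts i)"

definition esum :: "nat list \<Rightarrow> nat" where
  "esum ts = (\<Sum>i | i \<in> {1..length ts} \<and> even i. seq ts i)"


section \<open>Product functions\<close>

definition H :: "nat \<Rightarrow> real" where
  "H n = (\<Prod>i<n. fact i)"

definition H2 :: "nat \<Rightarrow> real" where
  "H2 n = (\<Prod>i=1..n div 2. fact (n - 2 * i))"

text \<open>
  The second argument is an integer because it may be negative when the product is empty; whenever
  a factor occurs below, \<open>n - 2 * i\<close> is non-negative.
\<close>

definition T :: "nat \<Rightarrow> int \<Rightarrow> nat \<Rightarrow> real" where
  "T x n m = (\<Prod>i<m. pochhammer (real (x + i)) (nat (n - 2 * int i)))"


section \<open>Regions\<close>

text \<open>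
  The equilateral triangles above and below the line \<open>k = 0\<close> with side from \<open>[p; 0]\<close> to \<open>[q; 0]\<close>.
\<close>

definition up_triangle :: "nat \<Rightarrow> nat \<Rightarrow> point set" where
  "up_triangle p q = {(u, k). 0 \<le> k \<and> real p + of_int k / 2 \<le> u \<and> u \<le> real q - of_int k / 2}"

definition down_triangle :: "nat \<Rightarrow> nat \<Rightarrow> point set" where
  "down_triangle p q = {(u, k). k \<le> 0 \<and> real p - of_int k / 2 \<le> u \<and> u \<le> real q + of_int k / 2}"

text \<open>Abscissae of the west zigzags at height \<open>k\<close>.\<close>

definition \<alpha> :: "int \<Rightarrow> real" where "\<alpha> k = (if even k then 0 else 1 / 2)"
definition \<beta> :: "int \<Rightarrow> real" where "\<beta> k = (if even k then 1 else 1 / 2)"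
definition \<gamma> :: "int \<Rightarrow> real" where "\<gamma> k = (if even k then 0 else - 1 / 2)"

definition \<alpha>_zigzag :: "int \<Rightarrow> point set" where
  "\<alpha>_zigzag N = {(\<alpha> k, k) | k. 0 \<le> k \<and> k \<le> N}"

text \<open>The up-pointing triangles removed from the base of the quartered hexagons.\<close>

definition dents :: "nat list \<Rightarrow> utriangle set" where
  "dents ts = (\<Union>i\<in>{1..length ts div 2}.
     triangles_in (up_triangle (psum ts (2 * i - 1)) (psum ts (2 * i))))"

definition Q_region :: "nat list \<Rightarrow> utriangle set" where
  "Q_region ts = triangles_in
     {(u, k). 0 \<le> k \<and> k \<le> 2 * int (esum ts) \<and> \<gamma> k \<le> u \<and>
              u \<le> real (osum ts + esum ts) - of_int k / 2} - dents ts"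

definition Q :: "nat list \<Rightarrow> nat" where
  "Q ts = card (tilings (Q_region ts))"

definition K'_region :: "nat list \<Rightarrow> utriangle set" where
  "K'_region ts = triangles_in
     {(u, k). 0 \<le> k \<and> k \<le> 2 * int (esum ts) - 1 \<and> \<alpha> k \<le> u \<and>
              u \<le> real (osum ts + esum ts) - of_int k / 2} - dents ts"

definition K' :: "nat list \<Rightarrow> real" where
  "K' ts = (if esum ts = 0 then 1
            else M (zigzag_weight (\<alpha>_zigzag (2 * int (esum ts) - 1))) (K'_region ts))"

definition NR4_L :: "nat \<Rightarrow> nat \<Rightarrow> nat list \<Rightarrow> nat list \<Rightarrow> nat" where
  "NR4_L x y as bs = x + y + sum_list as + sum_list bs"

definition NR4_A :: "nat \<Rightarrow> nat list \<Rightarrow> nat list \<Rightarrow> int" where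
  "NR4_A y as bs = 2 * int (y + esum as + osum bs) - 1"

definition NR4_B :: "nat \<Rightarrow> nat \<Rightarrow> nat list \<Rightarrow> nat list \<Rightarrow> int" where
  "NR4_B y z as bs = 2 * int (y + z + osum as + esum bs) - 2"

definition NR4_upper :: "nat \<Rightarrow> nat \<Rightarrow> nat list \<Rightarrow> nat list \<Rightarrow> utriangle set" where
  "NR4_upper x y as bs = triangles_in
     {(u, k). 0 \<le> k \<and> k \<le> NR4_A y as bs \<and> \<alpha> k \<le> u \<and> u \<le> real (NR4_L x y as bs) - of_int k / 2}"

text \<open>
  At height \<open>k \<le> 0\<close> the east boundary is \<open>L - k/2\<close> for \<open>k \<ge> - z\<close> and \<open>L + z + k/2\<close> for \<open>k \<le> - z\<close>, which
  is the smaller of the two values in either case.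
\<close>

definition NR4_lower :: "nat \<Rightarrow> nat \<Rightarrow> nat \<Rightarrow> nat list \<Rightarrow> nat list \<Rightarrow> utriangle set" where
  "NR4_lower x y z as bs = triangles_in
     {(u, k). - NR4_B y z as bs \<le> k \<and> k \<le> 0 \<and> \<beta> k \<le> u \<and>
              u \<le> real (NR4_L x y as bs) - of_int k / 2 \<and>
              u \<le> real (NR4_L x y as bs + z) + of_int k / 2}"

definition NR4_half_triangle :: "nat list \<Rightarrow> utriangle set" where
  "NR4_half_triangle as = triangles_in {(u, k). k \<le> 0 \<and> u \<le> real (seq as 1) + of_int k / 2}"

definition NR4_left_dents :: "nat list \<Rightarrow> utriangle set" where
  "NR4_left_dents as = (\<Union>i\<in>{2..length as}. triangles_in
     ((if even i then up_triangle else down_triangle) (psum as (i - 1)) (psum as i)))"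

text \<open>The subtractions below are not truncated, since \<open>L\<close> is at least the sum of \<open>bs\<close>.\<close>

definition NR4_right_dents :: "nat \<Rightarrow> nat list \<Rightarrow> utriangle set" where
  "NR4_right_dents L bs = (\<Union>j\<in>{1..length bs}. triangles_in
     ((if odd j then up_triangle else down_triangle) (L - psum bs j) (L - psum bs (j - 1))))"

definition NR4 :: "nat \<Rightarrow> nat \<Rightarrow> nat \<Rightarrow> nat list \<Rightarrow> nat list \<Rightarrow> utriangle set" where
  "NR4 x y z as bs = (NR4_upper x y as bs \<union> NR4_lower x y z as bs)
     - NR4_half_triangle as - NR4_left_dents as - NR4_right_dents (NR4_L x y as bs) bs"

definition M_NR4 :: "nat \<Rightarrow> nat \<Rightarrow> nat \<Rightarrow> nat list \<Rightarrow> nat list \<Rightarrow> real" where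
  "M_NR4 x y z as bs = M (zigzag_weight (\<alpha>_zigzag (NR4_A y as bs))) (NR4 x y z as bs)"


section \<open>The sequences of the two quartered hexagons\<close>

definition nonempty_seq :: "nat list \<Rightarrow> nat list" where
  "nonempty_seq bs = (if bs = [] then [0] else bs)"

definition floor_index :: "nat \<Rightarrow> nat" where
  "floor_index n = 2 * nat \<lfloor>(real n + 1) / 2\<rfloor>"

definition ceiling_index :: "nat \<Rightarrow> nat" where
  "ceiling_index n = 2 * nat \<lceil>(real n - 1) / 2\<rceil>"

definition t_plus :: "nat \<Rightarrow> nat \<Rightarrow> nat list \<Rightarrow> nat list \<Rightarrow> nat list" where
  "t_plus x y as bs =
     (let b = seq (nonempty_seq bs);
          \<mu>' = ceiling_index (length as);
          \<nu> = floor_index (length (nonempty_seq bs))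
      in map (seq as) [1..<\<mu>' + 1] @ [seq as (\<mu>' + 1) + x + y + b \<nu>] @ map b (rev [1..<\<nu>]))"

definition t_minus :: "nat \<Rightarrow> nat \<Rightarrow> nat \<Rightarrow> nat list \<Rightarrow> nat list \<Rightarrow> nat list" where
  "t_minus x y z as bs =
     (let b = seq (nonempty_seq bs);
          \<mu> = floor_index (length as);
          \<nu>' = ceiling_index (length (nonempty_seq bs))
      in [0, seq as 1 - 1] @ map (seq as) [2..<\<mu>] @ [seq as \<mu> + x + y + b (\<nu>' + 1)]
         @ map b (rev [1..<\<nu>' + 1]) @ [z])"

end

(*
  Cut the region along the line k = 0. A tiling is then a set S of y vertical lozenges crossing the
  free segment of the line, a tiling of the upper part and a tiling of the lower part. Cutting each
  part into strips turns its tilings into chains of interlacing sets, because the dual graph of a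
  strip is a path. Sums over interlacing sets of determinants are again determinants, so the number of
  tilings of either part is a Vandermonde product in the squares of the removed base positions,
  measured from the axis of the west zigzag. A large removed triangle is forced by the unit triangles
  along its base, hence only its base matters.
  In the resulting sum over S every position outside the free segment contributes to the weight of S
  exactly once, no matter on which side of the line it is removed. So up to the factors K' and Q, which
  are the terms without S, the sum depends only on a, b, x, y, z. It is a discrete Selberg sum
    sum over S of Vandermonde(s^2 : s in S)^2 * prod_{s in S} w(s),
  which the Cauchy-Binet formula turns into a determinant that can be evaluated.
*)

theory Submission
  imports Defs "Jordan_Normal_Form.Determinant"
begin

section \<open>Determinants of function tables\<close>

text \<open>The squares originate at the west zigzags. Going from one horizontal line to the next is
  a discrete integration; the antiderivatives that fit a zigzag are central factorial polynomials in
  the distance from its axis, alternately even and odd. Both zigzags of the region have the axis u =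
  1/2, so the edge at position s, with midpoint s + 1/2, contributes the same square on both sides.
  At the line k = 0 the upper part, thanks to the weights 1/2, ends on the even family and the lower
  part on the odd one; hence each crossing position s carries exactly one extra factor s, which
  makes the one-variable sums summable. The obstacle is the determinant. Cauchy-Binet leaves the
  nodes of two Newton bases free. Nodes from the left end of the free segment for one and beyond the
  right block for the other turn every entry into a one-variable sum of the same shape, and apart
  from row and column factors the entries depend on i + j only. In the result one factor depends on
  x and y through x + y only, one on y only, and the last is 1 if x = 0 or y = 0. The quotient of
  three counts isolates the first two.\<close>

definition dt :: "nat \<Rightarrow> (nat \<Rightarrow> nat \<Rightarrow> real) \<Rightarrow> real" where
  "dt n f = det (mat n n (\<lambda>(i, j). f i j))"

lemma dt_cong:
  assumes "\<And>i j. i < n \<Longrightarrow> j < n \<Longrightarrow> f i j = g i j"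
  shows "dt n f = dt n g"
  unfolding dt_def by (rule arg_cong[of _ _ det]) (auto intro!: eq_matI simp: assms)

lemma dt_leibniz:
  "dt n f = (\<Sum>p | p permutes {..<n}. real_of_int (sign p) * (\<Prod>i<n. f i (p i)))"
proof -
  have "dt n f = (\<Sum>p | p permutes {..<n}. real_of_int (sign p) * (\<Prod>i<n. mat n n (\<lambda>(i, j). f i j) $$ (i, p i)))"
    unfolding dt_def by (subst det_def'[of _ n]) (auto simp: atLeast0LessThan)
  also have "\<dots> = (\<Sum>p | p permutes {..<n}. real_of_int (sign p) * (\<Prod>i<n. f i (p i)))"
  proof (rule sum.cong[OF refl])
    fix p assume "p \<in> {p. p permutes {..<n}}"
    then have "p i < n" if "i < n" for i
      using that permutes_in_image[of p "{..<n}" i] by simp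
    then show "real_of_int (sign p) * (\<Prod>i<n. mat n n (\<lambda>(i, j). f i j) $$ (i, p i)) =
        real_of_int (sign p) * (\<Prod>i<n. f i (p i))"
      by simp
  qed
  finally show ?thesis .
qed

lemma dt_mult: "dt n (\<lambda>i j. \<Sum>k<n. f i k * g k j) = dt n f * dt n g"
proof -
  have "mat n n (\<lambda>(i, j). \<Sum>k<n. f i k * g k j) = mat n n (\<lambda>(i, j). f i j) * mat n n (\<lambda>(i, j). g i j)"
    by (rule eq_matI) (auto simp: scalar_prod_def atLeast0LessThan)
  then show ?thesis
    unfolding dt_def by (subst det_mult[of _ n, symmetric]) auto
qed

lemma dt_transpose: "dt n (\<lambda>i j. f j i) = dt n f"
proof -
  have "mat n n (\<lambda>(i, j). f j i) = transpose_mat (mat n n (\<lambda>(i, j). f i j))"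
    by (rule eq_matI) auto
  then show ?thesis
    unfolding dt_def by (simp add: det_transpose[of _ n])
qed

lemma dt_upper:
  assumes "\<And>i j. j < i \<Longrightarrow> i < n \<Longrightarrow> f i j = 0"
  shows "dt n f = (\<Prod>i<n. f i i)"
proof -
  have "upper_triangular (mat n n (\<lambda>(i, j). f i j))"
    using assms by (auto simp: upper_triangular_def)
  then have "dt n f = prod_list (diag_mat (mat n n (\<lambda>(i, j). f i j)))"
    unfolding dt_def by (rule det_upper_triangular) auto
  also have "\<dots> = (\<Prod>i<n. f i i)"
    by (subst prod_list_diag_prod) (auto simp: atLeast0LessThan intro!: prod.cong)
  finally show ?thesis .
qed

lemma dt_lower:
  assumes "\<And>i j. i < j \<Longrightarrow> j < n \<Longrightarrow> f i j = 0"
  shows "dt n f = (\<Prod>i<n. f i i)"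
  using dt_upper[of n "\<lambda>i j. f j i"] assms dt_transpose[of n f] by simp

lemma dt_scale: "dt n (\<lambda>i j. r i * c j * f i j) = (\<Prod>i<n. r i) * (\<Prod>j<n. c j) * dt n f"
proof -
  have "(\<Prod>j<n. c (p j)) = (\<Prod>j<n. c j)" if "p permutes {..<n}" for p
    using prod.permute[OF that, of c] by (simp add: o_def)
  then show ?thesis
    by (simp add: dt_leibniz prod.distrib sum_distrib_left mult_ac)
qed

text \<open>The row operation subtracting from each row its predecessor.\<close>

lemma dt_bordered_diff:
  "dt n (\<lambda>i j. g j (e (Suc i)) - g j (e i)) = dt (Suc n) (\<lambda>i j. if j = 0 then 1 else g (j - 1) (e i))"
proof -
  define B where "B = (\<lambda>i j. if j = 0 then 1 else g (j - 1) (e i) :: real)"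
  \<comment> \<open>Left multiplication by the unitriangular \<open>D\<close> subtracts from each
    row of the bordered matrix the row above. The column of ones becomes a unit vector, and
    expansion along it leaves the matrix of differences.\<close>
  define D where "D = (\<lambda>i k. if k = i then 1 else if Suc k = i then - 1 else 0 :: real)"
  define C where "C = (\<lambda>i j. if i = 0 then B 0 j else B i j - B (i - 1) j)"
  have "dt (Suc n) D = 1"
    by (subst dt_lower) (auto simp: D_def)
  moreover have "dt (Suc n) C = dt (Suc n) (\<lambda>i j. \<Sum>k<Suc n. D i k * B k j)"
  proof (rule dt_cong)
    fix i j assume "i < Suc n"
    have "(\<Sum>k<Suc n. D i k * B k j) = (\<Sum>k<Suc n. if k = i then B i j else 0) + (\<Sum>k<Suc n. if Suc k = i then - B k j else 0)"
      by (subst sum.distrib[symmetric], rule sum.cong) (auto simp: D_def)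
    also have "(\<Sum>k<Suc n. if k = i then B i j else 0) = B i j"
      using \<open>i < Suc n\<close> by (subst sum.delta) auto
    also have "(\<Sum>k<Suc n. if Suc k = i then - B k j else 0) = (\<Sum>k<Suc n. if k = i - 1 then (if i = 0 then 0 else - B (i - 1) j) else 0)"
      by (rule sum.cong) auto
    also have "\<dots> = (if i = 0 then 0 else - B (i - 1) j)"
      using \<open>i < Suc n\<close> by (subst sum.delta) auto
    finally show "C i j = (\<Sum>k<Suc n. D i k * B k j)"
      by (auto simp: C_def)
  qed
  ultimately have 1: "dt (Suc n) C = dt (Suc n) B"
    using dt_mult[of "Suc n" D B] by (metis mult_1)
  have "dt (Suc n) C = (\<Sum>i<Suc n. C i 0 * cofactor (mat (Suc n) (Suc n) (\<lambda>(i, j). C i j)) i 0)"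
    unfolding dt_def by (subst laplace_expansion_column[of _ "Suc n" 0]) auto
  also have "\<dots> = (\<Sum>i<Suc n. if i = 0 then cofactor (mat (Suc n) (Suc n) (\<lambda>(i, j). C i j)) 0 0 else 0)"
    by (rule sum.cong) (auto simp: C_def B_def)
  also have "\<dots> = cofactor (mat (Suc n) (Suc n) (\<lambda>(i, j). C i j)) 0 0"
    by simp
  also have "\<dots> = dt n (\<lambda>i j. C (Suc i) (Suc j))"
    unfolding cofactor_def dt_def
    by (auto simp: mat_delete_def intro!: arg_cong[of _ _ det] eq_matI)
  also have "\<dots> = dt n (\<lambda>i j. g j (e (Suc i)) - g j (e i))"
    by (rule dt_cong) (simp add: C_def B_def)
  finally show ?thesis
    using 1 by (simp add: B_def)
qed

text \<open>The first row is a unit vector, so expansion along it deletes the border. This serves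
  the lines on which the first position is a mere placeholder at the zigzag.\<close>

lemma dt_first_row:
  assumes "\<And>j. j < n \<Longrightarrow> g j (e 0) = 0"
  shows "dt (Suc n) (\<lambda>i j. if j = 0 then 1 else g (j - 1) (e i)) = dt n (\<lambda>i j. g j (e (Suc i)))"
proof -
  let ?A = "mat (Suc n) (Suc n) (\<lambda>(i, j). if j = 0 then 1 else g (j - 1) (e i))"
  have "det ?A = (\<Sum>j<Suc n. ?A $$ (0, j) * cofactor ?A 0 j)"
    by (rule laplace_expansion_row) auto
  also have "\<dots> = (\<Sum>j<Suc n. if j = 0 then cofactor ?A 0 0 else 0)"
    using assms by (intro sum.cong) auto
  also have "\<dots> = cofactor ?A 0 0"
    by simp
  also have "\<dots> = dt n (\<lambda>i j. g j (e (Suc i)))"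
    unfolding cofactor_def dt_def
    by (auto simp: mat_delete_def intro!: arg_cong[of _ _ det] eq_matI)
  finally show ?thesis
    by (simp add: dt_def)
qed

text \<open>In the summand with index \<open>l\<close> the new factor \<open>t - c j\<close> is
  written as \<open>(t - d l) + (d l - c j)\<close>, which either raises the degree by one or
  rescales the summand. The conditions on the support of \<open>u\<close> make the change of basis
  unitriangular.\<close>

lemma newton_basis_change:
  fixes c d :: "nat \<Rightarrow> real"
  shows "\<exists>u. u j = 1 \<and> (\<forall>k>j. u k = 0) \<and> (\<forall>t. (\<Prod>k<j. t - c k) = (\<Sum>l\<le>j. u l * (\<Prod>k<l. t - d k)))"
proof (induction j)
  case 0
  show ?case by (rule exI[of _ "\<lambda>k. if k = 0 then 1 else 0"]) auto
next
  case (Suc j)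
  then obtain u where u: "u j = 1" "\<And>k. k > j \<Longrightarrow> u k = 0"
    "\<And>t. (\<Prod>k<j. t - c k) = (\<Sum>l\<le>j. u l * (\<Prod>k<l. t - d k))" by auto
  define v where "v = (\<lambda>l. (if l = 0 then 0 else u (l - 1)) + (d l - c j) * u l)"
  have "(\<Prod>k<Suc j. t - c k) = (\<Sum>l\<le>Suc j. v l * (\<Prod>k<l. t - d k))" for t
  proof -
    have "(\<Prod>k<Suc j. t - c k) = (\<Sum>l\<le>j. u l * (\<Prod>k<l. t - d k)) * (t - c j)"
      by (simp add: u)
    also have "\<dots> = (\<Sum>l\<le>j. u l * (\<Prod>k<Suc l. t - d k)) + (\<Sum>l\<le>j. (d l - c j) * u l * (\<Prod>k<l. t - d k))"
      unfolding sum_distrib_right sum.distrib[symmetric]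
      by (rule sum.cong) (auto simp: algebra_simps)
    also have "(\<Sum>l\<le>j. u l * (\<Prod>k<Suc l. t - d k)) = (\<Sum>l\<le>Suc j. (if l = 0 then 0 else u (l - 1)) * (\<Prod>k<l. t - d k))"
      by (subst sum.atMost_Suc_shift) simp
    also have "(\<Sum>l\<le>j. (d l - c j) * u l * (\<Prod>k<l. t - d k)) = (\<Sum>l\<le>Suc j. (d l - c j) * u l * (\<Prod>k<l. t - d k))"
      by (simp add: u)
    finally show ?thesis
      by (simp only: v_def distrib_right sum.distrib)
  qed
  moreover have "v (Suc j) = 1" "\<And>k. k > Suc j \<Longrightarrow> v k = 0"
    using u(1,2) by (auto simp: v_def)
  ultimately show ?case by (intro exI[of _ v] conjI allI impI)
qed

text \<open>Changing the nodes of the Newton basis is a unitriangular column operation; with the nodes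
  \<open>t 0, t 1, \<dots>\<close> themselves the matrix is triangular.\<close>

lemma dt_newton:
  "dt n (\<lambda>i j. \<Prod>k<j. t i - c k) = (\<Prod>j<n. \<Prod>i<j. t j - t i)"
proof -
  obtain u where u: "\<And>j. u j j = 1" "\<And>j k. k > j \<Longrightarrow> u j k = 0"
    "\<And>j s. (\<Prod>k<j. s - c k) = (\<Sum>l\<le>j. u j l * (\<Prod>k<l. s - t k))"
    using newton_basis_change[of _ c t] by metis
  have "dt n (\<lambda>i j. \<Prod>k<j. t i - c k) = dt n (\<lambda>i j. \<Sum>l<n. (\<Prod>k<l. t i - t k) * u j l)"
  proof (rule dt_cong)
    fix i j assume "j < n"
    have "(\<Sum>l<n. (\<Prod>k<l. t i - t k) * u j l) = (\<Sum>l\<le>j. (\<Prod>k<l. t i - t k) * u j l)"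
      using \<open>j < n\<close> by (intro sum.mono_neutral_right) (auto simp: u(2))
    then show "(\<Prod>k<j. t i - c k) = (\<Sum>l<n. (\<Prod>k<l. t i - t k) * u j l)"
      by (simp add: u(3) mult.commute)
  qed
  also have "\<dots> = dt n (\<lambda>i l. \<Prod>k<l. t i - t k) * dt n (\<lambda>l j. u j l)"
    by (rule dt_mult)
  also have "dt n (\<lambda>l j. u j l) = 1"
    using dt_upper[of n "\<lambda>l j. u j l"] by (simp add: u(1,2))
  also have "dt n (\<lambda>i l. \<Prod>k<l. t i - t k) = (\<Prod>j<n. \<Prod>i<j. t j - t i)"
    by (rule dt_lower) (rule prod_zero, auto)
  finally show ?thesis by simp
qed

text \<open>Multilinearity: row \<open>i\<close> depends on the choice \<open>y i\<close> only, so
  in each term of the Leibniz expansion the sum over all choices factors.\<close>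

lemma dt_sum_rows:
  assumes "\<And>i. i < n \<Longrightarrow> finite (I i)"
  shows "(\<Sum>y\<in>Pi\<^sub>E {..<n} I. dt n (\<lambda>i j. f i j (y i))) = dt n (\<lambda>i j. \<Sum>s\<in>I i. f i j s)"
proof -
  have "(\<Sum>y\<in>Pi\<^sub>E {..<n} I. dt n (\<lambda>i j. f i j (y i))) =
      (\<Sum>p | p permutes {..<n}. \<Sum>y\<in>Pi\<^sub>E {..<n} I. real_of_int (sign p) * (\<Prod>i<n. f i (p i) (y i)))"
    unfolding dt_leibniz by (rule sum.swap)
  also have "\<dots> = (\<Sum>p | p permutes {..<n}. real_of_int (sign p) * (\<Prod>i<n. \<Sum>s\<in>I i. f i (p i) s))"
    using assms by (intro sum.cong refl) (subst prod_sum_PiE, auto simp: sum_distrib_left)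
  finally show ?thesis
    by (simp add: dt_leibniz)
qed

lemma dt_permute_rows:
  assumes "p permutes {..<n}"
  shows "dt n (\<lambda>i j. f (p i) j) = real_of_int (sign p) * dt n f"
proof -
  have "mat n n (\<lambda>(i, j). f (p i) j) = mat n n (\<lambda>(i, j). mat n n (\<lambda>(i, j). f i j) $$ (p i, j))"
    using permutes_in_image[OF assms] by (intro eq_matI) auto
  then show ?thesis
    unfolding dt_def
    using det_permute_rows[of "mat n n (\<lambda>(i, j). f i j)" n p] assms
    by (simp add: atLeast0LessThan)
qed

lemma dt_equal_rows:
  assumes "i < n" "k < n" "i \<noteq> k" "\<And>j. j < n \<Longrightarrow> f i j = f k j"
  shows "dt n f = 0"
proof -
  have "row (mat n n (\<lambda>(i, j). f i j)) i = row (mat n n (\<lambda>(i, j). f i j)) k"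
    by (rule eq_vecI) (simp_all add: assms(1,2) assms(4))
  then show ?thesis
    unfolding dt_def using assms(1-3) by (intro det_identical_rows[of _ n i k]) auto
qed

section \<open>Vandermonde products and the Cauchy--Binet formula\<close>

text \<open>The order of the positions, not that of the values of \<open>t\<close>, orients each
  factor; thus the set alone determines the product, sign included.\<close>

definition vand :: "('a::linorder \<Rightarrow> real) \<Rightarrow> 'a set \<Rightarrow> real" where
  "vand t X = (\<Prod>x\<in>X. \<Prod>y\<in>{y \<in> X. y < x}. t x - t y)"

lemma obtain_enumeration:
  fixes X :: "'a::linorder set"
  assumes "finite X"
  obtains x where "strict_mono_on {..<card X} x" "x ` {..<card X} = X"
proof
  let ?l = "sorted_list_of_set X"
  show "strict_mono_on {..<card X} (\<lambda>i. ?l ! i)"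
    by (intro strict_mono_onI) (auto simp: sorted_wrt_iff_nth_less[THEN iffD1, OF strict_sorted_list_of_set, rule_format])
  have "(\<lambda>i. ?l ! i) ` {..<length ?l} = set ?l"
    by (auto simp: set_conv_nth)
  then show "(\<lambda>i. ?l ! i) ` {..<card X} = X"
    using assms by simp
qed

lemma vand_enumeration:
  fixes x :: "nat \<Rightarrow> 'a::linorder"
  assumes "strict_mono_on {..<n} x"
  shows "vand t (x ` {..<n}) = (\<Prod>j<n. \<Prod>i<j. t (x j) - t (x i))"
proof -
  have inj: "inj_on x {..<n}"
    by (rule strict_mono_on_imp_inj_on[OF assms])
  have "{y \<in> x ` {..<n}. y < x j} = x ` {..<j}" if "j < n" for j
  proof -
    have "x i < x j \<longleftrightarrow> i < j" if "i < n" for i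
      using strict_mono_on_less[OF assms] that \<open>j < n\<close> by simp
    then show ?thesis using that by auto
  qed
  then have "vand t (x ` {..<n}) = (\<Prod>j<n. \<Prod>y\<in>x ` {..<j}. t (x j) - t y)"
    unfolding vand_def by (subst prod.reindex[OF inj]) simp
  also have "\<dots> = (\<Prod>j<n. \<Prod>i<j. t (x j) - t (x i))"
    by (intro prod.cong refl, subst prod.reindex) (auto intro: inj_on_subset[OF inj])
  finally show ?thesis .
qed

text \<open>The value does not depend on the nodes \<open>c\<close>; every use below chooses them to
  suit the sum that has to be evaluated.\<close>

lemma vand_dt:
  assumes "strict_mono_on {..<n} x"
  shows "vand t (x ` {..<n}) = dt n (\<lambda>i j. \<Prod>k<j. t (x i) - c k)"
  using vand_enumeration[OF assms] dt_newton by simp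

text \<open>The sum over all maps \<open>{..<n} \<rightarrow> A\<close> given by multilinearity reduces to
  injective maps, which are enumerations of \<open>n\<close>-subsets composed with permutations.\<close>

lemma cauchy_binet_vand:
  fixes A :: "'a::linorder set"
  assumes "finite A"
  shows "dt n (\<lambda>i j. \<Sum>s\<in>A. (w s * (\<Prod>k<i. t s - c k)) * (\<Prod>k<j. t s - d k)) =
    (\<Sum>S | S \<subseteq> A \<and> card S = n. (\<Prod>s\<in>S. w s) * (vand t S)\<^sup>2)"
proof -
  define f where "f = (\<lambda>i s. w s * (\<Prod>k<i. t s - c k))"
  define g where "g = (\<lambda>j s. \<Prod>k<j. t s - d k)"
  define F where "F = (\<lambda>y. (\<Prod>i<n. f i (y i)) * dt n (\<lambda>i j. g j (y i)))"
  let ?P = "Pi\<^sub>E {..<n} (\<lambda>_. A)"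
  let ?I = "{y \<in> ?P. inj_on y {..<n}}"
  have finP: "finite ?P" using assms by (intro finite_PiE) auto
  have "dt n (\<lambda>i j. \<Sum>s\<in>A. f i s * g j s) = (\<Sum>y\<in>?P. dt n (\<lambda>i j. f i (y i) * g j (y i)))"
    using assms by (subst dt_sum_rows) auto
  also have "\<dots> = (\<Sum>y\<in>?P. F y)"
    using dt_scale[of n "\<lambda>i. f i (y i)" "\<lambda>_. 1" "\<lambda>i j. g j (y i)" for y] by (simp add: F_def)
  also have "\<dots> = (\<Sum>y\<in>?I. F y)"
  proof (rule sum.mono_neutral_right[OF finP])
    show "\<forall>y\<in>?P - ?I. F y = 0"
    proof
      fix y assume "y \<in> ?P - ?I"
      then obtain i k where "i < n" "k < n" "i \<noteq> k" "y i = y k"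
        by (auto simp: inj_on_def)
      then have "dt n (\<lambda>i j. g j (y i)) = 0"
        by (intro dt_equal_rows[of i n k]) auto
      then show "F y = 0" by (simp add: F_def)
    qed
  qed auto
  also have "\<dots> = (\<Sum>S | S \<subseteq> A \<and> card S = n. \<Sum>y\<in>{y \<in> ?I. y ` {..<n} = S}. F y)"
    using assms finite_subset[of ?I ?P, OF _ finP]
    by (intro sum.group[symmetric]) (auto simp: card_image PiE_def Pi_def)
  also have "\<dots> = (\<Sum>S | S \<subseteq> A \<and> card S = n. (\<Prod>s\<in>S. w s) * (vand t S)\<^sup>2)"
  proof (rule sum.cong[OF refl])
    fix S assume "S \<in> {S. S \<subseteq> A \<and> card S = n}"
    then have S: "S \<subseteq> A" "card S = n" "finite S"
      using assms finite_subset by auto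
    obtain x where x: "strict_mono_on {..<n} x" "x ` {..<n} = S"
      using obtain_enumeration[OF S(3)] S(2) by auto
    have inj: "inj_on x {..<n}" by (rule strict_mono_on_imp_inj_on[OF x(1)])
    define X' where "X' = the_inv_into {..<n} x"
    have X': "X' (x i) = i" if "i < n" for i
      using that inj by (simp add: X'_def the_inv_into_f_f)
    have X'2: "x (X' s) = s" "X' s < n" if "s \<in> S" for s
      using that x(2) X' by auto
    have "(\<Sum>y\<in>{y \<in> ?I. y ` {..<n} = S}. F y) =
        (\<Sum>p | p permutes {..<n}. F (restrict (x \<circ> p) {..<n}))"
    proof (rule sum.reindex_bij_witness[where
          i = "\<lambda>p. restrict (x \<circ> p) {..<n}" and j = "\<lambda>y i. if i < n then X' (y i) else i"])
      fix y assume "y \<in> {y \<in> ?I. y ` {..<n} = S}"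
      then have y: "y \<in> ?P" "inj_on y {..<n}" "y ` {..<n} = S" by auto
      have yS: "y i \<in> S" if "i < n" for i using y(3) that by auto
      show 1: "restrict (x \<circ> (\<lambda>i. if i < n then X' (y i) else i)) {..<n} = y"
        using y(1) X'2 yS by (intro ext) (auto simp: PiE_def extensional_def)
      have "inj_on (\<lambda>i. if i < n then X' (y i) else i) {..<n}"
      proof (rule inj_onI)
        fix i k assume "i \<in> {..<n}" "k \<in> {..<n}"
          "(if i < n then X' (y i) else i) = (if k < n then X' (y k) else k)"
        then have "X' (y i) = X' (y k)" "i < n" "k < n" by auto
        then have "y i = y k" using X'2(1)[OF yS] by metis
        then show "i = k" using y(2) \<open>i < n\<close> \<open>k < n\<close> by (auto dest: inj_onD)
      qed
      moreover have "(\<lambda>i. if i < n then X' (y i) else i) ` {..<n} \<subseteq> {..<n}"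
        using X'2 yS by auto
      ultimately have "bij_betw (\<lambda>i. if i < n then X' (y i) else i) {..<n} {..<n}"
        unfolding bij_betw_def using endo_inj_surj[OF finite_lessThan] by blast
      then show "(\<lambda>i. if i < n then X' (y i) else i) \<in> {p. p permutes {..<n}}"
        by (intro CollectI bij_imp_permutes) auto
      show "F (restrict (x \<circ> (\<lambda>i. if i < n then X' (y i) else i)) {..<n}) = F y"
        by (simp only: 1)
    next
      fix p assume "p \<in> {p. p permutes {..<n}}"
      then have p: "p permutes {..<n}" by simp
      have pn: "p i < n" if "i < n" for i using permutes_in_image[OF p] that by auto
      show "(\<lambda>i. if i < n then X' (restrict (x \<circ> p) {..<n} i) else i) = p"
        using X' pn permutes_not_in[OF p] by (intro ext) auto
      have "restrict (x \<circ> p) {..<n} ` {..<n} = x ` (p ` {..<n})" by auto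
      then have im: "restrict (x \<circ> p) {..<n} ` {..<n} = S"
        using permutes_image[OF p] x(2) by simp
      moreover have "inj_on (restrict (x \<circ> p) {..<n}) {..<n}"
        using comp_inj_on[OF permutes_inj_on[OF p, of "{..<n}"]] permutes_image[OF p] inj by auto
      moreover have "restrict (x \<circ> p) {..<n} \<in> ?P"
        using im S(1) by (auto simp: PiE_def Pi_def)
      ultimately show "restrict (x \<circ> p) {..<n} \<in> {y \<in> ?I. y ` {..<n} = S}" by blast
    qed
    \<comment> \<open>Sorting the rows of the second determinant produces the sign that turns the
      sum over \<open>p\<close> into the Leibniz expansion of the first.\<close>
    also have "\<dots> = (\<Sum>p | p permutes {..<n}. real_of_int (sign p) * (\<Prod>i<n. f i (x (p i))) * dt n (\<lambda>i j. g j (x i)))"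
    proof (rule sum.cong[OF refl])
      fix p assume "p \<in> {p. p permutes {..<n}}"
      then have p: "p permutes {..<n}" by simp
      have "F (restrict (x \<circ> p) {..<n}) = (\<Prod>i<n. f i (x (p i))) * dt n (\<lambda>i j. g j (x (p i)))"
        unfolding F_def by (intro arg_cong2[of _ _ _ _ "(*)"] prod.cong dt_cong) auto
      then show "F (restrict (x \<circ> p) {..<n}) = real_of_int (sign p) * (\<Prod>i<n. f i (x (p i))) * dt n (\<lambda>i j. g j (x i))"
        using dt_permute_rows[OF p, of "\<lambda>i j. g j (x i)"] by simp
    qed
    also have "\<dots> = dt n (\<lambda>i j. f i (x j)) * dt n (\<lambda>i j. g j (x i))"
      unfolding sum_distrib_right[symmetric] by (simp add: dt_leibniz[of n "\<lambda>i j. f i (x j)"])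
    also have "dt n (\<lambda>i j. g j (x i)) = vand t S"
      unfolding g_def using vand_dt[OF x(1)] x(2) by simp
    also have "dt n (\<lambda>i j. f i (x j)) = dt n (\<lambda>i j. f j (x i))"
      using dt_transpose[of n "\<lambda>i j. f j (x i)"] by simp
    also have "\<dots> = (\<Prod>i<n. w (x i)) * vand t S"
      using dt_scale[of n "\<lambda>i. w (x i)" "\<lambda>_. 1" "\<lambda>i j. \<Prod>k<j. t (x i) - c k"] vand_dt[OF x(1), of t c] x(2)
      by (simp add: f_def)
    also have "(\<Prod>i<n. w (x i)) = (\<Prod>s\<in>S. w s)"
      unfolding x(2)[symmetric] using prod.reindex[OF inj, of w] by simp
    finally show "(\<Sum>y\<in>{y \<in> ?I. y ` {..<n} = S}. F y) = (\<Prod>s\<in>S. w s) * (vand t S)\<^sup>2"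
      by (simp add: power2_eq_square)
  qed
  finally show ?thesis by (simp add: f_def g_def)
qed

section \<open>A discrete Selberg sum\<close>

lemma alternating_binomial_Suc:
  fixes f :: "nat \<Rightarrow> real"
  shows "(\<Sum>l\<le>Suc k. (- 1) ^ l * of_nat (Suc k choose l) * f l) =
    (\<Sum>l\<le>k. (- 1) ^ l * of_nat (k choose l) * (f l - f (Suc l)))"
proof -
  have "(\<Sum>l\<le>Suc k. (- 1) ^ l * of_nat (Suc k choose l) * f l) =
      f 0 + (\<Sum>l\<le>k. (- 1) ^ Suc l * of_nat (Suc k choose Suc l) * f (Suc l))"
    by (subst sum.atMost_Suc_shift) simp
  also have "(\<Sum>l\<le>k. (- 1) ^ Suc l * of_nat (Suc k choose Suc l) * f (Suc l)) =
      (\<Sum>l\<le>k. (- 1) ^ Suc l * of_nat (k choose Suc l) * f (Suc l)) - (\<Sum>l\<le>k. (- 1) ^ l * of_nat (k choose l) * f (Suc l))"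
    unfolding sum_subtractf[symmetric] by (rule sum.cong) (auto simp: algebra_simps)
  also have "f 0 + \<dots> = (\<Sum>l\<le>Suc k. (- 1) ^ l * of_nat (k choose l) * f l) - (\<Sum>l\<le>k. (- 1) ^ l * of_nat (k choose l) * f (Suc l))"
  proof -
    have "(\<Sum>l\<le>Suc k. (- 1) ^ l * of_nat (k choose l) * f l) =
        f 0 + (\<Sum>l\<le>k. (- 1) ^ Suc l * of_nat (k choose Suc l) * f (Suc l))"
      by (subst sum.atMost_Suc_shift) simp
    then show ?thesis by linarith
  qed
  also have "\<dots> = (\<Sum>l\<le>k. (- 1) ^ l * of_nat (k choose l) * (f l - f (Suc l)))"
    by (simp add: right_diff_distrib sum_subtractf binomial_eq_0)
  finally show ?thesis .
qed

text \<open>The absorption identity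
  \<open>l * (k + 1 choose l) = (k + 1) * (k choose l - 1)\<close>: a factor \<open>l\<close> lowers
  the order of the difference by one.\<close>

lemma alternating_binomial_mult:
  fixes f :: "nat \<Rightarrow> real"
  shows "(\<Sum>l\<le>Suc k. (- 1) ^ l * of_nat (Suc k choose l) * (real l * f l)) =
    - of_nat (Suc k) * (\<Sum>l\<le>k. (- 1) ^ l * of_nat (k choose l) * f (Suc l))"
proof -
  have "(\<Sum>l\<le>Suc k. (- 1) ^ l * of_nat (Suc k choose l) * (real l * f l)) =
      (\<Sum>l\<le>k. (- 1) ^ Suc l * (of_nat (Suc k choose Suc l) * (real (Suc l)) * f (Suc l)))"
    by (subst sum.atMost_Suc_shift) (simp add: mult_ac)
  also have "\<dots> = (\<Sum>l\<le>k. - of_nat (Suc k) * ((- 1) ^ l * of_nat (k choose l) * f (Suc l)))"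
  proof (rule sum.cong[OF refl])
    fix l
    have "real (Suc k choose Suc l) * real (Suc l) = real (Suc k) * real (k choose l)"
      using Suc_times_binomial[of l k] by (metis of_nat_mult mult.commute)
    then show "(- 1) ^ Suc l * (of_nat (Suc k choose Suc l) * (real (Suc l)) * f (Suc l)) =
        - of_nat (Suc k) * ((- 1) ^ l * of_nat (k choose l) * f (Suc l))"
      by (simp only: power_Suc) (simp add: algebra_simps)
  qed
  finally show ?thesis by (simp only: sum_distrib_left)
qed

text \<open>One linear factor is split into \<open>l\<close> and its constant term. The constant
  leaves a product of smaller degree; the factor \<open>l\<close> is absorbed and lowers order and
  degree together.\<close>

lemma alternating_binomial_poly:
  fixes c :: "nat \<Rightarrow> real"
  assumes "r < k"
  shows "(\<Sum>l\<le>k. (- 1) ^ l * of_nat (k choose l) * (\<Prod>m<r. real l + c m)) = 0"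
  using assms
proof (induction r arbitrary: k c)
  case 0
  then obtain k' where "k = Suc k'" by (cases k) auto
  then show ?case by (simp only: alternating_binomial_Suc) simp
next
  case (Suc r)
  then obtain k' where k: "k = Suc k'" by (cases k) auto
  let ?P = "\<lambda>l. \<Prod>m<r. real l + c m"
  have "(\<Sum>l\<le>k. (- 1) ^ l * of_nat (k choose l) * (\<Prod>m<Suc r. real l + c m)) =
      (\<Sum>l\<le>k. (- 1) ^ l * of_nat (k choose l) * (real l * ?P l)) + c r * (\<Sum>l\<le>k. (- 1) ^ l * of_nat (k choose l) * ?P l)"
    unfolding sum_distrib_left sum.distrib[symmetric] by (rule sum.cong) (auto simp: algebra_simps)
  also have "(\<Sum>l\<le>k. (- 1) ^ l * of_nat (k choose l) * ?P l) = 0"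
    using Suc by simp
  also have "(\<Sum>l\<le>k. (- 1) ^ l * of_nat (k choose l) * (real l * ?P l)) =
      - of_nat (Suc k') * (\<Sum>l\<le>k'. (- 1) ^ l * of_nat (k' choose l) * ?P (Suc l))"
    unfolding k by (rule alternating_binomial_mult)
  also have "(\<Sum>l\<le>k'. (- 1) ^ l * of_nat (k' choose l) * ?P (Suc l)) = 0"
    using Suc.IH[of k' "\<lambda>m. 1 + c m"] Suc.prems k by (simp add: add.assoc add.commute add.left_commute)
  finally show ?case by simp
qed

text \<open>This is the partial fraction expansion of \<open>fact k / pochhammer W (Suc k)\<close>.
  One more difference compares the values at \<open>W\<close> and \<open>W + 1\<close>, whose
  Pochhammer symbols share all but the end factors.\<close>

lemma alternating_binomial_inverse:
  fixes W :: real
  assumes "W > 0"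
  shows "(\<Sum>l\<le>k. (- 1) ^ l * of_nat (k choose l) * (1 / (real l + W))) = fact k / pochhammer W (Suc k)"
  using assms
proof (induction k arbitrary: W)
  case 0
  then show ?case by simp
next
  case (Suc k)
  let ?S = "\<lambda>W. \<Sum>l\<le>k. (- 1) ^ l * of_nat (k choose l) * (1 / (real l + W))"
  have "(\<Sum>l\<le>Suc k. (- 1) ^ l * of_nat (Suc k choose l) * (1 / (real l + W))) = ?S W - ?S (W + 1)"
    unfolding alternating_binomial_Suc sum_subtractf[symmetric]
    by (rule sum.cong) (auto simp: algebra_simps)
  also have "\<dots> = fact k / pochhammer W (Suc k) - fact k / pochhammer (W + 1) (Suc k)"
    using Suc by simp
  also have "\<dots> = fact (Suc k) / pochhammer W (Suc (Suc k))"
  proof -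
    have p: "pochhammer (W + 1) k > 0" using Suc.prems by (intro pochhammer_pos) auto
    have "pochhammer W (Suc k) = W * pochhammer (W + 1) k"
      by (rule pochhammer_rec)
    moreover have "pochhammer (W + 1) (Suc k) = pochhammer (W + 1) k * (W + 1 + real k)"
      by (rule pochhammer_Suc)
    moreover have "pochhammer W (Suc (Suc k)) = W * (pochhammer (W + 1) k * (W + 1 + real k))"
      by (simp only: pochhammer_rec[of W] pochhammer_Suc[of "W + 1"])
    moreover have "F / (W * P) - F / (P * v) = (v - W) * F / (W * (P * v))"
      if "P > 0" "v > 0" for F P v :: real
      using that Suc.prems by (simp add: field_simps)
    ultimately show ?thesis
      using p Suc.prems by simp
  qed
  finally show ?case .
qed

text \<open>Division with remainder by \<open>l + W\<close>: the quotient has degree below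
  \<open>k\<close> and is annihilated by the difference, and the remainder is the value of the
  numerator at \<open>l = - W\<close>. The factors are divided off one at a time.\<close>

lemma alternating_binomial_quotient:
  fixes W :: real
  assumes "W > 0" "r \<le> k"
  shows "(\<Sum>l\<le>k. (- 1) ^ l * of_nat (k choose l) * ((\<Prod>m<r. real l + c m) / (real l + W))) =
    (\<Prod>m<r. c m - W) * (fact k / pochhammer W (Suc k))"
  using assms(2)
proof (induction r)
  case 0
  then show ?case using alternating_binomial_inverse[OF assms(1)] by simp
next
  case (Suc r)
  let ?P = "\<lambda>l. \<Prod>m<r. real l + c m"
  have "(\<Sum>l\<le>k. (- 1) ^ l * of_nat (k choose l) * ((\<Prod>m<Suc r. real l + c m) / (real l + W))) =
      (\<Sum>l\<le>k. (- 1) ^ l * of_nat (k choose l) * ?P l) +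
      (c r - W) * (\<Sum>l\<le>k. (- 1) ^ l * of_nat (k choose l) * (?P l / (real l + W)))"
    unfolding sum_distrib_left sum.distrib[symmetric]
  proof (rule sum.cong[OF refl])
    fix l
    have "real l + W \<noteq> 0" using assms(1) by linarith
    then have "(\<Prod>m<Suc r. real l + c m) / (real l + W) = ?P l + (c r - W) * (?P l / (real l + W))"
      by (simp add: field_simps)
    then show "(- 1) ^ l * of_nat (k choose l) * ((\<Prod>m<Suc r. real l + c m) / (real l + W)) =
        (- 1) ^ l * of_nat (k choose l) * ?P l +
        (c r - W) * ((- 1) ^ l * of_nat (k choose l) * (?P l / (real l + W)))"
      by (simp only: distrib_left) (simp add: mult_ac)
  qed
  also have "(\<Sum>l\<le>k. (- 1) ^ l * of_nat (k choose l) * ?P l) = 0"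
    using Suc by (intro alternating_binomial_poly) auto
  finally show ?case using Suc by simp
qed

text \<open>Multiplication from the left by a suitable lower triangular matrix makes the matrix upper
  triangular: below the diagonal one gets the \<open>k\<close>-th difference of a polynomial of degree \<open>k - 1\<close>.\<close>

lemma dt_pochhammer_fact:
  fixes Y :: real
  assumes "Y > 0" "Z \<ge> 1"
  shows "dt n (\<lambda>i j. pochhammer Y (i + j) / fact (Z + i + j)) =
    (\<Prod>k<n. (- 1) ^ k * fact k * pochhammer (Y - real Z - real k) k * fact (Z + k - 1) * pochhammer Y k
       / (fact (Z + 2 * k) * fact (Z + 2 * k - 1)))"
proof -
  \<comment> \<open>The factorial in \<open>L k l\<close> makes
    \<open>fact (Z + l + k - 1) / fact (Z + l + j)\<close> a polynomial in \<open>l\<close> of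
    degree \<open>k - 1 - j\<close> if \<open>j < k\<close>; with
    \<open>pochhammer (Y + real l) j\<close> the total degree is \<open>k - 1\<close> for every such
    \<open>j\<close>. For \<open>j = k\<close> a single denominator \<open>l + Z + k\<close> is
    left.\<close>
  define L where "L = (\<lambda>k l. (- 1) ^ (k + l) * of_nat (k choose l) * (fact (Z + l + k - 1) / pochhammer Y l) :: real)"
  define e where "e = (\<lambda>i j. pochhammer Y (i + j) / fact (Z + i + j) :: real)"
  define U where "U = (\<lambda>k j. \<Sum>l<n. L k l * e l j)"
  have Y: "pochhammer Y l > 0" for l using assms(1) by (rule pochhammer_pos)
  have U: "U k j = (- 1) ^ k * (\<Sum>l\<le>k. (- 1) ^ l * of_nat (k choose l) *
      (pochhammer (Y + real l) j * (fact (Z + l + k - 1) / fact (Z + l + j))))" if "k < n" for k j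
  proof -
    have "U k j = (\<Sum>l\<le>k. L k l * e l j)"
      unfolding U_def using that by (intro sum.mono_neutral_right) (auto simp: L_def)
    also have "\<dots> = (\<Sum>l\<le>k. (- 1) ^ k * ((- 1) ^ l * of_nat (k choose l) *
      (pochhammer (Y + real l) j * (fact (Z + l + k - 1) / fact (Z + l + j)))))"
    proof (rule sum.cong[OF refl])
      fix l
      have "pochhammer Y (l + j) = pochhammer Y l * pochhammer (Y + real l) j"
        by (rule pochhammer_product')
      then show "L k l * e l j = (- 1) ^ k * ((- 1) ^ l * of_nat (k choose l) *
          (pochhammer (Y + real l) j * (fact (Z + l + k - 1) / fact (Z + l + j))))"
        using Y[of l] by (simp add: L_def e_def power_add)
    qed
    finally show ?thesis by (simp only: sum_distrib_left)
  qed
  have "U k j = 0" if "j < k" "k < n" for k j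
  proof -
    define c where "c = (\<lambda>m. if m < j then Y + real m else real (Z + m + 1))"
    have "pochhammer (Y + real l) j * (fact (Z + l + k - 1) / fact (Z + l + j)) = (\<Prod>m<k - 1. real l + c m)" for l
    proof -
      have "(\<Prod>m<k - 1. real l + c m) = (\<Prod>m\<in>{..<j} \<union> {j..<k - 1}. real l + c m)"
        using that by (intro prod.cong) auto
      also have "\<dots> = (\<Prod>m<j. real l + c m) * (\<Prod>m=j..<k - 1. real l + c m)"
        by (rule prod.union_disjoint) auto
      also have "(\<Prod>m<j. real l + c m) = pochhammer (Y + real l) j"
        unfolding pochhammer_prod atLeast0LessThan by (intro prod.cong) (auto simp: c_def)
      also have "(\<Prod>m=j..<k - 1. real l + c m) = (\<Prod>m=j..<k - 1. real (Z + l + m + 1))"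
        by (intro prod.cong) (auto simp: c_def)
      also have "\<dots> = fact (Z + l + k - 1) / fact (Z + l + j)"
      proof -
        have "fact (Z + l + j) * (\<Prod>m=j..<j + d. real (Z + l + m + 1)) = fact (Z + l + j + d)" for d
          by (induction d) (auto simp: algebra_simps)
        from this[of "k - 1 - j"] show ?thesis using that by (simp add: field_simps)
      qed
      finally show ?thesis ..
    qed
    then show ?thesis
      unfolding U[OF that(2)] using that alternating_binomial_poly[of "k - 1" k c] by simp
  qed
  then have 1: "dt n U = (\<Prod>k<n. U k k)" by (intro dt_upper) auto
  have 2: "dt n U = dt n L * dt n e" unfolding U_def by (rule dt_mult)
  have 3: "dt n L = (\<Prod>k<n. L k k)" by (rule dt_lower) (simp add: L_def)
  have Lk: "L k k = fact (Z + 2 * k - 1) / pochhammer Y k" for k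
    by (simp add: L_def power_add[symmetric] mult_2 add.assoc)
  have Uk: "U k k = (- 1) ^ k * (pochhammer (Y - real Z - real k) k * (fact k * fact (Z + k - 1) / fact (Z + 2 * k)))"
    if "k < n" for k
  proof -
    have "(\<Sum>l\<le>k. (- 1) ^ l * of_nat (k choose l) *
        (pochhammer (Y + real l) k * (fact (Z + l + k - 1) / fact (Z + l + k)))) =
      (\<Sum>l\<le>k. (- 1) ^ l * of_nat (k choose l) * ((\<Prod>m<k. real l + (Y + real m)) / (real l + real (Z + k))))"
    proof (rule sum.cong[OF refl])
      fix l
      have "fact (Z + l + k) = real (Z + l + k) * fact (Z + l + k - 1)"
        using assms(2) by (subst fact_reduce) auto
      moreover have "pochhammer (Y + real l) k = (\<Prod>m<k. real l + (Y + real m))"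
        unfolding pochhammer_prod atLeast0LessThan by (intro prod.cong) auto
      ultimately show "(- 1) ^ l * of_nat (k choose l) *
        (pochhammer (Y + real l) k * (fact (Z + l + k - 1) / fact (Z + l + k))) =
        (- 1) ^ l * of_nat (k choose l) * ((\<Prod>m<k. real l + (Y + real m)) / (real l + real (Z + k)))"
        using assms(2) by (simp add: add_ac)
    qed
    also have "\<dots> = (\<Prod>m<k. Y + real m - real (Z + k)) * (fact k / pochhammer (real (Z + k)) (Suc k))"
      using assms(2) by (intro alternating_binomial_quotient) auto
    also have "(\<Prod>m<k. Y + real m - real (Z + k)) = pochhammer (Y - real Z - real k) k"
      unfolding pochhammer_prod atLeast0LessThan by (intro prod.cong) auto
    also have "pochhammer (real (Z + k)) (Suc k) = fact (Z + 2 * k) / fact (Z + k - 1)"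
    proof -
      have "1 + real (Z + k - 1) = real (Z + k)" using assms(2) by (simp add: of_nat_diff)
      then have "fact (Z + k - 1) * pochhammer (real (Z + k)) (Suc k) = fact (Z + k - 1 + Suc k)"
        using pochhammer_product'[of "1 :: real" "Z + k - 1" "Suc k"] by (simp only: pochhammer_fact)
      moreover have "Z + 2 * k = Z + k - 1 + Suc k" using assms(2) by simp
      ultimately have "fact (Z + k - 1) * pochhammer (real (Z + k)) (Suc k) = fact (Z + 2 * k)"
        by metis
      then show ?thesis by (subst eq_divide_eq) (simp add: mult.commute)
    qed
    finally show ?thesis unfolding U[OF that] by simp
  qed
  have "L k k \<noteq> 0" for k using Y[of k] by (simp add: Lk)
  then have "dt n e = (\<Prod>k<n. U k k / L k k)"
    using 1 2 3 by (simp add: prod_dividef field_simps)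
  also have "\<dots> = (\<Prod>k<n. (- 1) ^ k * fact k * pochhammer (Y - real Z - real k) k * fact (Z + k - 1) * pochhammer Y k
       / (fact (Z + 2 * k) * fact (Z + 2 * k - 1)))"
    by (rule prod.cong) (auto simp: Uk Lk)
  finally show ?thesis by (simp add: e_def)
qed

text \<open>The weight of a crossing position \<open>s\<close> on the free segment
  \<open>a \<le> s < a + N\<close>: differences of squares with the \<open>a - 1\<close> positions
  on its left and the \<open>c\<close> positions on its right, oriented so as to be nonnegative on
  the segment. The lone factor \<open>s\<close> comes from the odd family of the lower part.\<close>

definition selw :: "nat \<Rightarrow> nat \<Rightarrow> nat \<Rightarrow> int \<Rightarrow> real" where
  "selw a N c s = of_int s * (\<Prod>p=1..<a. (of_int s)\<^sup>2 - (real p)\<^sup>2) *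
     (\<Prod>p=a + N..<a + N + c. (real p)\<^sup>2 - (of_int s)\<^sup>2)"

text \<open>Newton factors with nodes from the left end of the segment shorten it from the left;
  \<open>N\<close> drops by the same amount, so that the right block keeps its place.\<close>

lemma selw_left:
  assumes "a \<ge> 1" "i \<le> N"
  shows "selw a N c s * (\<Prod>k<i. (of_int s)\<^sup>2 - (real (a + k))\<^sup>2) = selw (a + i) (N - i) c s"
proof -
  have "(\<Prod>p=1..<a + i. (of_int s)\<^sup>2 - (real p)\<^sup>2) =
      (\<Prod>p=1..<a. (of_int s)\<^sup>2 - (real p)\<^sup>2) * (\<Prod>k<i. (of_int s)\<^sup>2 - (real (a + k))\<^sup>2)"
    using assms(1) by (induction i) (auto simp: prod.atLeastLessThan_Suc mult_ac)
  then show ?thesis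
    using assms(2) by (simp add: selw_def)
qed

text \<open>Newton factors with nodes beyond the right block lengthen this block and leave the
  segment alone.\<close>

lemma selw_right:
  "selw a N c s * (\<Prod>k<j. (real (a + N + c + k))\<^sup>2 - (of_int s)\<^sup>2) = selw a N (c + j) s"
proof -
  have "(\<Prod>p=a + N..<a + N + (c + j). (real p)\<^sup>2 - (of_int s)\<^sup>2) =
      (\<Prod>p=a + N..<a + N + c. (real p)\<^sup>2 - (of_int s)\<^sup>2) * (\<Prod>k<j. (real (a + N + c + k))\<^sup>2 - (of_int s)\<^sup>2)"
    by (induction j) (auto simp: prod.atLeastLessThan_Suc mult_ac add.assoc)
  then show ?thesis
    by (simp add: selw_def)
qed

lemma selw_eq_0: "int 1 \<le> s \<Longrightarrow> s < int a \<Longrightarrow> selw a N c s = 0"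
proof -
  assume "int 1 \<le> s" "s < int a"
  then have "(\<Prod>p=1..<a. (of_int s)\<^sup>2 - (real p)\<^sup>2) = 0"
    by (intro prod_zero) (auto intro!: bexI[of _ "nat s"])
  then show ?thesis by (simp add: selw_def)
qed

lemma selw_single:
  assumes "a \<ge> 1"
  shows "selw a 1 c (int a) = fact c * fact (2 * a + c) / (2 * real a)"
proof -
  \<comment> \<open>Stopping the product at a variable \<open>m\<close> makes an induction possible;
    the case \<open>m = a\<close> is the one used.\<close>
  have "real a * (\<Prod>p=1..<m. (real a)\<^sup>2 - (real p)\<^sup>2) = fact (a + m - 1) / fact (a - m)" if "1 \<le> m" "m \<le> a" for m
    using that
  proof (induction m rule: dec_induct)
    case base
    then show ?case using assms by (simp add: fact_reduce)
  next
    case (step m)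
    have "real a - real m > 0" using step by simp
    have f: "fact (a - m) = (real a - real m) * fact (a - Suc m)"
      using step by (subst fact_reduce) (auto simp: of_nat_diff)
    have g: "fact (a + Suc m - 1) = (real a + real m) * fact (a + m - 1)"
      using step by (subst fact_reduce) auto
    have "real a * (\<Prod>p=1..<Suc m. (real a)\<^sup>2 - (real p)\<^sup>2) =
        (real a * (\<Prod>p=1..<m. (real a)\<^sup>2 - (real p)\<^sup>2)) * ((real a - real m) * (real a + real m))"
      using step(1) by (simp add: prod.atLeastLessThan_Suc power2_eq_square algebra_simps)
    also have "real a * (\<Prod>p=1..<m. (real a)\<^sup>2 - (real p)\<^sup>2) = fact (a + m - 1) / fact (a - m)"
      using step by simp
    also have "fact (a + m - 1) / fact (a - m) * ((real a - real m) * (real a + real m)) = fact (a + Suc m - 1) / fact (a - Suc m)"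
      using \<open>real a - real m > 0\<close> unfolding f g by simp
    finally show ?case .
  qed
  from this[of a] have 1: "real a * (\<Prod>p=1..<a. (real a)\<^sup>2 - (real p)\<^sup>2) = fact (2 * a - 1)"
    using assms by (simp add: mult_2)
  have 2: "(\<Prod>p=a + 1..<a + 1 + c. (real p)\<^sup>2 - (real a)\<^sup>2) = fact c * fact (2 * a + c) / fact (2 * a)"
    by (induction c) (auto simp: prod.atLeastLessThan_Suc field_simps power2_eq_square)
  have "fact (2 * a) = 2 * real a * fact (2 * a - 1)"
    using assms by (subst fact_reduce) auto
  then show ?thesis
    unfolding selw_def of_int_of_nat_eq 1 2 by simp
qed

text \<open>Since \<open>(s^2 - a^2) + ((a + N - 1)^2 - s^2)\<close> does not depend on
  \<open>s\<close>, a constant multiple of the sum equals two sums of the same kind in which the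
  left or the right end has left the segment. The induction on the length therefore keeps
  \<open>a\<close> and \<open>c\<close> arbitrary. The constant is
  \<open>(N - 1) * (2 * a + N - 1)\<close>; it vanishes for \<open>N = 1\<close>, which is a base
  case of its own.\<close>

lemma sum_selw:
  assumes "a \<ge> 1"
  shows "(\<Sum>s\<in>{int a..<int (a + N)}. selw a N c s) =
    fact c * fact (a - 1) / (2 * fact (a + c)) * pochhammer (real N) (2 * a + c) * pochhammer (real (N + a)) c"
  using assms
proof (induction N arbitrary: a c)
  case 0
  then show ?case by (simp add: pochhammer_0_left)
next
  case (Suc M)
  show ?case
  proof (cases M)
    case 0
    have "{int a..<int (a + 1)} = {int a}" by auto
    then have "(\<Sum>s\<in>{int a..<int (a + Suc M)}. selw a (Suc M) c s) = selw a 1 c (int a)"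
      by (simp add: 0)
    also have "\<dots> = fact c * fact (2 * a + c) / (2 * real a)"
      using Suc.prems by (rule selw_single)
    also have "\<dots> = fact c * fact (a - 1) / (2 * fact (a + c)) * fact (2 * a + c) * pochhammer (real (1 + a)) c"
    proof -
      have "fact a * pochhammer (real (1 + a)) c = fact (a + c)"
        using pochhammer_product'[of "1 :: real" a c] by (simp add: pochhammer_fact)
      moreover have "fact a = real a * fact (a - 1)"
        using Suc.prems by (subst fact_reduce) auto
      ultimately have "fact (a - 1) * pochhammer (real (1 + a)) c = fact (a + c) / real a"
        using Suc.prems by (simp add: field_simps)
      then show ?thesis using Suc.prems by (simp add: field_simps)
    qed
    finally show ?thesis by (simp add: 0 pochhammer_fact)
  next
    case (Suc N)
    let ?D = "\<Sum>s\<in>{int a..<int (a + N + 2)}. selw a (N + 2) c s"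
    have "(real (N + 1) * (2 * real a + real N + 1)) * ?D =
        (\<Sum>s\<in>{int a..<int (a + N + 2)}. selw (a + 1) (N + 1) c s + selw a (N + 1) (c + 1) s)"
      unfolding sum_distrib_left
    proof (rule sum.cong[OF refl])
      fix s
      have "selw (a + 1) (N + 1) c s = selw a (N + 2) c s * ((of_int s)\<^sup>2 - (real a)\<^sup>2)"
        using selw_left[of a 1 "N + 2" c s] Suc.prems by simp
      moreover have "selw a (N + 1) (c + 1) s = selw a (N + 2) c s * ((real (a + N + 1))\<^sup>2 - (of_int s)\<^sup>2)"
      proof -
        have "{a + (N + 1)..<a + (N + 1) + (c + 1)} = insert (a + N + 1) {a + (N + 2)..<a + (N + 2) + c}"
          by auto
        then show ?thesis by (simp add: selw_def)
      qed
      ultimately show "real (N + 1) * (2 * real a + real N + 1) * selw a (N + 2) c s =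
          selw (a + 1) (N + 1) c s + selw a (N + 1) (c + 1) s"
        by (simp add: algebra_simps power2_eq_square)
    qed
    also have "\<dots> = (\<Sum>s\<in>{int a..<int (a + N + 2)}. selw (a + 1) (N + 1) c s) + (\<Sum>s\<in>{int a..<int (a + N + 2)}. selw a (N + 1) (c + 1) s)"
      by (rule sum.distrib)
    \<comment> \<open>The weight is zero at the position that has just left the segment, so the
      range of summation can follow the new parameters.\<close>
    also have "(\<Sum>s\<in>{int a..<int (a + N + 2)}. selw (a + 1) (N + 1) c s) = (\<Sum>s\<in>{int (a + 1)..<int (a + 1 + (N + 1))}. selw (a + 1) (N + 1) c s)"
      using Suc.prems by (intro sum.mono_neutral_right) (auto intro!: selw_eq_0)
    also have "\<dots> = fact c * fact a / (2 * fact (a + 1 + c)) * pochhammer (real (N + 1)) (2 * a + c + 2) * pochhammer (real (N + 2 + a)) c"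
      using Suc.IH[of "a + 1" c] Suc by (simp add: algebra_simps)
    also have "(\<Sum>s\<in>{int a..<int (a + N + 2)}. selw a (N + 1) (c + 1) s) = (\<Sum>s\<in>{int a..<int (a + (N + 1))}. selw a (N + 1) (c + 1) s)"
    proof (intro sum.mono_neutral_right)
      have "selw a (N + 1) (c + 1) (int (a + N + 1)) = 0"
      proof -
        have "(\<Prod>p=a + (N + 1)..<a + (N + 1) + (c + 1). (real p)\<^sup>2 - (of_int (int (a + N + 1)))\<^sup>2) = (0 :: real)"
          by (rule prod_zero) (auto intro!: bexI[of _ "a + N + 1"])
        then show ?thesis by (simp only: selw_def mult_zero_right)
      qed
      moreover have "{int a..<int (a + N + 2)} - {int a..<int (a + (N + 1))} = {int (a + N + 1)}"
        by auto
      ultimately show "\<forall>s\<in>{int a..<int (a + N + 2)} - {int a..<int (a + (N + 1))}. selw a (N + 1) (c + 1) s = 0"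
        by simp
    qed auto
    also have "\<dots> = fact (c + 1) * fact (a - 1) / (2 * fact (a + 1 + c)) * pochhammer (real (N + 1)) (2 * a + c + 1) * pochhammer (real (N + 1 + a)) (c + 1)"
      using Suc.IH[of a "c + 1"] Suc.prems Suc by (simp add: algebra_simps)
    finally have "(real (N + 1) * (2 * real a + real N + 1)) * ?D =
      fact c * fact a / (2 * fact (a + 1 + c)) * pochhammer (real (N + 1)) (2 * a + c + 2) * pochhammer (real (N + 2 + a)) c +
      fact (c + 1) * fact (a - 1) / (2 * fact (a + 1 + c)) * pochhammer (real (N + 1)) (2 * a + c + 1) * pochhammer (real (N + 1 + a)) (c + 1)" .
    also have "\<dots> = (real (N + 1) * (2 * real a + real N + 1)) *
      (fact c * fact (a - 1) / (2 * fact (a + c)) * pochhammer (real (N + 2)) (2 * a + c) * pochhammer (real (N + 2 + a)) c)"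
    proof -
      define P R F G where "P = pochhammer (real (N + 2)) (2 * a + c)" and "R = pochhammer (real (N + 2 + a)) c"
        and "F = (fact (a - 1) :: real)" and "G = (fact (a + c) :: real)"
      have 1: "pochhammer (real (N + 1)) (2 * a + c + 1) = real (N + 1) * P"
        using pochhammer_rec[of "real (N + 1)" "2 * a + c"] by (simp add: P_def add_ac)
      have 2: "pochhammer (real (N + 1)) (2 * a + c + 2) = real (N + 1) * P * (real N + 2 * real a + real c + 2)"
        using pochhammer_Suc[of "real (N + 1)" "2 * a + c + 1"] 1 by (simp add: add_ac)
      have 3: "pochhammer (real (N + 1 + a)) (c + 1) = real (N + 1 + a) * R"
        using pochhammer_rec[of "real (N + 1 + a)" c] by (simp add: R_def add_ac)
      have 4: "fact a = real a * F"
        using Suc.prems by (subst fact_reduce) (auto simp: F_def)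
      have 5: "fact (a + 1 + c) = (real a + real c + 1) * G" by (simp add: G_def algebra_simps)
      have 6: "fact (c + 1) = (real c + 1) * fact c" by (simp add: algebra_simps)
      have "G \<noteq> 0" "real a + real c + 1 \<noteq> 0" by (auto simp: G_def)
      then show ?thesis
        unfolding 1 2 3 4 5 6 P_def[symmetric] R_def[symmetric] F_def[symmetric] G_def[symmetric]
        by (simp add: divide_simps) (simp add: algebra_simps)
    qed
    finally have "?D = fact c * fact (a - 1) / (2 * fact (a + c)) * pochhammer (real (N + 2)) (2 * a + c) * pochhammer (real (N + 2 + a)) c"
    proof (rule mult_left_cancel[THEN iffD1, rotated])
      have "0 < 2 * real a + real N + 1" by linarith
      then show "real (N + 1) * (2 * real a + real N + 1) \<noteq> 0" by simp
    qed
    then show ?thesis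
      using Suc by (simp add: add_ac)
  qed
qed

text \<open>With nodes \<open>a + k\<close> in one basis and \<open>a + N + c + k\<close> in the
  other, the Cauchy-Binet entry is a one-variable sum for \<open>a + i\<close>,
  \<open>N - i\<close>, \<open>c + j\<close>. As \<open>(N - i) + (2 * a + c + i)\<close> is the
  same number \<open>Y\<close> for all \<open>i\<close>, its closed form splits into a row factor, a
  column factor and a term in \<open>i + j\<close>, whose determinant is
  \<open>dt_pochhammer_fact\<close>.\<close>

lemma selberg_sum:
  assumes "a \<ge> 1" "n \<le> N"
  shows "(\<Sum>S | S \<subseteq> {int a..<int (a + N)} \<and> card S = n.
      (\<Prod>s\<in>S. selw a N c s) * (vand (\<lambda>s. (of_int s)\<^sup>2) S)\<^sup>2) =
    (\<Prod>k<n. fact (c + k) * fact k * fact (a + k - 1) / 2 *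
      pochhammer (real (N - k)) (2 * a + c + 2 * k) * pochhammer (real (N + a - k)) (c + 2 * k) *
      (fact (a + c + k - 1) / (fact (a + c + 2 * k) * fact (a + c + 2 * k - 1))))"
proof -
  define Y where "Y = real (N + 2 * a + c)"
  define r where "r = (\<lambda>i. fact (a + i - 1) / 2 * pochhammer (real (N - i)) (2 * a + c + i))"
  \<comment> \<open>The sign stems from turning the right-hand factors into
    \<open>p^2 - s^2\<close>; it cancels against the sign in
    \<open>dt_pochhammer_fact\<close>.\<close>
  define q where "q = (\<lambda>j. (- 1) ^ j * fact (c + j) * pochhammer (real (N + a)) (c + j) :: real)"
  let ?A = "{int a..<int (a + N)}"
  have "(\<Sum>S | S \<subseteq> ?A \<and> card S = n. (\<Prod>s\<in>S. selw a N c s) * (vand (\<lambda>s. (of_int s)\<^sup>2) S)\<^sup>2) =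
      dt n (\<lambda>i j. \<Sum>s\<in>?A. (selw a N c s * (\<Prod>k<i. (of_int s)\<^sup>2 - (real (a + k))\<^sup>2)) *
        (\<Prod>k<j. (of_int s)\<^sup>2 - (real (a + N + c + k))\<^sup>2))"
    by (rule cauchy_binet_vand[symmetric]) auto
  also have "\<dots> = dt n (\<lambda>i j. r i * q j * (pochhammer Y (i + j) / fact (a + c + i + j)))"
  proof (rule dt_cong)
    fix i j assume "i < n" "j < n"
    then have i: "i \<le> N" using assms by simp
    have "(selw a N c s * (\<Prod>k<i. (of_int s)\<^sup>2 - (real (a + k))\<^sup>2)) *
        (\<Prod>k<j. (of_int s)\<^sup>2 - (real (a + N + c + k))\<^sup>2) = (- 1) ^ j * selw (a + i) (N - i) (c + j) s" for s
    proof -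
      have "(\<Prod>k<j. (of_int s)\<^sup>2 - (real (a + N + c + k))\<^sup>2) = (- 1) ^ j * (\<Prod>k<j. (real (a + N + c + k))\<^sup>2 - (of_int s)\<^sup>2)"
        by (induction j) (auto simp: algebra_simps)
      then show ?thesis
        using selw_left[OF assms(1) i, of c s] selw_right[of "a + i" "N - i" c s j] i by simp
    qed
    then have "(\<Sum>s\<in>?A. (selw a N c s * (\<Prod>k<i. (of_int s)\<^sup>2 - (real (a + k))\<^sup>2)) *
        (\<Prod>k<j. (of_int s)\<^sup>2 - (real (a + N + c + k))\<^sup>2)) = (- 1) ^ j * (\<Sum>s\<in>?A. selw (a + i) (N - i) (c + j) s)"
      by (simp add: sum_distrib_left)
    also have "(\<Sum>s\<in>?A. selw (a + i) (N - i) (c + j) s) = (\<Sum>s\<in>{int (a + i)..<int (a + i + (N - i))}. selw (a + i) (N - i) (c + j) s)"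
      using assms(1) i by (intro sum.mono_neutral_right) (auto intro!: selw_eq_0)
    also have "\<dots> = fact (c + j) * fact (a + i - 1) / (2 * fact (a + i + (c + j))) *
        pochhammer (real (N - i)) (2 * (a + i) + (c + j)) * pochhammer (real (N - i + (a + i))) (c + j)"
      using assms(1) by (intro sum_selw) auto
    also have "pochhammer (real (N - i)) (2 * (a + i) + (c + j)) = pochhammer (real (N - i)) (2 * a + c + i) * pochhammer Y (i + j)"
      using pochhammer_product'[of "real (N - i)" "2 * a + c + i" "i + j"] i
      by (simp add: Y_def of_nat_diff algebra_simps)
    also have "N - i + (a + i) = N + a" using i by simp
    finally show "(\<Sum>s\<in>?A. (selw a N c s * (\<Prod>k<i. (of_int s)\<^sup>2 - (real (a + k))\<^sup>2)) *
        (\<Prod>k<j. (of_int s)\<^sup>2 - (real (a + N + c + k))\<^sup>2)) = r i * q j * (pochhammer Y (i + j) / fact (a + c + i + j))"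
      by (simp add: r_def q_def add_ac)
  qed
  also have "\<dots> = (\<Prod>i<n. r i) * (\<Prod>j<n. q j) *
      (\<Prod>k<n. (- 1) ^ k * fact k * pochhammer (Y - real (a + c) - real k) k * fact (a + c + k - 1) * pochhammer Y k
       / (fact (a + c + 2 * k) * fact (a + c + 2 * k - 1)))"
    unfolding dt_scale using assms(1) by (subst dt_pochhammer_fact) (auto simp: Y_def)
  also have "\<dots> = (\<Prod>k<n. fact (c + k) * fact k * fact (a + k - 1) / 2 *
      pochhammer (real (N - k)) (2 * a + c + 2 * k) * pochhammer (real (N + a - k)) (c + 2 * k) *
      (fact (a + c + k - 1) / (fact (a + c + 2 * k) * fact (a + c + 2 * k - 1))))"
    unfolding prod.distrib[symmetric]
  proof (rule prod.cong[OF refl])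
    fix k assume "k \<in> {..<n}"
    then have k: "k \<le> N" using assms by simp
    have 1: "pochhammer (real (N - k)) (2 * a + c + 2 * k) = pochhammer (real (N - k)) (2 * a + c + k) * pochhammer Y k"
      using pochhammer_product'[of "real (N - k)" "2 * a + c + k" k] k
      by (simp add: Y_def of_nat_diff algebra_simps)
    have "real (N + a - k) = Y - real (a + c) - real k" "c + 2 * k = k + (c + k)"
      using k by (auto simp: Y_def of_nat_diff)
    then have 2: "pochhammer (real (N + a - k)) (c + 2 * k) = pochhammer (Y - real (a + c) - real k) k * pochhammer (real (N + a)) (c + k)"
      by (simp only: pochhammer_product') (simp add: Y_def add_ac)
    have 3: "((- 1) ^ k * (- 1) ^ k :: real) = 1" by (simp add: power_mult_distrib[symmetric])
    show "r k * q k * ((- 1) ^ k * fact k * pochhammer (Y - real (a + c) - real k) k * fact (a + c + k - 1) * pochhammer Y k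
       / (fact (a + c + 2 * k) * fact (a + c + 2 * k - 1))) =
      fact (c + k) * fact k * fact (a + k - 1) / 2 *
      pochhammer (real (N - k)) (2 * a + c + 2 * k) * pochhammer (real (N + a - k)) (c + 2 * k) *
      (fact (a + c + k - 1) / (fact (a + c + 2 * k) * fact (a + c + 2 * k - 1)))"
      unfolding 1 2 r_def q_def using 3 by (simp add: mult_ac)
  qed
  finally show ?thesis .
qed

section \<open>Sums over interlacing sets\<close>

text \<open>The gaps are half-open because the down-pointing triangle with index \<open>j\<close> on
  top of a strip lies between the up-pointing ones with indices \<open>j\<close> and
  \<open>j + 1\<close>: between removed positions \<open>e i\<close> and \<open>e (Suc i)\<close>
  there are the indices \<open>e i, ..., e (Suc i) - 1\<close>.\<close>

definition interlacing :: "(nat \<Rightarrow> int) \<Rightarrow> nat \<Rightarrow> int set set" where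
  "interlacing e n = {Y. Y \<subseteq> {e 0..<e n} \<and> (\<forall>i<n. card (Y \<inter> {e i..<e (Suc i)}) = 1)}"

lemma interlacing_0 [simp]: "interlacing e 0 = {{}}"
  by (auto simp: interlacing_def)

lemma interval_index:
  fixes e :: "nat \<Rightarrow> int"
  assumes "e 0 \<le> y" "y < e n"
  shows "\<exists>i<n. y \<in> {e i..<e (Suc i)}"
  using assms(2)
proof (induction n)
  case 0
  then show ?case using assms(1) by simp
next
  case (Suc n)
  then show ?case by (cases "y < e n") (auto simp: less_Suc_eq)
qed

lemma interval_index_unique:
  fixes e :: "nat \<Rightarrow> int"
  assumes "strict_mono_on {..n} e" "i < n" "k < n" "y \<in> {e i..<e (Suc i)}" "y \<in> {e k..<e (Suc k)}"
  shows "i = k"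
proof (rule ccontr)
  have *: "e (Suc i) \<le> e k" if "i < k" "k < n" for i k
    using strict_mono_on_leD[OF assms(1), of "Suc i" k] that by simp
  assume "i \<noteq> k"
  then show False using *[of i k] *[of k i] assms by fastforce
qed

lemma interlacing_finite:
  "Y \<in> interlacing e n \<Longrightarrow> finite Y"
  by (auto simp: interlacing_def intro: finite_subset)

text \<open>The gaps are disjoint, so their points are chosen independently; in this form the
  multilinearity of the determinant applies.\<close>

lemma sum_interlacing:
  assumes e: "strict_mono_on {..n} e"
  shows "(\<Sum>Y\<in>interlacing e n. F Y) = (\<Sum>y\<in>Pi\<^sub>E {..<n} (\<lambda>i. {e i..<e (Suc i)}). F (y ` {..<n}))"
proof (rule sum.reindex_bij_witness[where i = "\<lambda>y. y ` {..<n}"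
      and j = "\<lambda>Y. restrict (\<lambda>i. the_elem (Y \<inter> {e i..<e (Suc i)})) {..<n}"])
  fix Y assume Y: "Y \<in> interlacing e n"
  define y where "y = restrict (\<lambda>i. the_elem (Y \<inter> {e i..<e (Suc i)})) {..<n}"
  have *: "Y \<inter> {e i..<e (Suc i)} = {y i}" if "i < n" for i
  proof -
    have "card (Y \<inter> {e i..<e (Suc i)}) = 1"
      using Y that by (simp add: interlacing_def)
    then obtain z where "Y \<inter> {e i..<e (Suc i)} = {z}"
      by (rule card_1_singletonE)
    then show ?thesis using that by (simp add: y_def)
  qed
  have im: "y ` {..<n} = Y"
  proof
    show "y ` {..<n} \<subseteq> Y"
    proof (rule image_subsetI)
      fix i assume "i \<in> {..<n}"
      then show "y i \<in> Y" using *[of i] by blast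
    qed
    show "Y \<subseteq> y ` {..<n}"
    proof
      fix x assume "x \<in> Y"
      then have "e 0 \<le> x" "x < e n" using Y by (auto simp: interlacing_def)
      then obtain i where "i < n" "x \<in> {e i..<e (Suc i)}"
        using interval_index[of e x n] by blast
      then have "x = y i" using *[of i] \<open>x \<in> Y\<close> by blast
      then show "x \<in> y ` {..<n}" using \<open>i < n\<close> by simp
    qed
  qed
  then show "restrict (\<lambda>i. the_elem (Y \<inter> {e i..<e (Suc i)})) {..<n} ` {..<n} = Y"
    by (simp only: y_def)
  then show "F (restrict (\<lambda>i. the_elem (Y \<inter> {e i..<e (Suc i)})) {..<n} ` {..<n}) = F Y"
    by (rule arg_cong)
  show "restrict (\<lambda>i. the_elem (Y \<inter> {e i..<e (Suc i)})) {..<n} \<in> Pi\<^sub>E {..<n} (\<lambda>i. {e i..<e (Suc i)})"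
    unfolding y_def[symmetric]
  proof (rule PiE_I)
    fix i assume "i \<in> {..<n}"
    then show "y i \<in> {e i..<e (Suc i)}" using *[of i] by blast
  next
    fix i assume "i \<notin> {..<n}"
    then show "y i = undefined" by (simp add: y_def)
  qed
next
  fix y assume y: "y \<in> Pi\<^sub>E {..<n} (\<lambda>i. {e i..<e (Suc i)})"
  have yi: "y i \<in> {e i..<e (Suc i)}" if "i < n" for i using PiE_mem[OF y] that by simp
  have *: "y ` {..<n} \<inter> {e i..<e (Suc i)} = {y i}" if "i < n" for i
  proof
    show "y ` {..<n} \<inter> {e i..<e (Suc i)} \<subseteq> {y i}"
    proof
      fix x assume "x \<in> y ` {..<n} \<inter> {e i..<e (Suc i)}"
      then obtain k where "k < n" "x = y k" "x \<in> {e i..<e (Suc i)}" by auto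
      then show "x \<in> {y i}"
        using interval_index_unique[OF e \<open>i < n\<close> \<open>k < n\<close>, of x] yi[of k] by auto
    qed
    show "{y i} \<subseteq> y ` {..<n} \<inter> {e i..<e (Suc i)}"
      using yi[OF that] that by blast
  qed
  show "restrict (\<lambda>i. the_elem (y ` {..<n} \<inter> {e i..<e (Suc i)})) {..<n} = y"
  proof
    fix i show "restrict (\<lambda>i. the_elem (y ` {..<n} \<inter> {e i..<e (Suc i)})) {..<n} i = y i"
    proof (cases "i < n")
      case True
      then show ?thesis using *[of i] by simp
    next
      case False
      then show ?thesis using PiE_arb[OF y, of i] by simp
    qed
  qed
  show "y ` {..<n} \<in> interlacing e n"
  proof -
    have "e 0 \<le> y i \<and> y i < e n" if "i < n" for i
      using yi[OF that] that strict_mono_on_leD[OF e, of 0 i] strict_mono_on_leD[OF e, of "Suc i" n] by simp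
    then have "y ` {..<n} \<subseteq> {e 0..<e n}" by auto
    moreover have "card (y ` {..<n} \<inter> {e i..<e (Suc i)}) = 1" if "i < n" for i
      using *[OF that] by simp
    ultimately show ?thesis by (simp add: interlacing_def)
  qed
qed

lemma interlacing_image_strict_mono:
  fixes e :: "nat \<Rightarrow> int"
  assumes e: "strict_mono_on {..n} e" and y: "y \<in> Pi\<^sub>E {..<n} (\<lambda>i. {e i..<e (Suc i)})"
  shows "strict_mono_on {..<n} y"
proof (rule strict_mono_onI)
  fix i k assume "i \<in> {..<n}" "k \<in> {..<n}" "i < k"
  then have "y i < e (Suc i)" "e (Suc i) \<le> e k" "e k \<le> y k"
    using y strict_mono_on_leD[OF e, of "Suc i" k] by (auto simp: PiE_def Pi_def)
  then show "y i < y k" by linarith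
qed

lemma card_interlacing:
  assumes e: "strict_mono_on {..n} e" and Y: "Y \<in> interlacing e n"
  shows "card Y = n"
proof -
  have "Y = (\<Union>i<n. Y \<inter> {e i..<e (Suc i)})"
  proof
    show "Y \<subseteq> (\<Union>i<n. Y \<inter> {e i..<e (Suc i)})"
    proof
      fix y assume "y \<in> Y"
      then have "e 0 \<le> y" "y < e n" using Y by (auto simp: interlacing_def)
      then obtain i where "i < n" "y \<in> {e i..<e (Suc i)}"
        using interval_index[of e y n] by blast
      then show "y \<in> (\<Union>i<n. Y \<inter> {e i..<e (Suc i)})"
        using \<open>y \<in> Y\<close> by blast
    qed
  qed auto
  also have "card \<dots> = (\<Sum>i<n. card (Y \<inter> {e i..<e (Suc i)}))"
  proof (rule card_UN_disjoint)
    show "\<forall>i\<in>{..<n}. finite (Y \<inter> {e i..<e (Suc i)})"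
      using interlacing_finite[OF Y] by blast
    show "\<forall>i\<in>{..<n}. \<forall>k\<in>{..<n}. i \<noteq> k \<longrightarrow> (Y \<inter> {e i..<e (Suc i)}) \<inter> (Y \<inter> {e k..<e (Suc k)}) = {}"
    proof (intro ballI impI)
      fix i k assume "i \<in> {..<n}" "k \<in> {..<n}" "i \<noteq> k"
      then show "(Y \<inter> {e i..<e (Suc i)}) \<inter> (Y \<inter> {e k..<e (Suc k)}) = {}"
        using interval_index_unique[OF e, of i k] by blast
    qed
  qed simp
  also have "\<dots> = n" using Y by (simp add: interlacing_def)
  finally show ?thesis .
qed

lemma sum_int_telescope:
  fixes g :: "int \<Rightarrow> real"
  assumes "a \<le> b"
  shows "(\<Sum>x\<in>{a..<b}. g (x + 1) - g x) = g b - g a"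
  using assms
proof (induction b rule: int_ge_induct)
  case base
  then show ?case by simp
next
  case (step b)
  then have "{a..<b + 1} = insert b {a..<b}" by auto
  then show ?case using step by simp
qed

text \<open>Row \<open>i\<close> is summed over the gap \<open>i\<close>, where it telescopes
  because \<open>g\<close> is a discrete antiderivative of the entries. The resulting differences of
  consecutive rows are undone by bordering with a column of ones.\<close>

lemma sum_interlacing_vand:
  assumes e: "strict_mono_on {..n} e"
    and g: "\<And>x j. e 0 \<le> x \<Longrightarrow> x < e n \<Longrightarrow> j < n \<Longrightarrow> g j (x + 1) - g j x = w x * (\<Prod>k<j. t x - c k)"
  shows "(\<Sum>Y\<in>interlacing e n. (\<Prod>x\<in>Y. w x) * vand t Y) =
    dt (Suc n) (\<lambda>i j. if j = 0 then 1 else g (j - 1) (e i))"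
proof -
  have le: "e i \<le> e k" if "i \<le> k" "k \<le> n" for i k
    using strict_mono_on_leD[OF e, of i k] that by simp
  have "(\<Sum>Y\<in>interlacing e n. (\<Prod>x\<in>Y. w x) * vand t Y) =
      (\<Sum>y\<in>Pi\<^sub>E {..<n} (\<lambda>i. {e i..<e (Suc i)}). dt n (\<lambda>i j. w (y i) * (\<Prod>k<j. t (y i) - c k)))"
    unfolding sum_interlacing[OF e]
  proof (rule sum.cong[OF refl])
    fix y assume "y \<in> Pi\<^sub>E {..<n} (\<lambda>i. {e i..<e (Suc i)})"
    then have y: "strict_mono_on {..<n} y" by (rule interlacing_image_strict_mono[OF e])
    have "(\<Prod>x\<in>y ` {..<n}. w x) = (\<Prod>i<n. w (y i))"
      by (subst prod.reindex) (use strict_mono_on_imp_inj_on[OF y] in auto)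
    then show "(\<Prod>x\<in>y ` {..<n}. w x) * vand t (y ` {..<n}) = dt n (\<lambda>i j. w (y i) * (\<Prod>k<j. t (y i) - c k))"
      using dt_scale[of n "\<lambda>i. w (y i)" "\<lambda>_. 1" "\<lambda>i j. \<Prod>k<j. t (y i) - c k"] vand_dt[OF y, of t c] by simp
  qed
  also have "\<dots> = dt n (\<lambda>i j. \<Sum>x\<in>{e i..<e (Suc i)}. w x * (\<Prod>k<j. t x - c k))"
    by (rule dt_sum_rows) auto
  also have "\<dots> = dt n (\<lambda>i j. g j (e (Suc i)) - g j (e i))"
  proof (rule dt_cong)
    fix i j assume "i < n" "j < n"
    have "(\<Sum>x\<in>{e i..<e (Suc i)}. w x * (\<Prod>k<j. t x - c k)) = (\<Sum>x\<in>{e i..<e (Suc i)}. g j (x + 1) - g j x)"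
      using le[of 0 i] le[of "Suc i" n] \<open>i < n\<close> \<open>j < n\<close> by (intro sum.cong refl g[symmetric]) auto
    then show "(\<Sum>x\<in>{e i..<e (Suc i)}. w x * (\<Prod>k<j. t x - c k)) = g j (e (Suc i)) - g j (e i)"
      using sum_int_telescope[of "e i" "e (Suc i)" "g j"] le[of i "Suc i"] \<open>i < n\<close> by simp
  qed
  also have "\<dots> = dt (Suc n) (\<lambda>i j. if j = 0 then 1 else g (j - 1) (e i))"
    by (rule dt_bordered_diff)
  finally show ?thesis .
qed

text \<open>For the strips in which the number of positions drops by one. The antiderivatives of a
  Newton basis in \<open>t\<close> have degrees \<open>1, 2, ...\<close> in \<open>t'\<close>, and
  the border supplies the missing constant column.\<close>

lemma sum_interlacing_vand_up:
  assumes e: "strict_mono_on {..n} e"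
    and g: "\<And>x j. s j * ((\<Prod>k<Suc j. t' (x + 1) - c' k) - (\<Prod>k<Suc j. t' x - c' k)) = w x * (\<Prod>k<j. t x - c k)"
  shows "(\<Sum>Y\<in>interlacing e n. (\<Prod>x\<in>Y. w x) * vand t Y) = (\<Prod>j<n. s j) * vand t' (e ` {..n})"
proof -
  have "(\<Sum>Y\<in>interlacing e n. (\<Prod>x\<in>Y. w x) * vand t Y) =
      dt (Suc n) (\<lambda>i j. if j = 0 then 1 else s (j - 1) * (\<Prod>k<Suc (j - 1). t' (e i) - c' k))"
    by (rule sum_interlacing_vand[OF e, where c = c]) (simp only: g[symmetric] right_diff_distrib)
  also have "\<dots> = dt (Suc n) (\<lambda>i j. 1 * (if j = 0 then 1 else s (j - 1)) * (\<Prod>k<j. t' (e i) - c' k))"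
    by (rule dt_cong) auto
  also have "\<dots> = (\<Prod>j<Suc n. if j = 0 then 1 else s (j - 1)) * vand t' (e ` {..<Suc n})"
    using e by (subst dt_scale, subst vand_dt[of "Suc n" e t' c']) (auto simp: lessThan_Suc_atMost)
  also have "(\<Prod>j<Suc n. if j = 0 then 1 else s (j - 1)) = (\<Prod>j<n. s j)"
    by (subst prod.lessThan_Suc_shift) simp
  finally show ?thesis by (simp add: lessThan_Suc_atMost)
qed

text \<open>For the strips in which the zigzag moves outwards and \<open>e 0\<close> is a
  placeholder for the new leftmost position. The antiderivative is cut off to be zero at
  \<open>e 0\<close>, so that the border can be deleted; \<open>g0\<close> is the condition which
  this imposes at the first point.\<close>

lemma sum_interlacing_vand_down:
  assumes e: "strict_mono_on {..n} e"
    and g: "\<And>x j. e 0 < x \<Longrightarrow> s j * (w' (x + 1) * (\<Prod>k<j. t' (x + 1) - c' k) - w' x * (\<Prod>k<j. t' x - c' k)) = w x * (\<Prod>k<j. t x - c k)"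
    and g0: "\<And>j. s j * (w' (e 0 + 1) * (\<Prod>k<j. t' (e 0 + 1) - c' k)) = w (e 0) * (\<Prod>k<j. t (e 0) - c k)"
  shows "(\<Sum>Y\<in>interlacing e n. (\<Prod>x\<in>Y. w x) * vand t Y) =
    (\<Prod>j<n. s j) * ((\<Prod>x\<in>e ` {1..n}. w' x) * vand t' (e ` {1..n}))"
proof -
  define g where "g = (\<lambda>j x. if x \<le> e 0 then 0 else s j * (w' x * (\<Prod>k<j. t' x - c' k)))"
  have e': "strict_mono_on {..<n} (\<lambda>i. e (Suc i))"
    using e by (auto simp: strict_mono_on_def)
  have im: "(\<lambda>i. e (Suc i)) ` {..<n} = e ` {1..n}"
    using image_image[of e Suc "{..<n}"] by (simp add: image_Suc_lessThan)
  have "(\<Sum>Y\<in>interlacing e n. (\<Prod>x\<in>Y. w x) * vand t Y) = dt (Suc n) (\<lambda>i j. if j = 0 then 1 else g (j - 1) (e i))"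
  proof (rule sum_interlacing_vand[OF e, where c = c])
    fix x j assume "e 0 \<le> x"
    then show "g j (x + 1) - g j x = w x * (\<Prod>k<j. t x - c k)"
      using assms(2)[of x j] assms(3)[of j]
      by (cases "x = e 0") (auto simp: g_def right_diff_distrib)
  qed
  also have "\<dots> = dt n (\<lambda>i j. g j (e (Suc i)))"
    by (rule dt_first_row) (simp add: g_def)
  also have "\<dots> = dt n (\<lambda>i j. w' (e (Suc i)) * s j * (\<Prod>k<j. t' (e (Suc i)) - c' k))"
  proof (rule dt_cong)
    fix i j assume "i < n"
    then have "e 0 < e (Suc i)"
      using strict_mono_onD[OF e, of 0 "Suc i"] by simp
    then show "g j (e (Suc i)) = w' (e (Suc i)) * s j * (\<Prod>k<j. t' (e (Suc i)) - c' k)"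
      by (simp add: g_def)
  qed
  also have "\<dots> = (\<Prod>i<n. w' (e (Suc i))) * (\<Prod>j<n. s j) * vand t' (e ` {1..n})"
    unfolding dt_scale im[symmetric] vand_dt[OF e', of t' c'] ..
  also have "(\<Prod>i<n. w' (e (Suc i))) = (\<Prod>x\<in>e ` {1..n}. w' x)"
    unfolding im[symmetric] by (subst prod.reindex) (use strict_mono_on_imp_inj_on[OF e'] in auto)
  finally show ?thesis by (simp add: mult_ac)
qed

section \<open>Central factorials and their differences\<close>

definition central :: "real \<Rightarrow> nat \<Rightarrow> real" where
  "central x j = (\<Prod>k<j. (x + 1 + real k) * (x - real k))"

lemma central_0 [simp]: "central x 0 = 1"
  by (simp add: central_def)

lemma central_Suc [simp]: "central x (Suc j) = central x j * ((x + 1 + real j) * (x - real j))"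
  by (simp add: central_def)

text \<open>The products at \<open>x\<close> and at \<open>x + 1\<close> have the factor
  \<open>central x j\<close> in common, so their difference reduces to that of the few linear
  factors left over.\<close>

lemma prod_even_central:
  "(\<Prod>k<Suc j. x\<^sup>2 - (real k)\<^sup>2) = x * (x - real j) * central x j"
  "(\<Prod>k<Suc j. (x + 1)\<^sup>2 - (real k)\<^sup>2) = (x + 1) * (x + 1 + real j) * central x j"
proof (induction j)
  case (Suc j)
  show "(\<Prod>k<Suc (Suc j). x\<^sup>2 - (real k)\<^sup>2) = x * (x - real (Suc j)) * central x (Suc j)"
    unfolding prod.lessThan_Suc[of _ "Suc j"] Suc by (simp add: power2_eq_square algebra_simps)
  show "(\<Prod>k<Suc (Suc j). (x + 1)\<^sup>2 - (real k)\<^sup>2) = (x + 1) * (x + 1 + real (Suc j)) * central x (Suc j)"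
    unfolding prod.lessThan_Suc[of _ "Suc j"] Suc by (simp add: power2_eq_square algebra_simps)
qed (auto simp: power2_eq_square)

lemma prod_odd_central:
  "x * (\<Prod>k<j. x\<^sup>2 - (real k + 1)\<^sup>2) = (x - real j) * central x j"
  "(x + 1) * (\<Prod>k<j. (x + 1)\<^sup>2 - (real k + 1)\<^sup>2) = (x + 1 + real j) * central x j"
proof (induction j)
  case (Suc j)
  show "x * (\<Prod>k<Suc j. x\<^sup>2 - (real k + 1)\<^sup>2) = (x - real (Suc j)) * central x (Suc j)"
    unfolding prod.lessThan_Suc mult.assoc[symmetric] Suc by (simp add: power2_eq_square algebra_simps)
  show "(x + 1) * (\<Prod>k<Suc j. (x + 1)\<^sup>2 - (real k + 1)\<^sup>2) = (x + 1 + real (Suc j)) * central x (Suc j)"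
    unfolding prod.lessThan_Suc mult.assoc[symmetric] Suc by (simp add: power2_eq_square algebra_simps)
qed auto

lemma prod_half_central:
  "(\<Prod>k<j. (x + 1/2)\<^sup>2 - (real k + 1/2)\<^sup>2) = central x j"
  unfolding central_def by (rule prod.cong) (auto simp: power2_eq_square field_simps)

lemma prod_half_central':
  "(\<Prod>k<j. (x - 1/2)\<^sup>2 - (real k + 1/2)\<^sup>2) = central (x - 1) j"
  using prod_half_central[of "x - 1" j] by (simp add: algebra_simps)

lemma central_half_Suc:
  "central x (Suc j) = (x + real j + 1) * (x * (\<Prod>k<j. x\<^sup>2 - (real k + 1)\<^sup>2))"
  "central (x - 1) (Suc j) = (x - real j - 1) * (x * (\<Prod>k<j. x\<^sup>2 - (real k + 1)\<^sup>2))"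
proof -
  show "central x (Suc j) = (x + real j + 1) * (x * (\<Prod>k<j. x\<^sup>2 - (real k + 1)\<^sup>2))"
    unfolding prod_odd_central(1) by (simp add: algebra_simps)
  have "x * (\<Prod>k<j. x\<^sup>2 - (real k + 1)\<^sup>2) = (x + real j) * central (x - 1) j"
    using prod_odd_central(2)[of "x - 1" j] by simp
  then show "central (x - 1) (Suc j) = (x - real j - 1) * (x * (\<Prod>k<j. x\<^sup>2 - (real k + 1)\<^sup>2))"
    by (simp add: algebra_simps)
qed

lemma prod_even_Suc:
  fixes x :: real
  shows "(\<Prod>k<Suc j. x\<^sup>2 - (real k)\<^sup>2) = x * (x * (\<Prod>k<j. x\<^sup>2 - (real k + 1)\<^sup>2))"
  by (subst prod.lessThan_Suc_shift) (simp add: power2_eq_square add.commute)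

text \<open>In this and the next three lemmas the unit difference exchanges even and odd central
  factorial polynomials and moves the grid by one half. The constants \<open>2 * j + 1\<close> and
  \<open>2 * j + 2\<close> are the degrees; they build up the factorials in the normalisations of
  \<open>KE\<close>, \<open>KO\<close>, \<open>QE\<close> and \<open>QO\<close>.\<close>

lemma difference_even:
  fixes x :: real
  shows "(\<Prod>k<Suc j. (x + 1)\<^sup>2 - (real k)\<^sup>2) - (\<Prod>k<Suc j. x\<^sup>2 - (real k)\<^sup>2) =
    (2 * real j + 2) * ((x + 1/2) * (\<Prod>k<j. (x + 1/2)\<^sup>2 - (real k + 1/2)\<^sup>2))"
  unfolding prod_even_central[where x = x and j = j] prod_half_central[where x = x and j = j] by (simp add: field_simps)

lemma difference_odd:
  fixes x :: real
  shows "(x + 1) * (\<Prod>k<j. (x + 1)\<^sup>2 - (real k + 1)\<^sup>2) - x * (\<Prod>k<j. x\<^sup>2 - (real k + 1)\<^sup>2) =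
    (2 * real j + 1) * (\<Prod>k<j. (x + 1/2)\<^sup>2 - (real k + 1/2)\<^sup>2)"
  unfolding prod_odd_central[where x = x and j = j] prod_half_central[where x = x and j = j] by (simp add: algebra_simps)

lemma difference_half:
  fixes x :: real
  shows "(x + 1/2) * (\<Prod>k<j. (x + 1/2)\<^sup>2 - (real k + 1/2)\<^sup>2) - (x - 1/2) * (\<Prod>k<j. (x - 1/2)\<^sup>2 - (real k + 1/2)\<^sup>2) =
    (2 * real j + 1) * (\<Prod>k<j. x\<^sup>2 - (real k)\<^sup>2)"
proof (cases j)
  case (Suc i)
  define P where "P = x * (\<Prod>k<i. x\<^sup>2 - (real k + 1)\<^sup>2)"
  show ?thesis
    unfolding Suc prod_half_central[where x = x] prod_half_central'[where x = x] central_half_Suc[where x = x] prod_even_Suc[where x = x] P_def[symmetric]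
    by (simp add: field_simps)
qed simp

lemma difference_half_Suc:
  fixes x :: real
  shows "(\<Prod>k<Suc j. (x + 1/2)\<^sup>2 - (real k + 1/2)\<^sup>2) - (\<Prod>k<Suc j. (x - 1/2)\<^sup>2 - (real k + 1/2)\<^sup>2) =
    (2 * real j + 2) * (x * (\<Prod>k<j. x\<^sup>2 - (real k + 1)\<^sup>2))"
proof -
  define P where "P = x * (\<Prod>k<j. x\<^sup>2 - (real k + 1)\<^sup>2)"
  show ?thesis
    unfolding prod_half_central[where x = x] prod_half_central'[where x = x] central_half_Suc[where x = x] P_def[symmetric] by (simp add: algebra_simps)
qed

text \<open>Numbers of tilings of a region with a zigzag west side and \<open>m\<close> removed unit triangles on the base,
  at the positions \<open>X\<close>. The letter \<open>K\<close> resp. \<open>Q\<close> refers to the zigzag of \<open>K'\<close> resp. \<open>Q\<close>, the letter \<open>E\<close>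
  resp. \<open>O\<close> to the parity of the level of the base, and \<open>lo\<close> is the leftmost position on the base.\<close>

definition KE :: "int \<Rightarrow> nat \<Rightarrow> int set \<Rightarrow> real" where
  "KE lo m X = vand (\<lambda>x. (of_int (x - lo))\<^sup>2) X / (\<Prod>j<m. fact (2 * j))"

definition KO :: "int \<Rightarrow> nat \<Rightarrow> int set \<Rightarrow> real" where
  "KO lo m X = (\<Prod>x\<in>X. of_int (x - lo) + 1/2) * vand (\<lambda>x. (of_int (x - lo) + 1/2)\<^sup>2) X / (\<Prod>j<m. fact (2 * j + 1))"

definition QE :: "int \<Rightarrow> nat \<Rightarrow> int set \<Rightarrow> real" where
  "QE lo m X = (\<Prod>x\<in>X. of_int (x - lo + 1)) * vand (\<lambda>x. (of_int (x - lo + 1))\<^sup>2) X / (\<Prod>j<m. fact (2 * j + 1))"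

definition QO :: "int \<Rightarrow> nat \<Rightarrow> int set \<Rightarrow> real" where
  "QO lo m X = vand (\<lambda>x. (of_int (x - lo) + 1/2)\<^sup>2) X / (\<Prod>j<m. fact (2 * j))"

text \<open>From an even to an odd line this zigzag recedes by half a unit and one position is lost.
  The even family on the integers is the antiderivative of the odd family on the
  half-integers.\<close>

lemma KE_step:
  fixes e :: "nat \<Rightarrow> int"
  assumes "strict_mono_on {..m} e"
  shows "KE lo (Suc m) (e ` {..m}) = (\<Sum>Y\<in>interlacing e m. KO lo m Y)"
proof -
  have "(\<Sum>Y\<in>interlacing e m. (\<Prod>x\<in>Y. of_int (x - lo) + 1/2) * vand (\<lambda>x. (of_int (x - lo) + 1/2)\<^sup>2) Y) =
      (\<Prod>j<m. 1 / (2 * real j + 2)) * vand (\<lambda>x. (of_int (x - lo))\<^sup>2) (e ` {..m})"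
  proof (rule sum_interlacing_vand_up[OF assms, where c = "\<lambda>k. (real k + 1/2)\<^sup>2" and c' = "\<lambda>k. (real k)\<^sup>2"])
    fix x :: int and j :: nat
    have 1: "of_int (x + 1 - lo) = of_int (x - lo) + (1 :: real)" and 2: "2 * real j + 2 \<noteq> 0" by auto
    show "1 / (2 * real j + 2) * ((\<Prod>k<Suc j. (of_int (x + 1 - lo))\<^sup>2 - (real k)\<^sup>2) - (\<Prod>k<Suc j. (of_int (x - lo))\<^sup>2 - (real k)\<^sup>2)) =
       (of_int (x - lo) + 1/2) * (\<Prod>k<j. (of_int (x - lo) + 1/2)\<^sup>2 - (real k + 1/2)\<^sup>2)"
      unfolding 1 difference_even using 2 by simp
  qed
  moreover have "(\<Prod>j<Suc m. fact (2 * j) :: real) = (\<Prod>j<m. (2 * real j + 2) * fact (2 * j + 1))"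
    by (subst prod.lessThan_Suc_shift) (simp add: algebra_simps)
  ultimately show ?thesis
    by (simp only: KE_def KO_def sum_divide_distrib[symmetric]) (simp add: prod.distrib prod_dividef)
qed

text \<open>From an odd to an even line the zigzag advances, and its corner \<open>lo - 1\<close>
  becomes the placeholder \<open>e 0\<close>, where the variable is 0. Starting the odd
  antiderivative from 0 instead of from its value at \<open>- 1/2\<close> halves the first
  difference, and this is exactly the weight of a lozenge at the corner.\<close>

lemma KO_step:
  assumes "strict_mono_on {..m} e" "e 0 = lo - 1"
  shows "KO lo m (e ` {1..m}) = (\<Sum>Y\<in>interlacing e m. (\<Prod>x\<in>Y. if x = lo - 1 then 1/2 else 1) * KE (lo - 1) m Y)"
proof -
  have "(\<Sum>Y\<in>interlacing e m. (\<Prod>x\<in>Y. if x = lo - 1 then 1/2 else 1) * vand (\<lambda>x. (of_int (x - (lo - 1)))\<^sup>2) Y) =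
      (\<Prod>j<m. 1 / (2 * real j + 1)) * ((\<Prod>x\<in>e ` {1..m}. of_int (x - lo) + 1/2) * vand (\<lambda>x. (of_int (x - lo) + 1/2)\<^sup>2) (e ` {1..m}))"
  proof (rule sum_interlacing_vand_down[OF assms(1), where c' = "\<lambda>k. (real k + 1/2)\<^sup>2" and c = "\<lambda>k. (real k)\<^sup>2"])
    fix x :: int and j :: nat
    assume x: "e 0 < x"
    have 1: "of_int (x + 1 - lo) + 1/2 = of_int (x - (lo - 1)) + (1/2 :: real)"
      "of_int (x - lo) + 1/2 = of_int (x - (lo - 1)) - (1/2 :: real)" by auto
    show "1 / (2 * real j + 1) *
        ((of_int (x + 1 - lo) + 1/2) * (\<Prod>k<j. (of_int (x + 1 - lo) + 1/2)\<^sup>2 - (real k + 1/2)\<^sup>2) -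
         (of_int (x - lo) + 1/2) * (\<Prod>k<j. (of_int (x - lo) + 1/2)\<^sup>2 - (real k + 1/2)\<^sup>2)) =
       (if x = lo - 1 then 1/2 else 1) * (\<Prod>k<j. (of_int (x - (lo - 1)))\<^sup>2 - (real k)\<^sup>2)"
      unfolding 1 difference_half using x assms(2) by simp
  next
    fix j :: nat
    \<comment> \<open>For \<open>j = 0\<close> both sides are \<open>1 / 2\<close>; for
      \<open>j > 0\<close> both contain a vanishing factor with \<open>k = 0\<close>.\<close>
    show "1 / (2 * real j + 1) *
        ((of_int (e 0 + 1 - lo) + 1/2) * (\<Prod>k<j. (of_int (e 0 + 1 - lo) + 1/2)\<^sup>2 - (real k + 1/2)\<^sup>2)) =
       (if e 0 = lo - 1 then 1/2 else 1) * (\<Prod>k<j. (of_int (e 0 - (lo - 1)))\<^sup>2 - (real k)\<^sup>2)"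
      using assms(2) by (cases j) (auto simp: prod.lessThan_Suc_shift simp del: prod.lessThan_Suc)
  qed
  moreover have "(\<Prod>j<m. fact (2 * j + 1) :: real) = (\<Prod>j<m. (2 * real j + 1) * fact (2 * j))"
    by (simp add: algebra_simps)
  ultimately show ?thesis
    by (simp only: KE_def KO_def sum_divide_distrib[symmetric] times_divide_eq_right) (simp add: prod.distrib prod_dividef)
qed

text \<open>Here the variable \<open>x - lo + 1\<close> is zero at the placeholder
  \<open>e 0 = lo - 1\<close>, so the odd antiderivative vanishes there of its own accord and the
  first difference has full weight.\<close>

lemma QE_step:
  assumes "strict_mono_on {..m} e" "e 0 = lo - 1"
  shows "QE lo m (e ` {1..m}) = (\<Sum>Y\<in>interlacing e m. QO (lo - 1) m Y)"
proof -
  have "(\<Sum>Y\<in>interlacing e m. (\<Prod>x\<in>Y. 1) * vand (\<lambda>x. (of_int (x - (lo - 1)) + 1/2)\<^sup>2) Y) =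
      (\<Prod>j<m. 1 / (2 * real j + 1)) * ((\<Prod>x\<in>e ` {1..m}. of_int (x - lo + 1)) * vand (\<lambda>x. (of_int (x - lo + 1))\<^sup>2) (e ` {1..m}))"
  proof (rule sum_interlacing_vand_down[OF assms(1), where c = "\<lambda>k. (real k + 1/2)\<^sup>2" and c' = "\<lambda>k. (real k + 1)\<^sup>2"])
    fix x :: int and j :: nat
    have 1: "of_int (x + 1 - lo + 1) = of_int (x - lo + 1) + (1 :: real)"
      "of_int (x - (lo - 1)) = (of_int (x - lo + 1) :: real)" by auto
    show *: "1 / (2 * real j + 1) *
        (of_int (x + 1 - lo + 1) * (\<Prod>k<j. (of_int (x + 1 - lo + 1))\<^sup>2 - (real k + 1)\<^sup>2) -
         of_int (x - lo + 1) * (\<Prod>k<j. (of_int (x - lo + 1))\<^sup>2 - (real k + 1)\<^sup>2)) =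
       1 * (\<Prod>k<j. (of_int (x - (lo - 1)) + 1/2)\<^sup>2 - (real k + 1/2)\<^sup>2)"
      unfolding 1 difference_odd by simp
  next
    fix j :: nat
    show "1 / (2 * real j + 1) *
        (of_int (e 0 + 1 - lo + 1) * (\<Prod>k<j. (of_int (e 0 + 1 - lo + 1))\<^sup>2 - (real k + 1)\<^sup>2)) =
       1 * (\<Prod>k<j. (of_int (e 0 - (lo - 1)) + 1/2)\<^sup>2 - (real k + 1/2)\<^sup>2)"
      using difference_odd[where x = 0 and j = j] assms(2) by simp
  qed
  moreover have "(\<Prod>j<m. fact (2 * j + 1) :: real) = (\<Prod>j<m. (2 * real j + 1) * fact (2 * j))"
    by (simp add: algebra_simps)
  ultimately show ?thesis
    by (simp only: QE_def QO_def sum_divide_distrib[symmetric]) (simp add: prod.distrib prod_dividef)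
qed

text \<open>The zigzag recedes as in \<open>KE_step\<close>, with integers and half-integers
  exchanged.\<close>

lemma QO_step:
  assumes "strict_mono_on {..m} e"
  shows "QO lo (Suc m) (e ` {..m}) = (\<Sum>Y\<in>interlacing e m. QE lo m Y)"
proof -
  have "(\<Sum>Y\<in>interlacing e m. (\<Prod>x\<in>Y. of_int (x - lo + 1)) * vand (\<lambda>x. (of_int (x - lo + 1))\<^sup>2) Y) =
      (\<Prod>j<m. 1 / (2 * real j + 2)) * vand (\<lambda>x. (of_int (x - lo) + 1/2)\<^sup>2) (e ` {..m})"
  proof (rule sum_interlacing_vand_up[OF assms, where c' = "\<lambda>k. (real k + 1/2)\<^sup>2" and c = "\<lambda>k. (real k + 1)\<^sup>2"])
    fix x :: int and j :: nat
    have 1: "of_int (x + 1 - lo) + 1/2 = of_int (x - lo + 1) + (1/2 :: real)"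
      "of_int (x - lo) + 1/2 = of_int (x - lo + 1) - (1/2 :: real)" by auto
    show "1 / (2 * real j + 2) * ((\<Prod>k<Suc j. (of_int (x + 1 - lo) + 1/2)\<^sup>2 - (real k + 1/2)\<^sup>2) -
          (\<Prod>k<Suc j. (of_int (x - lo) + 1/2)\<^sup>2 - (real k + 1/2)\<^sup>2)) =
       of_int (x - lo + 1) * (\<Prod>k<j. (of_int (x - lo + 1))\<^sup>2 - (real k + 1)\<^sup>2)"
      unfolding 1 difference_half_Suc by (simp add: divide_simps)
  qed
  moreover have "(\<Prod>j<Suc m. fact (2 * j) :: real) = (\<Prod>j<m. (2 * real j + 2) * fact (2 * j + 1))"
    by (subst prod.lessThan_Suc_shift) (simp add: algebra_simps)
  ultimately show ?thesis
    by (simp only: QE_def QO_def sum_divide_distrib[symmetric]) (simp add: prod.distrib prod_dividef)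
qed

section \<open>Splitting tilings along a horizontal line\<close>

definition lattice_point :: "int \<Rightarrow> int \<Rightarrow> point" where
  "lattice_point j k = (of_int j + of_int k / 2, k)"

lemma lattice_point_eq [simp]: "lattice_point j k = lattice_point j' k' \<longleftrightarrow> j = j' \<and> k = k'"
  by (auto simp: lattice_point_def)

lemma corners_Up: "corners (Up j k) = {lattice_point j k, lattice_point (j + 1) k, lattice_point j (k + 1)}"
  by (simp add: lattice_point_def)

lemma corners_Down: "corners (Down j k) = {lattice_point j k, lattice_point (j + 1) k, lattice_point (j + 1) (k - 1)}"
  by (simp add: lattice_point_def field_simps)

declare corners.simps [simp del]

lemma common_corners_Up_Up:
  assumes "card (corners (Up j k) \<inter> corners (Up j' k')) = 2"
  shows "Up j k = Up j' k'"
proof -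
  obtain p q where "p \<noteq> q" "corners (Up j k) \<inter> corners (Up j' k') = {p, q}"
    using assms by (auto simp: card_2_iff)
  then have "p \<in> corners (Up j k)" "q \<in> corners (Up j k)" "p \<in> corners (Up j' k')" "q \<in> corners (Up j' k')" "p \<noteq> q"
    by blast+
  then show ?thesis
    unfolding corners_Up by (elim insertE emptyE; simp)
qed

lemma common_corners_Down_Down:
  assumes "card (corners (Down j k) \<inter> corners (Down j' k')) = 2"
  shows "Down j k = Down j' k'"
proof -
  obtain p q where "p \<noteq> q" "corners (Down j k) \<inter> corners (Down j' k') = {p, q}"
    using assms by (auto simp: card_2_iff)
  then have "p \<in> corners (Down j k)" "q \<in> corners (Down j k)" "p \<in> corners (Down j' k')" "q \<in> corners (Down j' k')" "p \<noteq> q"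
    by blast+
  then show ?thesis
    unfolding corners_Down by (elim insertE emptyE; simp)
qed

lemma common_corners_Up_Down:
  "card (corners (Up j k) \<inter> corners (Down j' k')) = 2 \<longleftrightarrow>
    (j' = j \<and> k' = k) \<or> (j' = j \<and> k' = k + 1) \<or> (j' = j - 1 \<and> k' = k + 1)"
proof
  assume "card (corners (Up j k) \<inter> corners (Down j' k')) = 2"
  then obtain p q where "p \<noteq> q" "corners (Up j k) \<inter> corners (Down j' k') = {p, q}"
    by (auto simp: card_2_iff)
  then have "p \<in> corners (Up j k)" "q \<in> corners (Up j k)" "p \<in> corners (Down j' k')" "q \<in> corners (Down j' k')" "p \<noteq> q"
    by blast+
  then show "(j' = j \<and> k' = k) \<or> (j' = j \<and> k' = k + 1) \<or> (j' = j - 1 \<and> k' = k + 1)"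
    unfolding corners_Up corners_Down by (elim insertE emptyE; simp)
next
  assume "(j' = j \<and> k' = k) \<or> (j' = j \<and> k' = k + 1) \<or> (j' = j - 1 \<and> k' = k + 1)"
  then show "card (corners (Up j k) \<inter> corners (Down j' k')) = 2"
    unfolding corners_Up corners_Down by auto
qed

text \<open>Oriented from the up-pointing to the down-pointing triangle; the three cases are the
  neighbours below, on the right and on the left.\<close>

definition adjacent :: "utriangle \<Rightarrow> utriangle \<Rightarrow> bool" where
  "adjacent s t \<longleftrightarrow> (\<exists>j k. s = Up j k \<and> (t = Down j k \<or> t = Down j (k + 1) \<or> t = Down (j - 1) (k + 1)))"

lemma lozenge_adjacent: "lozenge {s, t} \<longleftrightarrow> adjacent s t \<or> adjacent t s"
proof -
  have *: "s \<noteq> t \<and> card (corners s \<inter> corners t) = 2 \<longleftrightarrow> adjacent s t \<or> adjacent t s" for s t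
  proof (cases s; cases t)
    fix j k j' k' assume "s = Up j k" "t = Up j' k'"
    then show ?thesis using common_corners_Up_Up[of j k j' k'] by (auto simp: adjacent_def)
  next
    fix j k j' k' assume "s = Down j k" "t = Down j' k'"
    then show ?thesis using common_corners_Down_Down[of j k j' k'] by (auto simp: adjacent_def)
  next
    fix j k j' k' assume "s = Up j k" "t = Down j' k'"
    then show ?thesis using common_corners_Up_Down[of j k j' k'] by (auto simp: adjacent_def)
  next
    fix j k j' k' assume "s = Down j k" "t = Up j' k'"
    then show ?thesis
      using common_corners_Up_Down[of j' k' j k] Int_commute[of "corners s" "corners t"] by (auto simp: adjacent_def)
  qed
  have "lozenge {s, t} \<longleftrightarrow> s \<noteq> t \<and> card (corners s \<inter> corners t) = 2"
  proof
    assume "lozenge {s, t}"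
    then obtain s' t' where *: "s' \<noteq> t'" "card (corners s' \<inter> corners t') = 2" "{s, t} = {s', t'}"
      by (auto simp: lozenge_def)
    then consider "s = s'" "t = t'" | "s = t'" "t = s'" by (auto simp: doubleton_eq_iff)
    then show "s \<noteq> t \<and> card (corners s \<inter> corners t) = 2"
      using * Int_commute[of "corners s" "corners t"] by cases auto
  qed (auto simp: lozenge_def)
  with *[of s t] show ?thesis by blast
qed

lemma lozengeE:
  assumes "lozenge l"
  obtains s t where "l = {s, t}" "s \<noteq> t" "adjacent s t"
proof -
  obtain s t where l: "l = {s, t}" "s \<noteq> t" using assms by (auto simp: lozenge_def)
  then have "adjacent s t \<or> adjacent t s" using assms lozenge_adjacent by simp
  then show ?thesis using l that[of s t] that[of t s] by auto
qed

lemma tilings_subset_Pow: "tilings R \<subseteq> Pow (Pow R)"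
  by (auto simp: tilings_def partition_on_def)

lemma finite_tilings: "finite R \<Longrightarrow> finite (tilings R)"
  using finite_subset[OF tilings_subset_Pow] by simp

lemma finite_tiling:
  assumes "P \<in> tilings R" "finite R"
  shows "finite P"
  using assms tilings_subset_Pow[of R] finite_subset[of P "Pow R"] by auto

lemma tilingsD:
  assumes "P \<in> tilings R"
  shows "\<Union>P = R" "\<And>l. l \<in> P \<Longrightarrow> lozenge l" "\<And>l. l \<in> P \<Longrightarrow> l \<subseteq> R"
    "\<And>l l' x. l \<in> P \<Longrightarrow> l' \<in> P \<Longrightarrow> x \<in> l \<Longrightarrow> x \<in> l' \<Longrightarrow> l = l'"
  using assms by (auto simp: tilings_def partition_on_def disjoint_def)

lemma tilingsI:
  assumes "\<Union>P = R" "\<And>l. l \<in> P \<Longrightarrow> lozenge l"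
    "\<And>l l' x. l \<in> P \<Longrightarrow> l' \<in> P \<Longrightarrow> x \<in> l \<Longrightarrow> x \<in> l' \<Longrightarrow> l = l'"
  shows "P \<in> tilings R"
proof -
  have "l \<noteq> {}" if "l \<in> P" for l
    using assms(2)[OF that] by (auto elim: lozengeE)
  moreover have "disjoint P"
  proof (rule disjointI)
    fix l l' assume "l \<in> P" "l' \<in> P" "l \<noteq> l'"
    then show "l \<inter> l' = {}" using assms(3)[of l l'] by blast
  qed
  ultimately show ?thesis
    using assms(1,2) by (auto simp: tilings_def partition_on_def)
qed

lemma tilings_empty [simp]: "tilings {} = {{}}"
  by (auto simp: tilings_def partition_on_def)

lemma M_empty [simp]: "M w {} = 1"
  by (simp add: M_def)

definition vert :: "int \<Rightarrow> int \<Rightarrow> utriangle set" where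
  "vert h j = {Up j h, Down j h}"

lemma lozenge_vert: "lozenge (vert h j)"
  unfolding vert_def lozenge_adjacent by (auto simp: adjacent_def)

lemma inj_vert: "inj (vert h)"
  by (auto simp: inj_def vert_def doubleton_eq_iff)

lemma tilings_subset:
  assumes "P \<in> tilings R" "\<Union>S = R'" "S \<subseteq> P"
  shows "S \<in> tilings R'"
proof (rule tilingsI)
  show "lozenge l" if "l \<in> S" for l
    using tilingsD(2)[OF assms(1)] assms(3) that by blast
  show "l = l'" if "l \<in> S" "l' \<in> S" "x \<in> l" "x \<in> l'" for l l' x
    using tilingsD(4)[OF assms(1) _ _ that(3,4)] assms(3) that(1,2) by blast
qed (rule assms(2))

lemma tilings_Un:
  assumes "P \<in> tilings A" "S \<in> tilings B" "A \<inter> B = {}"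
  shows "P \<union> S \<in> tilings (A \<union> B)"
proof (rule tilingsI)
  show "\<Union> (P \<union> S) = A \<union> B"
    using tilingsD(1)[OF assms(1)] tilingsD(1)[OF assms(2)] by auto
  show "lozenge l" if "l \<in> P \<union> S" for l
    using tilingsD(2)[OF assms(1)] tilingsD(2)[OF assms(2)] that by blast
  have *: False if "l \<in> P" "l' \<in> S" "x \<in> l" "x \<in> l'" for l l' x
    using tilingsD(3)[OF assms(1) that(1)] tilingsD(3)[OF assms(2) that(2)] that assms(3) by blast
  show "l = l'" if l: "l \<in> P \<union> S" "l' \<in> P \<union> S" "x \<in> l" "x \<in> l'" for l l' x
  proof (cases "l \<in> P"; cases "l' \<in> P")
    assume "l \<in> P" "l' \<in> P"
    then show ?thesis using tilingsD(4)[OF assms(1)] l by blast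
  next
    assume "l \<in> P" "l' \<notin> P"
    then show ?thesis using *[of l l' x] l by blast
  next
    assume "l \<notin> P" "l' \<in> P"
    then show ?thesis using *[of l' l x] l by blast
  next
    assume "l \<notin> P" "l' \<notin> P"
    then have "l \<in> S" "l' \<in> S" using l by blast+
    then show ?thesis using tilingsD(4)[OF assms(2)] l by blast
  qed
qed

lemma tilings_vert: "vert h ` V \<in> tilings ((\<lambda>j. Down j h) ` V \<union> (\<lambda>j. Up j h) ` V)"
proof (rule tilingsI)
  show "\<Union> (vert h ` V) = (\<lambda>j. Down j h) ` V \<union> (\<lambda>j. Up j h) ` V"
    by (auto simp: vert_def)
  show "lozenge l" if "l \<in> vert h ` V" for l
    using that lozenge_vert by blast
  show "l = l'" if "l \<in> vert h ` V" "l' \<in> vert h ` V" "x \<in> l" "x \<in> l'" for l l' x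
    using that by (auto simp: vert_def)
qed

text \<open>By \<open>cross\<close> every lozenge lies in one part or is some
  \<open>vert h j\<close>, so a tiling amounts to a set \<open>V\<close> of crossing positions and a
  tiling of what \<open>V\<close> leaves of each part. Sets \<open>V\<close> that leave no tiling
  contribute zero.\<close>

lemma M_split:
  assumes fin: "finite R1" "finite R2" and disj: "R1 \<inter> R2 = {}"
    and cross: "\<And>s t. s \<in> R1 \<Longrightarrow> t \<in> R2 \<Longrightarrow> lozenge {s, t} \<Longrightarrow> \<exists>j. s = Down j h \<and> t = Up j h"
  shows "M w (R1 \<union> R2) = (\<Sum>V\<in>Pow {j. Down j h \<in> R1 \<and> Up j h \<in> R2}.
    (\<Prod>j\<in>V. w (vert h j)) * M w (R1 - (\<lambda>j. Down j h) ` V) * M w (R2 - (\<lambda>j. Up j h) ` V))"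
proof -
  define W where "W = {j. Down j h \<in> R1 \<and> Up j h \<in> R2}"
  let ?A = "\<lambda>V. R1 - (\<lambda>j. Down j h) ` V" and ?B = "\<lambda>V. R2 - (\<lambda>j. Up j h) ` V"
  have "(\<lambda>j. Down j h) ` W \<subseteq> R1" by (auto simp: W_def)
  then have finW: "finite W"
    using fin(1) by (meson finite_imageD finite_subset injI utriangle.inject(2) inj_on_subset subset_UNIV)
  have cases: "l \<subseteq> R1 \<or> l \<subseteq> R2 \<or> (\<exists>j\<in>W. l = vert h j)" if sub: "l \<subseteq> R1 \<union> R2" and loz: "lozenge l" for l
  proof -
    obtain s t where l: "l = {s, t}" using loz by (auto elim: lozengeE)
    then have *: "lozenge {s, t}" "lozenge {t, s}" using loz by (auto simp: insert_commute)
    show ?thesis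
      using sub cross[OF _ _ *(1)] cross[OF _ _ *(2)] unfolding l W_def vert_def by blast
  qed
  have vertR: "\<not> vert h j \<subseteq> R1" "\<not> vert h j \<subseteq> R2" if "j \<in> W" for j
    using that disj by (auto simp: W_def vert_def)
  have "(\<Sum>V\<in>Pow W. (\<Prod>j\<in>V. w (vert h j)) * M w (?A V) * M w (?B V)) =
      (\<Sum>V\<in>Pow W. \<Sum>(P1, P2)\<in>tilings (?A V) \<times> tilings (?B V). (\<Prod>j\<in>V. w (vert h j)) * (\<Prod>l\<in>P1. w l) * (\<Prod>l\<in>P2. w l))"
  proof (rule sum.cong[OF refl])
    fix V
    have "c * sum f A * sum g B = (\<Sum>(p, q)\<in>A \<times> B. c * f p * g q)" for c :: real and f g :: "utriangle set set \<Rightarrow> real" and A B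
    proof -
      have "c * sum f A * sum g B = c * (\<Sum>p\<in>A. \<Sum>q\<in>B. f p * g q)"
        by (simp only: mult.assoc sum_product)
      also have "\<dots> = (\<Sum>p\<in>A. \<Sum>q\<in>B. c * f p * g q)"
        by (simp only: sum_distrib_left mult.assoc)
      finally show ?thesis by (simp only: sum.cartesian_product)
    qed
    then show "(\<Prod>j\<in>V. w (vert h j)) * M w (?A V) * M w (?B V) =
        (\<Sum>(P1, P2)\<in>tilings (?A V) \<times> tilings (?B V). (\<Prod>j\<in>V. w (vert h j)) * (\<Prod>l\<in>P1. w l) * (\<Prod>l\<in>P2. w l))"
      unfolding M_def .
  qed
  also have "\<dots> = (\<Sum>(V, P1, P2)\<in>(SIGMA V:Pow W. tilings (?A V) \<times> tilings (?B V)).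
      (\<Prod>j\<in>V. w (vert h j)) * (\<Prod>l\<in>P1. w l) * (\<Prod>l\<in>P2. w l))"
    using finW fin by (subst sum.Sigma) (auto simp: finite_tilings)
  also have "\<dots> = (\<Sum>P\<in>tilings (R1 \<union> R2). \<Prod>l\<in>P. w l)"
  proof (rule sum.reindex_bij_witness[where
        i = "\<lambda>P. ({j \<in> W. vert h j \<in> P}, {l \<in> P. l \<subseteq> R1}, {l \<in> P. l \<subseteq> R2})" and
        j = "\<lambda>(V, P1, P2). vert h ` V \<union> P1 \<union> P2"])
    fix a assume "a \<in> (SIGMA V:Pow W. tilings (?A V) \<times> tilings (?B V))"
    then obtain V P1 P2 where a: "a = (V, P1, P2)" and V: "V \<subseteq> W"
      and P1: "P1 \<in> tilings (?A V)" and P2: "P2 \<in> tilings (?B V)" by auto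
    let ?P = "vert h ` V \<union> P1 \<union> P2"
    have sub1: "l \<subseteq> R1" "\<not> l \<subseteq> R2" "\<And>j. j \<in> W \<Longrightarrow> l \<noteq> vert h j" if "l \<in> P1" for l
    proof -
      show 1: "l \<subseteq> R1" using tilingsD(3)[OF P1 that] by auto
      have "l \<noteq> {}" using tilingsD(2)[OF P1 that] by (auto elim: lozengeE)
      then show "\<not> l \<subseteq> R2" using 1 disj by blast
      show "l \<noteq> vert h j" if "j \<in> W" for j using 1 vertR[OF that] by blast
    qed
    have sub2: "l \<subseteq> R2" "\<not> l \<subseteq> R1" "\<And>j. j \<in> W \<Longrightarrow> l \<noteq> vert h j" if "l \<in> P2" for l
    proof -
      show 1: "l \<subseteq> R2" using tilingsD(3)[OF P2 that] by auto
      have "l \<noteq> {}" using tilingsD(2)[OF P2 that] by (auto elim: lozengeE)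
      then show "\<not> l \<subseteq> R1" using 1 disj by blast
      show "l \<noteq> vert h j" if "j \<in> W" for j using 1 vertR[OF that] by blast
    qed
    have inV: "vert h j \<in> ?P \<longleftrightarrow> j \<in> V" if "j \<in> W" for j
    proof -
      have "vert h j \<notin> P1" "vert h j \<notin> P2" using sub1(3)[OF _ that] sub2(3)[OF _ that] by blast+
      then show ?thesis by (simp add: inj_image_mem_iff[OF inj_vert])
    qed
    have vV: "\<not> l \<subseteq> R1 \<and> \<not> l \<subseteq> R2 \<and> l \<notin> P1 \<and> l \<notin> P2" if lV: "l \<in> vert h ` V" for l
    proof -
      obtain j where j: "j \<in> W" "l = vert h j" using lV V by blast
      then show ?thesis using vertR[OF j(1)] sub1(1)[of l] sub2(1)[of l] by blast
    qed
    have "{j \<in> W. vert h j \<in> ?P} = V"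
    proof (rule Set.set_eqI)
      show "j \<in> {j \<in> W. vert h j \<in> ?P} \<longleftrightarrow> j \<in> V" for j
        using inV[of j] V by blast
    qed
    moreover have "{l \<in> ?P. l \<subseteq> R1} = P1"
    proof (rule Set.set_eqI)
      show "l \<in> {l \<in> ?P. l \<subseteq> R1} \<longleftrightarrow> l \<in> P1" for l
        using sub1(1)[of l] sub2(2)[of l] vV[of l] by blast
    qed
    moreover have "{l \<in> ?P. l \<subseteq> R2} = P2"
    proof (rule Set.set_eqI)
      show "l \<in> {l \<in> ?P. l \<subseteq> R2} \<longleftrightarrow> l \<in> P2" for l
        using sub1(2)[of l] sub2(1)[of l] vV[of l] by blast
    qed
    ultimately show "(\<lambda>P. ({j \<in> W. vert h j \<in> P}, {l \<in> P. l \<subseteq> R1}, {l \<in> P. l \<subseteq> R2})) (case a of (V, P1, P2) \<Rightarrow> vert h ` V \<union> P1 \<union> P2) = a"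
      by (simp add: a)
    show "(case a of (V, P1, P2) \<Rightarrow> vert h ` V \<union> P1 \<union> P2) \<in> tilings (R1 \<union> R2)"
    proof -
      have D: "(\<lambda>j. Down j h) ` V \<subseteq> R1" and U: "(\<lambda>j. Up j h) ` V \<subseteq> R2"
        using V by (auto simp: W_def)
      have "vert h ` V \<union> P1 \<union> P2 \<in> tilings (((\<lambda>j. Down j h) ` V \<union> (\<lambda>j. Up j h) ` V) \<union> ?A V \<union> ?B V)"
        using D U disj by (intro tilings_Un tilings_vert P1 P2) blast+
      also have "((\<lambda>j. Down j h) ` V \<union> (\<lambda>j. Up j h) ` V) \<union> ?A V \<union> ?B V = R1 \<union> R2"
        using D U by blast
      finally show ?thesis by (simp add: a)
    qed
    have fP: "finite P1" "finite P2" "finite V"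
      using finite_tiling[OF P1] finite_tiling[OF P2] fin finite_subset[OF V finW] by auto
    have "(\<Prod>l\<in>?P. w l) = (\<Prod>l\<in>vert h ` V. w l) * (\<Prod>l\<in>P1. w l) * (\<Prod>l\<in>P2. w l)"
    proof -
      have "(vert h ` V) \<inter> P1 = {}" using vV by blast
      moreover have "l \<notin> P2" if "l \<in> vert h ` V \<union> P1" for l
        using vV[of l] sub1(2)[of l] sub2(1)[of l] that by blast
      then have "(vert h ` V \<union> P1) \<inter> P2 = {}" by blast
      ultimately show ?thesis using fP by (simp add: prod.union_disjoint)
    qed
    also have "(\<Prod>l\<in>vert h ` V. w l) = (\<Prod>j\<in>V. w (vert h j))"
      by (subst prod.reindex) (auto intro: inj_on_subset[OF inj_vert])
    finally show "(\<Prod>l\<in>(case a of (V, P1, P2) \<Rightarrow> vert h ` V \<union> P1 \<union> P2). w l) =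
        (case a of (V, P1, P2) \<Rightarrow> (\<Prod>j\<in>V. w (vert h j)) * (\<Prod>l\<in>P1. w l) * (\<Prod>l\<in>P2. w l))"
      by (simp add: a)
  next
    fix P assume P: "P \<in> tilings (R1 \<union> R2)"
    define V where "V = {j \<in> W. vert h j \<in> P}"
    have VW: "V \<subseteq> W" by (auto simp: V_def)
    have lc: "l \<subseteq> R1 \<or> l \<subseteq> R2 \<or> (\<exists>j\<in>V. l = vert h j)" if "l \<in> P" for l
      using cases[OF tilingsD(3)[OF P that] tilingsD(2)[OF P that]] that by (auto simp: V_def)
    then show "(\<lambda>(V, P1, P2). vert h ` V \<union> P1 \<union> P2) ({j \<in> W. vert h j \<in> P}, {l \<in> P. l \<subseteq> R1}, {l \<in> P. l \<subseteq> R2}) = P"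
      unfolding V_def[symmetric] prod.case by (auto simp: V_def)
    have "{l \<in> P. l \<subseteq> R1} \<in> tilings (?A V)"
    proof (rule tilings_subset[OF P])
      show "\<Union> {l \<in> P. l \<subseteq> R1} = ?A V"
      proof
        show "\<Union> {l \<in> P. l \<subseteq> R1} \<subseteq> ?A V"
        proof
          fix x assume "x \<in> \<Union> {l \<in> P. l \<subseteq> R1}"
          then obtain l where l: "l \<in> P" "l \<subseteq> R1" "x \<in> l" by auto
          have "x \<notin> (\<lambda>j. Down j h) ` V"
          proof
            assume "x \<in> (\<lambda>j. Down j h) ` V"
            then obtain j where j: "j \<in> V" "x = Down j h" by auto
            then have "vert h j \<in> P" "x \<in> vert h j" by (auto simp: V_def vert_def)
            then have "l = vert h j" using tilingsD(4)[OF P l(1) _ l(3)] by blast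
            then show False using l(2) vertR(1) j(1) VW by blast
          qed
          then show "x \<in> ?A V" using l by blast
        qed
        show "?A V \<subseteq> \<Union> {l \<in> P. l \<subseteq> R1}"
        proof
          fix x assume x: "x \<in> ?A V"
          then obtain l where l: "l \<in> P" "x \<in> l" using tilingsD(1)[OF P] by blast
          moreover have "\<not> l \<subseteq> R2" using x l disj by blast
          moreover have "l \<noteq> vert h j" if "j \<in> V" for j
            using x l that VW disj by (auto simp: vert_def W_def)
          ultimately show "x \<in> \<Union> {l \<in> P. l \<subseteq> R1}" using lc[OF l(1)] by blast
        qed
      qed
    qed blast
    moreover have "{l \<in> P. l \<subseteq> R2} \<in> tilings (?B V)"
    proof (rule tilings_subset[OF P])
      show "\<Union> {l \<in> P. l \<subseteq> R2} = ?B V"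
      proof
        show "\<Union> {l \<in> P. l \<subseteq> R2} \<subseteq> ?B V"
        proof
          fix x assume "x \<in> \<Union> {l \<in> P. l \<subseteq> R2}"
          then obtain l where l: "l \<in> P" "l \<subseteq> R2" "x \<in> l" by auto
          have "x \<notin> (\<lambda>j. Up j h) ` V"
          proof
            assume "x \<in> (\<lambda>j. Up j h) ` V"
            then obtain j where j: "j \<in> V" "x = Up j h" by auto
            then have "vert h j \<in> P" "x \<in> vert h j" by (auto simp: V_def vert_def)
            then have "l = vert h j" using tilingsD(4)[OF P l(1) _ l(3)] by blast
            then show False using l(2) vertR(2) j(1) VW by blast
          qed
          then show "x \<in> ?B V" using l by blast
        qed
        show "?B V \<subseteq> \<Union> {l \<in> P. l \<subseteq> R2}"
        proof
          fix x assume x: "x \<in> ?B V"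
          then obtain l where l: "l \<in> P" "x \<in> l" using tilingsD(1)[OF P] by blast
          moreover have "\<not> l \<subseteq> R1" using x l disj by blast
          moreover have "l \<noteq> vert h j" if "j \<in> V" for j
            using x l that VW disj by (auto simp: vert_def W_def)
          ultimately show "x \<in> \<Union> {l \<in> P. l \<subseteq> R2}" using lc[OF l(1)] by blast
        qed
      qed
    qed blast
    ultimately show "({j \<in> W. vert h j \<in> P}, {l \<in> P. l \<subseteq> R1}, {l \<in> P. l \<subseteq> R2}) \<in> (SIGMA V:Pow W. tilings (?A V) \<times> tilings (?B V))"
      unfolding V_def[symmetric] using VW by auto
  qed
  finally show ?thesis by (simp add: M_def W_def)
qed

text \<open>Every tiling covers \<open>s\<close>, and only the lozenge with \<open>t\<close> can do
  so. As \<open>t\<close> may lie outside \<open>R\<close>, the statement covers both a forced step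
  and a dead end.\<close>

lemma M_forced:
  assumes "s \<in> R" "finite R" "lozenge {s, t}" "\<And>u. u \<in> R \<Longrightarrow> lozenge {s, u} \<Longrightarrow> u = t"
  shows "M w R = (if t \<in> R then w {s, t} * M w (R - {s, t}) else 0)"
proof -
  have st: "s \<noteq> t" using assms(3) by (auto simp: lozenge_adjacent adjacent_def)
  have forced: "{s, t} \<in> P \<and> t \<in> R" if P: "P \<in> tilings R" for P
  proof -
    obtain l where l: "l \<in> P" "s \<in> l" using tilingsD(1)[OF P] assms(1) by blast
    obtain u where u: "l = {s, u}"
      using tilingsD(2)[OF P l(1)] l(2) by (auto elim!: lozengeE)
    then have "u = t" "u \<in> R" using assms(4)[of u] tilingsD(2,3)[OF P l(1)] by auto
    then show ?thesis using l u by simp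
  qed
  show ?thesis
  proof (cases "t \<in> R")
    case False
    then have "tilings R = {}" using forced by blast
    then show ?thesis using False by (simp add: M_def)
  next
    case True
    have "M w R = (\<Sum>P\<in>tilings (R - {s, t}). w {s, t} * (\<Prod>l\<in>P. w l))"
      unfolding M_def
    proof (rule sum.reindex_bij_witness[where i = "insert {s, t}" and j = "\<lambda>P. P - {{s, t}}"])
      fix P assume P: "P \<in> tilings R"
      then have stP: "{s, t} \<in> P" using forced by blast
      then show "insert {s, t} (P - {{s, t}}) = P" by blast
      have "finite P" using P assms(2) by (rule finite_tiling)
      then show "w {s, t} * (\<Prod>l\<in>P - {{s, t}}. w l) = (\<Prod>l\<in>P. w l)"
        using stP by (simp add: prod.remove)
      show "P - {{s, t}} \<in> tilings (R - {s, t})"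
      proof (rule tilings_subset[OF P])
        show "\<Union> (P - {{s, t}}) = R - {s, t}"
        proof
          show "\<Union> (P - {{s, t}}) \<subseteq> R - {s, t}"
          proof
            fix x assume "x \<in> \<Union> (P - {{s, t}})"
            then obtain l where l: "l \<in> P" "l \<noteq> {s, t}" "x \<in> l" by blast
            then have "x \<notin> {s, t}" using tilingsD(4)[OF P l(1) stP l(3)] by blast
            then show "x \<in> R - {s, t}" using l tilingsD(3)[OF P l(1)] by blast
          qed
          show "R - {s, t} \<subseteq> \<Union> (P - {{s, t}})"
            using tilingsD(1)[OF P] by blast
        qed
      qed blast
    next
      fix P assume P: "P \<in> tilings (R - {s, t})"
      have "{s, t} \<notin> P" using tilingsD(3)[OF P] by blast
      then show "insert {s, t} P - {{s, t}} = P" by blast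
      have "{{s, t}} \<in> tilings {s, t}"
        using assms(3) by (intro tilingsI) auto
      then have "{{s, t}} \<union> P \<in> tilings ({s, t} \<union> (R - {s, t}))"
        using P by (rule tilings_Un) blast
      moreover have "{s, t} \<union> (R - {s, t}) = R" using assms(1) True by blast
      ultimately show "insert {s, t} P \<in> tilings R" by simp
    qed
    then show ?thesis using True by (simp add: M_def sum_distrib_left)
  qed
qed

text \<open>Every lozenge consists of one up-pointing and one down-pointing triangle.\<close>

lemma tilings_balanced:
  assumes "P \<in> tilings R" "finite R"
  shows "card {t \<in> R. \<exists>j k. t = Up j k} = card {t \<in> R. \<exists>j k. t = Down j k}"
proof -
  let ?U = "\<lambda>A. {t \<in> A. \<exists>j k. t = Up j k}" and ?D = "\<lambda>A. {t \<in> A. \<exists>j k. t = Down j k}"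
  have fP: "finite P" using assms by (rule finite_tiling)
  have fl: "finite l" if "l \<in> P" for l using tilingsD(3)[OF assms(1) that] assms(2) finite_subset by blast
  have one: "card (?U l) = card (?D l)" if lP: "l \<in> P" for l
  proof -
    obtain s t where l: "l = {s, t}" "adjacent s t"
      using tilingsD(2)[OF assms(1) lP] by (auto elim: lozengeE)
    then obtain j k j' k' where "s = Up j k" "t = Down j' k'" by (auto simp: adjacent_def)
    then have "?U l = {s}" "?D l = {t}" using l by auto
    then show ?thesis by simp
  qed
  have count: "card {t \<in> R. S t} = (\<Sum>l\<in>P. card {t \<in> l. S t})" for S
  proof -
    have "{t \<in> R. S t} = (\<Union>l\<in>P. {t \<in> l. S t})"
      using tilingsD(1)[OF assms(1)] by auto
    also have "card \<dots> = (\<Sum>l\<in>P. card {t \<in> l. S t})"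
    proof (rule card_UN_disjoint[OF fP])
      show "\<forall>l\<in>P. finite {t \<in> l. S t}" using fl by simp
      show "\<forall>l\<in>P. \<forall>l'\<in>P. l \<noteq> l' \<longrightarrow> {t \<in> l. S t} \<inter> {t \<in> l'. S t} = {}"
        using tilingsD(4)[OF assms(1)] by blast
    qed
    finally show ?thesis .
  qed
  show ?thesis
    unfolding count using one by simp
qed

section \<open>Tilings of a strip\<close>

lemma adjacent_Up: "adjacent (Up j k) t \<longleftrightarrow> t = Down j k \<or> t = Down j (k + 1) \<or> t = Down (j - 1) (k + 1)"
  by (auto simp: adjacent_def)

lemma adjacent_Down: "adjacent (Down j k) t \<longleftrightarrow> False"
  by (auto simp: adjacent_def)

lemma lozenge_Up_Down:
  "lozenge {Up j k, Down j' k'} \<longleftrightarrow> (j' = j \<and> k' = k) \<or> (j' = j \<and> k' = k + 1) \<or> (j' = j - 1 \<and> k' = k + 1)"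
  unfolding lozenge_adjacent adjacent_Up adjacent_Down by auto

lemma lozenge_same_kind: "\<not> lozenge {Up j k, Up j' k'}" "\<not> lozenge {Down j k, Down j' k'}"
  unfolding lozenge_adjacent adjacent_Up adjacent_Down by auto

text \<open>The down-pointing triangles carry the height \<open>k + 1\<close> of their horizontal
  side. The two rows have separate index sets because dents and crossings on the lower line delete
  from the first, those on the upper line from the second.\<close>

definition strip :: "int \<Rightarrow> int set \<Rightarrow> int set \<Rightarrow> utriangle set" where
  "strip k A B = (\<lambda>j. Up j k) ` A \<union> (\<lambda>j. Down j (k + 1)) ` B"

lemma Up_in_strip [simp]: "Up j k' \<in> strip k A B \<longleftrightarrow> k' = k \<and> j \<in> A"
  by (auto simp: strip_def)

lemma Down_in_strip [simp]: "Down j k' \<in> strip k A B \<longleftrightarrow> k' = k + 1 \<and> j \<in> B"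
  by (auto simp: strip_def)

lemma finite_strip [simp]: "finite A \<Longrightarrow> finite B \<Longrightarrow> finite (strip k A B)"
  by (simp add: strip_def)

lemma strip_diff:
  "strip k A B - {Up i k, Down j (k + 1)} = strip k (A - {i}) (B - {j})"
  "strip k A B - {Down j (k + 1), Up i k} = strip k (A - {i}) (B - {j})"
  by (auto simp: strip_def)

text \<open>The adjacency graph of a strip is a path, so its leftmost triangle forces a lozenge.\<close>

lemma M_strip_Up:
  assumes w: "\<And>j j'. w {Up j k, Down j' (k + 1)} = 1"
    and fin: "finite A" "finite B" and "i \<in> A" "i - 1 \<notin> B"
  shows "M w (strip k A B) = (if i \<in> B then M w (strip k (A - {i}) (B - {i})) else 0)"
proof -
  have "M w (strip k A B) = (if Down i (k + 1) \<in> strip k A B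
      then w {Up i k, Down i (k + 1)} * M w (strip k A B - {Up i k, Down i (k + 1)}) else 0)"
  proof (rule M_forced)
    show "lozenge {Up i k, Down i (k + 1)}" by (simp add: lozenge_Up_Down)
    show "u = Down i (k + 1)" if "u \<in> strip k A B" "lozenge {Up i k, u}" for u
      using that assms(5) by (cases u) (auto simp: lozenge_Up_Down lozenge_same_kind)
  qed (use fin assms(4) in auto)
  then show ?thesis by (simp add: w strip_diff)
qed

lemma M_strip_Down:
  assumes w: "\<And>j j'. w {Up j k, Down j' (k + 1)} = 1"
    and fin: "finite A" "finite B" and "i \<in> B" "i \<notin> A"
  shows "M w (strip k A B) = (if i + 1 \<in> A then M w (strip k (A - {i + 1}) (B - {i})) else 0)"
proof -
  have "M w (strip k A B) = (if Up (i + 1) k \<in> strip k A B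
      then w {Down i (k + 1), Up (i + 1) k} * M w (strip k A B - {Down i (k + 1), Up (i + 1) k}) else 0)"
  proof (rule M_forced)
    have "lozenge {Up (i + 1) k, Down i (k + 1)}" by (simp add: lozenge_Up_Down)
    then show "lozenge {Down i (k + 1), Up (i + 1) k}" by (simp add: insert_commute)
    show "u = Up (i + 1) k" if "u \<in> strip k A B" "lozenge {Down i (k + 1), u}" for u
    proof (cases u)
      case (Up j k')
      then have "lozenge {Up j k, Down i (k + 1)}" using that by (simp add: insert_commute)
      then show ?thesis using Up that assms(5) by (auto simp: lozenge_Up_Down)
    next
      case (Down j k')
      then show ?thesis using that(2) by (simp add: lozenge_same_kind)
    qed
  qed (use fin assms(4) in auto)
  then show ?thesis using w[of "i + 1" i] by (simp add: strip_diff insert_commute)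
qed

text \<open>From the left, each up-pointing triangle has to take the down-pointing one on its right,
  and at the latest the last one finds none.\<close>

lemma M_strip_no_dent:
  assumes w: "\<And>j j'. w {Up j k, Down j' (k + 1)} = 1"
    and "lo < hi" "B \<subseteq> {lo..<hi - 1}"
  shows "M w (strip k {lo..<hi} B) = 0"
  using assms(2,3)
proof (induction "nat (hi - lo)" arbitrary: lo B)
  case 0
  then show ?case by simp
next
  case (Suc d)
  have fin: "finite B" using Suc.prems finite_subset by blast
  have "lo - 1 \<notin> B" using Suc.prems by auto
  then have "M w (strip k {lo..<hi} B) = (if lo \<in> B then M w (strip k ({lo..<hi} - {lo}) (B - {lo})) else 0)"
    using Suc.prems fin by (intro M_strip_Up[of w k, OF w]) auto
  moreover have "{lo..<hi} - {lo} = {lo + 1..<hi}" by auto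
  moreover have "M w (strip k {lo + 1..<hi} (B - {lo})) = 0" if "lo \<in> B"
    using Suc.prems that by (intro Suc.hyps(1)) (use Suc.hyps(2) in auto)
  ultimately show ?case by simp
qed

lemma interlacing_shift_left:
  assumes "strict_mono_on {..n} e" "i < e 0" "Y \<in> interlacing e n"
  shows "i \<notin> Y"
proof -
  have "Y \<subseteq> {e 0..<e n}" using assms(3) by (simp add: interlacing_def)
  then show ?thesis using assms(2) by auto
qed

lemma atLeastLessThan_Suc_int: "{lo + 1..<hi} = {lo..<hi} - {lo :: int}"
  by auto

text \<open>When \<open>e 0\<close> itself is the point in the first gap, all other points must lie
  beyond this gap, so the gap can be split off.\<close>

lemma interlacing_Suc:
  assumes e: "strict_mono_on {..Suc n} e" and Y: "Y \<subseteq> {e 0..}" and "e 0 \<in> Y"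
  shows "Y \<in> interlacing e (Suc n) \<longleftrightarrow> Y - {e 0} \<in> interlacing (\<lambda>i. e (Suc i)) n"
proof -
  have 01: "e 0 < e 1" using strict_mono_onD[OF e, of 0 1] by simp
  have le: "e 1 \<le> e (Suc i)" if "i \<le> n" for i using strict_mono_on_leD[OF e, of 1 "Suc i"] that by simp
  have *: "Y \<inter> {e (Suc i)..<e (Suc (Suc i))} = (Y - {e 0}) \<inter> {e (Suc i)..<e (Suc (Suc i))}" if "i < n" for i
    using le[of i] 01 that by auto
  have card: "card (Y \<inter> {e 0..<e (Suc 0)}) = 1 \<longleftrightarrow> Y - {e 0} \<subseteq> {e 1..}"
  proof
    assume "card (Y \<inter> {e 0..<e (Suc 0)}) = 1"
    then obtain z where "Y \<inter> {e 0..<e (Suc 0)} = {z}" by (rule card_1_singletonE)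
    moreover have "e 0 \<in> Y \<inter> {e 0..<e (Suc 0)}" using assms(3) 01 by simp
    ultimately have "Y \<inter> {e 0..<e (Suc 0)} = {e 0}" by (metis singletonD)
    show "Y - {e 0} \<subseteq> {e 1..}"
    proof
      fix y assume y: "y \<in> Y - {e 0}"
      then have "y \<notin> {e 0..<e (Suc 0)}" using \<open>Y \<inter> {e 0..<e (Suc 0)} = {e 0}\<close> by blast
      moreover have "e 0 \<le> y" using y Y by blast
      ultimately show "y \<in> {e 1..}" by simp
    qed
  next
    assume "Y - {e 0} \<subseteq> {e 1..}"
    then have "y = e 0" if "y \<in> Y \<inter> {e 0..<e (Suc 0)}" for y using that by (cases "y = e 0") auto
    moreover have "e 0 \<in> Y \<inter> {e 0..<e (Suc 0)}" using 01 assms(3) by simp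
    ultimately have "Y \<inter> {e 0..<e (Suc 0)} = {e 0}" by blast
    then show "card (Y \<inter> {e 0..<e (Suc 0)}) = 1" by simp
  qed
  have "Y \<in> interlacing e (Suc n) \<longleftrightarrow> Y \<subseteq> {e 0..<e (Suc n)} \<and> card (Y \<inter> {e 0..<e (Suc 0)}) = 1 \<and>
      (\<forall>i<n. card (Y \<inter> {e (Suc i)..<e (Suc (Suc i))}) = 1)"
    unfolding interlacing_def mem_Collect_eq All_less_Suc2 ..
  also have "\<dots> \<longleftrightarrow> Y - {e 0} \<subseteq> {e 1..<e (Suc n)} \<and> (\<forall>i<n. card ((Y - {e 0}) \<inter> {e (Suc i)..<e (Suc (Suc i))}) = 1)"
  proof -
    have c: "card (Y \<inter> {e (Suc i)..<e (Suc (Suc i))}) = card ((Y - {e 0}) \<inter> {e (Suc i)..<e (Suc (Suc i))})" if "i < n" for i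
      using *[OF that] by (rule arg_cong)
    have 1: "(\<forall>i<n. card (Y \<inter> {e (Suc i)..<e (Suc (Suc i))}) = 1) \<longleftrightarrow>
        (\<forall>i<n. card ((Y - {e 0}) \<inter> {e (Suc i)..<e (Suc (Suc i))}) = 1)"
      by (intro iff_allI imp_cong refl) (simp only: c)
    have "e 0 < e (Suc n)" using le[of n] 01 by simp
    have 2: "Y \<subseteq> {e 0..<e (Suc n)} \<and> Y - {e 0} \<subseteq> {e 1..} \<longleftrightarrow> Y - {e 0} \<subseteq> {e 1..<e (Suc n)}"
    proof
      assume "Y \<subseteq> {e 0..<e (Suc n)} \<and> Y - {e 0} \<subseteq> {e 1..}"
      then show "Y - {e 0} \<subseteq> {e 1..<e (Suc n)}" by (auto simp only: subset_iff atLeast_iff atLeastLessThan_iff Diff_iff)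
    next
      assume A: "Y - {e 0} \<subseteq> {e 1..<e (Suc n)}"
      have "y \<in> {e 0..<e (Suc n)}" if "y \<in> Y" for y
      proof (cases "y = e 0")
        case True
        then show ?thesis using \<open>e 0 < e (Suc n)\<close> by simp
      next
        case False
        then have "y \<in> {e 1..<e (Suc n)}" using A that by blast
        then show ?thesis using 01 by simp
      qed
      moreover have "Y - {e 0} \<subseteq> {e 1..}" using A by (auto simp only: subset_iff atLeast_iff atLeastLessThan_iff Diff_iff)
      ultimately show "Y \<subseteq> {e 0..<e (Suc n)} \<and> Y - {e 0} \<subseteq> {e 1..}" by blast
    qed
    show ?thesis unfolding card 1 conj_assoc[symmetric] 2 ..
  qed
  finally show ?thesis by (simp add: interlacing_def)
qed

lemma interlacing_Suc_notin:
  assumes "e 0 \<notin> Y" "e 1 = e 0 + 1"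
  shows "Y \<notin> interlacing e (Suc n)"
proof
  assume "Y \<in> interlacing e (Suc n)"
  then have "card (Y \<inter> {e 0..<e (Suc 0)}) = 1" by (simp add: interlacing_def)
  moreover have "Y \<inter> {e 0..<e (Suc 0)} = {}" using assms by auto
  ultimately show False by simp
qed

text \<open>The left end of the first gap may be moved to the right as long as it passes no point of
  \<open>Y\<close>.\<close>

lemma interlacing_update_0_Suc:
  assumes "e 0 < i" "i < e 1" "Y \<subseteq> {i..}"
  shows "Y \<in> interlacing (e(0 := i)) (Suc n) \<longleftrightarrow> Y \<in> interlacing e (Suc n)"
proof -
  have "Y \<inter> {(e(0 := i)) l..<(e(0 := i)) (Suc l)} = Y \<inter> {e l..<e (Suc l)}" for l
    using assms by (cases l) auto
  moreover have "Y \<subseteq> {(e(0 := i)) 0..<(e(0 := i)) (Suc n)} \<longleftrightarrow> Y \<subseteq> {e 0..<e (Suc n)}"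
    using assms by (auto simp: subset_iff)
  ultimately show ?thesis unfolding interlacing_def mem_Collect_eq by simp
qed

text \<open>The two claims are the states of an automaton reading the strip from the left: before an
  up-pointing triangle with all earlier ones matched, resp. just after a removed or matched
  up-pointing triangle at position \<open>e 0\<close>.\<close>

lemma M_strip:
  assumes w: "\<And>j j'. w {Up j k, Down j' (k + 1)} = 1"
  shows "strict_mono_on {..n} e \<Longrightarrow> e ` {..n} \<subseteq> {lo..<hi} \<Longrightarrow> Y \<subseteq> {lo..<hi - 1} \<Longrightarrow>
      M w (strip k ({lo..<hi} - e ` {..n}) ({lo..<hi - 1} - Y)) = of_bool (Y \<in> interlacing e n)"
    and "strict_mono_on {..n} e \<Longrightarrow> e 0 = lo \<Longrightarrow> e ` {..n} \<subseteq> {lo..<hi} \<Longrightarrow> Y \<subseteq> {lo..<hi - 1} \<Longrightarrow>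
      M w (strip k ({lo..<hi} - e ` {..n}) ({lo..<hi - 1} - Y)) = of_bool (Y \<in> interlacing e n)"
proof (induction "nat (hi - lo)" arbitrary: lo e n Y)
  case 0
  {
    case 1
    have "e 0 \<in> e ` {..n}" by simp
    then have "e 0 \<in> {lo..<hi}" using 1(2) by blast
    then show ?case using 0 by simp
  next
    case 2
    have "e 0 \<in> e ` {..n}" by simp
    then have "e 0 \<in> {lo..<hi}" using 2(3) by blast
    then show ?case using 0 by simp
  }
next
  case (Suc d)
  have d: "d = nat (hi - (lo + 1))" and lohi: "lo < hi" using Suc.hyps(3) by auto
  have D: "M w (strip k ({lo..<hi} - e ` {..n}) ({lo..<hi - 1} - Y)) = of_bool (Y \<in> interlacing e n)"
    if e: "strict_mono_on {..n} e" and e0: "e 0 = lo" and sub: "e ` {..n} \<subseteq> {lo..<hi}" and Y: "Y \<subseteq> {lo..<hi - 1}" for e n Y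
  proof -
    let ?A = "{lo..<hi} - e ` {..n}" and ?B = "{lo..<hi - 1} - Y"
    have loX: "lo \<in> e ` {..n}" using e0 by (auto intro!: image_eqI[of _ _ 0])
    have inter0: "e l = lo \<longleftrightarrow> l = 0" if "l \<le> n" for l
      using strict_mono_onD[OF e, of 0 l] that e0 by (cases l) auto
    have im: "e ` {..n} = insert lo (e ` {1..n})"
    proof -
      have "{..n} = insert 0 {1..n}" by auto
      then show ?thesis using e0 by simp
    qed
    show ?thesis
    proof (cases n)
      case 0
      have A: "?A = {lo + 1..<hi}" using 0 e0 by auto
      have I: "Y \<in> interlacing e n \<longleftrightarrow> Y = {}" by (simp add: 0)
      show ?thesis
      proof (cases "lo \<in> Y")
        case True
        then have "lo + 1 < hi" using Y by auto
        moreover have "?B \<subseteq> {lo + 1..<hi - 1}" unfolding atLeastLessThan_Suc_int using True by auto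
        ultimately have "M w (strip k ?A ?B) = 0"
          unfolding A by (intro M_strip_no_dent[of w k, OF w])
        then show ?thesis using True I by auto
      next
        case False
        show ?thesis
        proof (cases "lo + 1 < hi")
          case True
          have "M w (strip k ?A ?B) = M w (strip k (?A - {lo + 1}) (?B - {lo}))"
            using M_strip_Down[of w k ?A ?B lo, OF w] loX False True A by simp
          also have "?A - {lo + 1} = {lo + 1..<hi} - (\<lambda>_. lo + 1) ` {..0::nat}" using A by auto
          also have "?B - {lo} = {lo + 1..<hi - 1} - Y" unfolding atLeastLessThan_Suc_int by auto
          also have "M w (strip k ({lo + 1..<hi} - (\<lambda>_. lo + 1) ` {..0::nat}) ({lo + 1..<hi - 1} - Y)) = of_bool (Y \<in> interlacing (\<lambda>_. lo + 1) 0)"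
          proof (rule Suc.hyps(2)[OF d])
            show "strict_mono_on {..0} (\<lambda>_ :: nat. lo + 1)" by (rule strict_mono_onI) simp
            show "(\<lambda>_. lo + 1) ` {..0 :: nat} \<subseteq> {lo + 1..<hi}" using True by auto
            show "Y \<subseteq> {lo + 1..<hi - 1}" unfolding atLeastLessThan_Suc_int using Y False by auto
          qed simp
          finally show ?thesis using I by simp
        next
          case F: False
          then have E: "?A = {}" "?B = {}" "Y = {}" using A Y by auto
          have "strip k ?A ?B = {}" unfolding strip_def E(1,2) by simp
          then show ?thesis using I E(3) by simp
        qed
      qed
    next
      case (Suc n')
      have e1: "e 1 \<in> {lo + 1..<hi}"
      proof -
        have "e 1 \<in> e ` {..n}" using Suc by simp
        moreover have "lo < e 1" using strict_mono_onD[OF e, of 0 1] e0 Suc by simp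
        ultimately show ?thesis using sub by auto
      qed
      have e': "strict_mono_on {..n'} (\<lambda>i. e (Suc i))"
        using e Suc by (auto simp: strict_mono_on_def)
      have im': "(\<lambda>i. e (Suc i)) ` {..n'} = e ` {1..n}"
      proof -
        have "Suc ` {..n'} = {1..n}" by (simp add: Suc image_Suc_atMost)
        then show ?thesis using image_image[of e Suc "{..n'}"] by simp
      qed
      have lo': "e ` {1..n} \<subseteq> {lo + 1..<hi}"
      proof
        fix x assume "x \<in> e ` {1..n}"
        then obtain l where "l \<in> {1..n}" "x = e l" by auto
        then have "x \<noteq> lo" "x \<in> {lo..<hi}" using inter0[of l] sub by auto
        then show "x \<in> {lo + 1..<hi}" by auto
      qed
      show ?thesis
      \<comment> \<open>With \<open>lo\<close> in \<open>Y\<close> the first gap has its point, and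
        the scan returns to the state of the first claim with the first position dropped.\<close>
      proof (cases "lo \<in> Y")
        case True
        have "strip k ?A ?B = strip k ({lo + 1..<hi} - (\<lambda>i. e (Suc i)) ` {..n'}) ({lo + 1..<hi - 1} - (Y - {lo}))"
        proof -
          have "?A = {lo + 1..<hi} - (\<lambda>i. e (Suc i)) ` {..n'}" unfolding im' im atLeastLessThan_Suc_int by auto
          moreover have "?B = {lo + 1..<hi - 1} - (Y - {lo})" unfolding atLeastLessThan_Suc_int using True by auto
          ultimately show ?thesis by simp
        qed
        also have "M w \<dots> = of_bool (Y - {lo} \<in> interlacing (\<lambda>i. e (Suc i)) n')"
        proof (rule Suc.hyps(1)[OF d e'])
          show "(\<lambda>i. e (Suc i)) ` {..n'} \<subseteq> {lo + 1..<hi}" unfolding im' by (rule lo')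
          show "Y - {lo} \<subseteq> {lo + 1..<hi - 1}" unfolding atLeastLessThan_Suc_int using Y by auto
        qed
        also have "Y - {lo} \<in> interlacing (\<lambda>i. e (Suc i)) n' \<longleftrightarrow> Y \<in> interlacing e n"
        proof -
          have "Y \<subseteq> {e 0..}" using Y e0 by auto
          then show ?thesis using interlacing_Suc[of n' e Y] e e0 True Suc by simp
        qed
        finally show ?thesis .
      next
        case False
        have "lo \<in> ?B" using False e1 by auto
        then have step: "M w (strip k ?A ?B) = (if lo + 1 \<in> ?A then M w (strip k (?A - {lo + 1}) (?B - {lo})) else 0)"
          using loX by (intro M_strip_Down[of w k, OF w]) auto
        show ?thesis
        \<comment> \<open>If the next removed position is adjacent, the forced partner is missing,
          and the first gap \<open>{lo}\<close> contains no point of \<open>Y\<close>: both sides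
          are zero.\<close>
        proof (cases "e 1 = lo + 1")
          case True
          then have "lo + 1 \<in> e ` {..n}" using Suc by (auto intro!: image_eqI[of _ _ 1])
          moreover have "Y \<notin> interlacing e n"
            using interlacing_Suc_notin[of e Y n'] False True e0 Suc by simp
          ultimately show ?thesis using step by simp
        next
          case F: False
          \<comment> \<open>The triangle \<open>Down lo (k + 1)\<close> takes
            \<open>Up (lo + 1) k\<close>, which from now on behaves like a removed triangle; so the
            first position advances to \<open>lo + 1\<close>.\<close>
          define e2 where "e2 = e(0 := lo + 1)"
          have e2: "strict_mono_on {..n} e2"
          proof (rule strict_mono_onI)
            fix r s assume rs: "r \<in> {..n}" "s \<in> {..n}" "r < s"
            have "e 1 \<le> e s" using strict_mono_on_leD[OF e, of 1 s] rs by simp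
            then show "e2 r < e2 s"
              using strict_mono_onD[OF e rs] rs F e1 by (auto simp: e2_def)
          qed
          have im2: "e2 ` {..n} = insert (lo + 1) (e ` {1..n})"
          proof -
            have "{..n} = insert 0 {1..n}" by auto
            moreover have "e2 ` {1..n} = e ` {1..n}" by (rule image_cong) (auto simp: e2_def)
            moreover have "e2 0 = lo + 1" by (simp add: e2_def)
            ultimately show ?thesis by simp
          qed
          have "lo + 1 \<notin> e ` {..n}"
          proof
            assume "lo + 1 \<in> e ` {..n}"
            then obtain l where l: "l \<le> n" "e l = lo + 1" by auto
            have "l \<noteq> 0"
            proof
              assume "l = 0"
              then show False using l(2) e0 by simp
            qed
            then have "e 1 \<le> e l" using strict_mono_on_leD[OF e, of 1 l] l by simp
            then show False using F e1 l by simp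
          qed
          moreover have "lo + 1 < hi" using e1 by auto
          ultimately have "M w (strip k ?A ?B) = M w (strip k (?A - {lo + 1}) (?B - {lo}))"
            using step by simp
          also have "?A - {lo + 1} = {lo + 1..<hi} - e2 ` {..n}" unfolding im im2 atLeastLessThan_Suc_int by auto
          also have "?B - {lo} = {lo + 1..<hi - 1} - Y" unfolding atLeastLessThan_Suc_int by auto
          also have "M w (strip k ({lo + 1..<hi} - e2 ` {..n}) ({lo + 1..<hi - 1} - Y)) = of_bool (Y \<in> interlacing e2 n)"
          proof (rule Suc.hyps(2)[OF d e2])
            show "e2 0 = lo + 1" by (simp add: e2_def)
            show "e2 ` {..n} \<subseteq> {lo + 1..<hi}" unfolding im2 using lo' \<open>lo + 1 < hi\<close> by auto
            show "Y \<subseteq> {lo + 1..<hi - 1}"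
            proof
              fix y assume "y \<in> Y"
              then have "y \<in> {lo..<hi - 1}" "y \<noteq> lo" using Y False by auto
              then show "y \<in> {lo + 1..<hi - 1}" by auto
            qed
          qed
          also have "Y \<in> interlacing e2 n \<longleftrightarrow> Y \<in> interlacing e n"
          proof -
            have "y \<ge> lo + 1" if "y \<in> Y" for y
            proof -
              have "y \<in> {lo..<hi - 1}" "y \<noteq> lo" using Y False that by auto
              then show ?thesis by auto
            qed
            then show ?thesis
              unfolding e2_def Suc using e0 F e1 by (intro interlacing_update_0_Suc) auto
          qed
          finally show ?thesis .
        qed
      qed
    qed
  qed
  {
    case 2
    then show ?case by (rule D)
  next
    case 1
    show ?case
    proof (cases "e 0 = lo")
      case True
      then show ?thesis using 1 by (intro D)
    next
      case False
      let ?A = "{lo..<hi} - e ` {..n}" and ?B = "{lo..<hi - 1} - Y"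
      have gt: "e ` {..n} \<subseteq> {lo + 1..<hi}"
      proof
        fix x assume x: "x \<in> e ` {..n}"
        then obtain l where l: "l \<le> n" "x = e l" by auto
        have "e 0 \<in> e ` {..n}" by simp
        then have "lo < e 0" using 1(2) False by force
        then have "lo < x" using strict_mono_on_leD[OF 1(1), of 0 l] l by simp
        then show "x \<in> {lo + 1..<hi}" using x 1(2) by auto
      qed
      then have e0: "lo < e 0" by auto
      have "M w (strip k ?A ?B) = (if lo \<in> ?B then M w (strip k (?A - {lo}) (?B - {lo})) else 0)"
        using gt lohi by (intro M_strip_Up[of w k, OF w]) auto
      moreover have "lo \<notin> ?B \<longleftrightarrow> lo \<in> Y"
      proof -
        have "e 0 \<in> {lo + 1..<hi}" using gt by auto
        then show ?thesis by auto
      qed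
      moreover have "Y \<notin> interlacing e n" if "lo \<in> Y"
        using interlacing_shift_left[OF 1(1) e0] that by blast
      moreover have "M w (strip k (?A - {lo}) (?B - {lo})) = of_bool (Y \<in> interlacing e n)" if "lo \<notin> Y"
      proof -
        have "?A - {lo} = {lo + 1..<hi} - e ` {..n}" "?B - {lo} = {lo + 1..<hi - 1} - Y"
          unfolding atLeastLessThan_Suc_int by auto
        moreover have "Y \<subseteq> {lo + 1..<hi - 1}"
        proof
          fix y assume "y \<in> Y"
          then have "y \<in> {lo..<hi - 1}" "y \<noteq> lo" using 1(3) that by auto
          then show "y \<in> {lo + 1..<hi - 1}" by auto
        qed
        ultimately show ?thesis using Suc.hyps(1)[OF d 1(1) gt] by simp
      qed
      ultimately show ?thesis by auto
    qed
  }
qed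

section \<open>Stacks of strips\<close>

lemma interlacing_subset: "Y \<in> interlacing e n \<Longrightarrow> Y \<subseteq> {e 0..<e n}"
  by (simp add: interlacing_def)

text \<open>Adjacent removed up-pointing triangles force the vertical position between them; this is why
  removing a large triangle amounts to removing the unit triangles along its base.\<close>

lemma interlacing_contains:
  assumes e: "strict_mono_on {..n} e" and Y: "Y \<in> interlacing e n"
    and "j \<in> e ` {..n}" "j + 1 \<in> e ` {..n}"
  shows "j \<in> Y"
proof -
  obtain i l where i: "i \<le> n" "j = e i" and l: "l \<le> n" "j + 1 = e l"
    using assms(3,4) by auto
  have "i < l"
  proof (rule ccontr)
    assume "\<not> i < l"
    then have "e l \<le> e i" using strict_mono_on_leD[OF e, of l i] i by simp
    then show False using i(2) l(2) by simp
  qed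
  have "l = Suc i"
  proof (rule ccontr)
    assume "l \<noteq> Suc i"
    then have "Suc i < l" using \<open>i < l\<close> by simp
    then have "e i < e (Suc i)" "e (Suc i) < e l"
      using strict_mono_onD[OF e, of i "Suc i"] strict_mono_onD[OF e, of "Suc i" l] i l by simp_all
    then show False using i(2) l(2) by simp
  qed
  then have "card (Y \<inter> {j..<j + 1}) = 1"
    using Y i l by (simp add: interlacing_def)
  then obtain z where "Y \<inter> {j..<j + 1} = {z}" by (rule card_1_singletonE)
  then have "z \<in> Y" "z \<in> {j..<j + 1}" by blast+
  moreover from this have "z = j" by simp
  ultimately show ?thesis by simp
qed

lemma strip_minus_Down: "strip k A B - (\<lambda>j. Down j (k + 1)) ` V = strip k A (B - V)"
  by (auto simp: strip_def)

lemma double_diff_union: "A - B - C = A - (B \<union> C)"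
  by blast

text \<open>A strip has one tiling or none for given positions on its upper line, so the sum over
  crossings is a sum over interlacing sets. \<open>D\<close> holds the dents on that line; they
  belong to every interlacing \<open>Y\<close>, and only \<open>Y - D\<close> stands for actual
  lozenges.\<close>

lemma M_peel:
  fixes e :: "nat \<Rightarrow> int"
  assumes w: "\<And>j j'. w {Up j k, Down j' (k + 1)} = 1"
    and e: "strict_mono_on {..n} e" "e ` {..n} \<subseteq> {lo..<hi}"
    and D: "\<And>j. j \<in> D \<Longrightarrow> j \<in> e ` {..n} \<and> j + 1 \<in> e ` {..n}"
    and fin: "finite R2"
    and above: "\<And>j k'. Up j k' \<in> R2 \<Longrightarrow> k < k'" "\<And>j k'. Down j k' \<in> R2 \<Longrightarrow> k + 1 < k'"
    and full: "\<And>Y. Y \<in> interlacing e n \<Longrightarrow> (\<lambda>j. Up j (k + 1)) ` (Y - D) \<subseteq> R2"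
  shows "M w (strip k ({lo..<hi} - e ` {..n}) ({lo..<hi - 1} - D) \<union> R2) =
    (\<Sum>Y\<in>interlacing e n. (\<Prod>j\<in>Y - D. w (vert (k + 1) j)) * M w (R2 - (\<lambda>j. Up j (k + 1)) ` (Y - D)))"
proof -
  let ?R1 = "strip k ({lo..<hi} - e ` {..n}) ({lo..<hi - 1} - D)"
  let ?I = "interlacing e n"
  define W where "W = {j. Down j (k + 1) \<in> ?R1 \<and> Up j (k + 1) \<in> R2}"
  have W: "j \<in> W \<longleftrightarrow> lo \<le> j \<and> j < hi - 1 \<and> j \<notin> D \<and> Up j (k + 1) \<in> R2" for j
    by (auto simp: W_def)
  have finW: "finite W"
    by (rule finite_subset[of _ "{lo..<hi - 1}"]) (auto simp: W)
  have D': "D \<subseteq> {lo..<hi - 1}"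
  proof
    fix j assume "j \<in> D"
    then have "j \<in> {lo..<hi}" "j + 1 \<in> {lo..<hi}" using D e(2) by blast+
    then show "j \<in> {lo..<hi - 1}" by simp
  qed
  have "M w (?R1 \<union> R2) = (\<Sum>V\<in>Pow W. (\<Prod>j\<in>V. w (vert (k + 1) j)) * M w (?R1 - (\<lambda>j. Down j (k + 1)) ` V) * M w (R2 - (\<lambda>j. Up j (k + 1)) ` V))"
    unfolding W_def
  proof (rule M_split)
    show "?R1 \<inter> R2 = {}"
    proof (rule ccontr)
      assume "?R1 \<inter> R2 \<noteq> {}"
      then obtain t where "t \<in> ?R1" "t \<in> R2" by blast
      then show False using above by (cases t) fastforce+
    qed
    show "\<exists>j. s = Down j (k + 1) \<and> t = Up j (k + 1)" if "s \<in> ?R1" "t \<in> R2" "lozenge {s, t}" for s t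
    proof (cases s)
      case (Up j k')
      then have "k' = k" using that(1) by simp
      then show ?thesis
        using that above Up by (cases t) (fastforce simp: lozenge_Up_Down lozenge_same_kind)+
    next
      case (Down j k')
      then have k': "k' = k + 1" using that(1) by simp
      show ?thesis
      proof (cases t)
        case (Up j2 k2)
        then have "lozenge {Up j2 k2, Down j k'}" using that(3) Down by (simp add: insert_commute)
        then show ?thesis using k' above(1)[of j2 k2] that(2) Up Down by (auto simp: lozenge_Up_Down)
      next
        case (Down j2 k2)
        then show ?thesis using that(3) \<open>s = Down j k'\<close> by (simp add: lozenge_same_kind)
      qed
    qed
  qed (use fin in auto)
  also have "\<dots> = (\<Sum>V\<in>Pow W. if D \<union> V \<in> ?I then (\<Prod>j\<in>V. w (vert (k + 1) j)) * M w (R2 - (\<lambda>j. Up j (k + 1)) ` V) else 0)"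
  proof (rule sum.cong[OF refl])
    fix V assume "V \<in> Pow W"
    then have "D \<union> V \<subseteq> {lo..<hi - 1}" using D' W by auto
    then have "M w (strip k ({lo..<hi} - e ` {..n}) ({lo..<hi - 1} - (D \<union> V))) = of_bool (D \<union> V \<in> ?I)"
      by (intro M_strip(1)[of w k, OF w] e)
    then show "(\<Prod>j\<in>V. w (vert (k + 1) j)) * M w (?R1 - (\<lambda>j. Down j (k + 1)) ` V) * M w (R2 - (\<lambda>j. Up j (k + 1)) ` V) =
        (if D \<union> V \<in> ?I then (\<Prod>j\<in>V. w (vert (k + 1) j)) * M w (R2 - (\<lambda>j. Up j (k + 1)) ` V) else 0)"
      using double_diff_union[of "{lo..<hi - 1}" D V] by (simp only: strip_minus_Down) simp
  qed
  also have "\<dots> = (\<Sum>V | V \<in> Pow W \<and> D \<union> V \<in> ?I. (\<Prod>j\<in>V. w (vert (k + 1) j)) * M w (R2 - (\<lambda>j. Up j (k + 1)) ` V))"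
    by (rule sum.inter_filter[symmetric]) (use finW in simp)
  also have "\<dots> = (\<Sum>Y\<in>?I. (\<Prod>j\<in>Y - D. w (vert (k + 1) j)) * M w (R2 - (\<lambda>j. Up j (k + 1)) ` (Y - D)))"
  proof (rule sum.reindex_bij_witness[where i = "\<lambda>Y. Y - D" and j = "\<lambda>V. D \<union> V"])
    fix V assume "V \<in> {V. V \<in> Pow W \<and> D \<union> V \<in> ?I}"
    then have V: "V \<subseteq> W" "D \<union> V \<in> ?I" by auto
    then show "D \<union> V - D = V" "D \<union> V \<in> ?I" using W by auto
    then show "(\<Prod>j\<in>D \<union> V - D. w (vert (k + 1) j)) * M w (R2 - (\<lambda>j. Up j (k + 1)) ` (D \<union> V - D)) =
        (\<Prod>j\<in>V. w (vert (k + 1) j)) * M w (R2 - (\<lambda>j. Up j (k + 1)) ` V)" by simp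
  next
    fix Y assume Y: "Y \<in> ?I"
    have "D \<subseteq> Y" using interlacing_contains[OF e(1) Y] D by blast
    then show *: "D \<union> (Y - D) = Y" by blast
    have "Y - D \<subseteq> W"
    proof
      fix j assume j: "j \<in> Y - D"
      have "e 0 \<in> {lo..<hi}" "e n \<in> {lo..<hi}" using e(2) by auto
      moreover have "j \<in> {e 0..<e n}" using interlacing_subset[OF Y] j by blast
      moreover have "Up j (k + 1) \<in> R2" using full[OF Y] j by blast
      ultimately show "j \<in> W" using j by (simp add: W)
    qed
    then show "Y - D \<in> {V. V \<in> Pow W \<and> D \<union> V \<in> ?I}" using * Y by simp
  qed
  finally show ?thesis .
qed

text \<open>\<open>G i\<close> is the set of free positions on the line at height \<open>i\<close>.
  It serves the up-pointing triangles above and the down-pointing ones below the line at once, as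
  dents and boundaries delete both together.\<close>

definition stack :: "(nat \<Rightarrow> int set) \<Rightarrow> nat \<Rightarrow> nat \<Rightarrow> utriangle set" where
  "stack G k h = {Up j (int i) | j i. k \<le> i \<and> i < h \<and> j \<in> G i} \<union> {Down j (int i) | j i. k < i \<and> i \<le> h \<and> j \<in> G i}"

lemma Up_in_stack: "Up j k' \<in> stack G k h \<longleftrightarrow> int k \<le> k' \<and> k' < int h \<and> j \<in> G (nat k')"
proof
  assume "int k \<le> k' \<and> k' < int h \<and> j \<in> G (nat k')"
  then show "Up j k' \<in> stack G k h"
    unfolding stack_def by (intro UnI1 CollectI exI[of _ j] exI[of _ "nat k'"]) auto
qed (auto simp: stack_def)

lemma Down_in_stack: "Down j k' \<in> stack G k h \<longleftrightarrow> int k < k' \<and> k' \<le> int h \<and> j \<in> G (nat k')"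
proof
  assume "int k < k' \<and> k' \<le> int h \<and> j \<in> G (nat k')"
  then show "Down j k' \<in> stack G k h"
    unfolding stack_def by (intro UnI2 CollectI exI[of _ j] exI[of _ "nat k'"]) auto
qed (auto simp: stack_def)

lemma stack_same [simp]: "stack G h h = {}"
  by (auto simp: stack_def)

lemma stack_rec:
  assumes "k < h"
  shows "stack G k h = strip (int k) (G k) (G (Suc k)) \<union> stack G (Suc k) h"
proof (rule Set.set_eqI)
  fix t
  show "t \<in> stack G k h \<longleftrightarrow> t \<in> strip (int k) (G k) (G (Suc k)) \<union> stack G (Suc k) h"
  proof (cases t)
    case (Up j k')
    have "int k \<le> k' \<longleftrightarrow> k' = int k \<or> int (Suc k) \<le> k'" by auto
    then show ?thesis using assms unfolding Up Un_iff Up_in_stack Up_in_strip by auto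
  next
    case (Down j k')
    have "int k < k' \<longleftrightarrow> k' = int k + 1 \<or> int (Suc k) < k'" by auto
    moreover have "nat (int k + 1) = Suc k" by simp
    ultimately show ?thesis using assms unfolding Down Un_iff Down_in_stack Down_in_strip by auto
  qed
qed

lemma finite_stack:
  assumes "\<And>i. finite (G i)"
  shows "finite (stack G k h)"
proof -
  have "stack G k h \<subseteq> (\<Union>i\<in>{..h}. (\<lambda>j. Up j (int i)) ` G i) \<union> (\<Union>i\<in>{..h}. (\<lambda>j. Down j (int i)) ` G i)"
  proof
    fix t assume t: "t \<in> stack G k h"
    show "t \<in> (\<Union>i\<in>{..h}. (\<lambda>j. Up j (int i)) ` G i) \<union> (\<Union>i\<in>{..h}. (\<lambda>j. Down j (int i)) ` G i)"
    proof (cases t)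
      case (Up j k')
      then have "nat k' \<in> {..h}" "t = Up j (int (nat k'))" "j \<in> G (nat k')"
        using t by (auto simp: Up_in_stack)
      then show ?thesis by blast
    next
      case (Down j k')
      then have "nat k' \<in> {..h}" "t = Down j (int (nat k'))" "j \<in> G (nat k')"
        using t by (auto simp: Down_in_stack)
      then show ?thesis by blast
    qed
  qed
  then show ?thesis by (rule finite_subset) (use assms in auto)
qed

text \<open>Induction from the top line down, one strip at a time. \<open>lo\<close> is the western
  boundary, \<open>D\<close> the dents, \<open>c k\<close> the number of occupied positions at
  height \<open>k\<close>, \<open>\<Phi>\<close> any function obeying the recursion of the strips.
  Where the boundary moves west, the absent up-pointing triangle at \<open>lo (Suc k)\<close> counts
  as one more removed triangle in front of \<open>X\<close>; this keeps \<open>c\<close> constant.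
  \<open>\<omega>\<close> extends the weights by 1 to dents, where there is no lozenge.\<close>

lemma M_stack:
  fixes lo :: "nat \<Rightarrow> int" and D :: "nat \<Rightarrow> int set" and N :: int and c :: "nat \<Rightarrow> nat"
    and \<Phi> :: "nat \<Rightarrow> int set \<Rightarrow> real" and \<omega> :: "nat \<Rightarrow> int \<Rightarrow> real"
  defines "G \<equiv> (\<lambda>i. {lo i..<N - int i} - D i)"
  assumes w: "\<And>k j j'. w {Up j k, Down j' (k + 1)} = 1"
    and lo: "\<And>k. k < h \<Longrightarrow> lo (Suc k) = lo k \<and> c k = Suc (c (Suc k)) \<or> lo (Suc k) = lo k - 1 \<and> c k = c (Suc k)"
    and loN: "\<And>k. k < h \<Longrightarrow> lo k \<le> N - int k"
    and D: "\<And>k j. k < h \<Longrightarrow> j \<in> D (Suc k) \<Longrightarrow> j + 1 \<in> D k \<and> (j \<in> D k \<or> j = lo (Suc k) \<and> lo (Suc k) = lo k - 1)"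
    and \<omega>: "\<And>k j. k < h \<Longrightarrow> j \<notin> D (Suc k) \<Longrightarrow> w (vert (int (Suc k)) j) = \<omega> (Suc k) j"
      "\<And>k j. k < h \<Longrightarrow> j \<in> D (Suc k) \<Longrightarrow> \<omega> (Suc k) j = 1"
    and up: "\<And>k e. k < h \<Longrightarrow> lo (Suc k) = lo k \<Longrightarrow> strict_mono_on {..c (Suc k)} e \<Longrightarrow>
      \<Phi> k (e ` {..c (Suc k)}) = (\<Sum>Y\<in>interlacing e (c (Suc k)). (\<Prod>j\<in>Y. \<omega> (Suc k) j) * \<Phi> (Suc k) Y)"
    and down: "\<And>k e. k < h \<Longrightarrow> lo (Suc k) = lo k - 1 \<Longrightarrow> e 0 = lo (Suc k) \<Longrightarrow> strict_mono_on {..c (Suc k)} e \<Longrightarrow>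
      \<Phi> k (e ` {1..c (Suc k)}) = (\<Sum>Y\<in>interlacing e (c (Suc k)). (\<Prod>j\<in>Y. \<omega> (Suc k) j) * \<Phi> (Suc k) Y)"
    and top: "c h = 0" "\<Phi> h {} = 1"
  shows "k \<le> h \<Longrightarrow> D k \<subseteq> X \<Longrightarrow> X \<subseteq> {lo k..<N - int k} \<Longrightarrow> card X = c k \<Longrightarrow>
    M w (stack G k h - (\<lambda>j. Up j (int k)) ` (X - D k)) = \<Phi> k X"
proof (induction "h - k" arbitrary: k X)
  case 0
  then have "k = h" "X = {}" using top(1) finite_subset[of X] by auto
  then show ?case using top(2) by simp
next
  case (Suc d)
  have k: "k < h" and d: "d = h - Suc k" using Suc.hyps(2) by auto
  let ?n = "c (Suc k)" and ?hi = "N - int k"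
  have finX: "finite X" using Suc.prems(3) finite_subset by blast
  obtain x where x: "strict_mono_on {..<c k} x" "x ` {..<c k} = X"
    using obtain_enumeration[OF finX] Suc.prems(4) by auto
  have strip: "stack G k h - (\<lambda>j. Up j (int k)) ` (X - D k) =
      strip (int k) ({lo k..<?hi} - X) ({lo (Suc k)..<?hi - 1} - D (Suc k)) \<union> stack G (Suc k) h"
  proof -
    have "stack G k h - (\<lambda>j. Up j (int k)) ` (X - D k) = strip (int k) (G k - (X - D k)) (G (Suc k)) \<union> stack G (Suc k) h"
      unfolding stack_rec[OF k] using Up_in_stack[of _ "int k" G "Suc k" h] by (auto simp: strip_def)
    moreover have "G k - (X - D k) = {lo k..<?hi} - X" using Suc.prems(2) by (auto simp: G_def)
    moreover have "G (Suc k) = {lo (Suc k)..<?hi - 1} - D (Suc k)" by (simp add: G_def algebra_simps)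
    ultimately show ?thesis by simp
  qed
  \<comment> \<open>Both kinds of strip are brought to one form: a row starting at
    \<open>lo (Suc k)\<close> from which the positions \<open>e\<close> are removed.\<close>
  obtain e :: "nat \<Rightarrow> int" where e: "strict_mono_on {..?n} e" "e ` {..?n} \<subseteq> {lo (Suc k)..<?hi}"
    and ups: "{lo k..<?hi} - X = {lo (Suc k)..<?hi} - e ` {..?n}"
    and \<Phi>: "\<Phi> k X = (\<Sum>Y\<in>interlacing e ?n. (\<Prod>j\<in>Y. \<omega> (Suc k) j) * \<Phi> (Suc k) Y)"
    and De: "\<And>j. j \<in> D (Suc k) \<Longrightarrow> j \<in> e ` {..?n} \<and> j + 1 \<in> e ` {..?n}"
    using lo[OF k]
  proof (elim disjE conjE)
    assume lo': "lo (Suc k) = lo k" and c: "c k = Suc ?n"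
    show thesis
    proof (rule that[of x])
      show e: "strict_mono_on {..?n} x" using x(1) c by (simp add: lessThan_Suc_atMost)
      have im: "x ` {..?n} = X" using x(2) c by (simp add: lessThan_Suc_atMost)
      show "x ` {..?n} \<subseteq> {lo (Suc k)..<?hi}" using im lo' Suc.prems(3) by simp
      show "{lo k..<?hi} - X = {lo (Suc k)..<?hi} - x ` {..?n}" using im lo' by simp
      show "\<Phi> k X = (\<Sum>Y\<in>interlacing x ?n. (\<Prod>j\<in>Y. \<omega> (Suc k) j) * \<Phi> (Suc k) Y)"
        using up[OF k lo' e] im by simp
      show "j \<in> x ` {..?n} \<and> j + 1 \<in> x ` {..?n}" if "j \<in> D (Suc k)" for j
        using D[OF k that] lo' Suc.prems(2) im by auto
    qed
  next
    assume lo': "lo (Suc k) = lo k - 1" and c: "c k = ?n"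
    define e where "e = case_nat (lo (Suc k)) x"
    have im: "e ` {1..?n} = X"
    proof -
      have "Suc ` {..<?n} = {1..?n}" by (rule image_Suc_lessThan)
      then have "e ` {1..?n} = (\<lambda>i. e (Suc i)) ` {..<?n}" using image_image[of e Suc "{..<?n}"] by simp
      then show ?thesis using x(2) c by (simp add: e_def)
    qed
    have im0: "e ` {..?n} = insert (lo (Suc k)) X"
    proof -
      have "{..?n} = insert 0 {1..?n}" by auto
      then have "e ` {..?n} = insert (e 0) (e ` {1..?n})" by (metis image_insert)
      then show ?thesis using im by (simp add: e_def)
    qed
    show thesis
    proof (rule that[of e])
      show e: "strict_mono_on {..?n} e"
      proof (rule strict_mono_onI)
        fix r s assume rs: "r \<in> {..?n}" "s \<in> {..?n}" "r < s"
        then obtain s' where s': "s = Suc s'" by (cases s) auto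
        show "e r < e s"
        proof (cases r)
          case 0
          have "x s' \<in> X" using x(2) rs c s' by auto
          then have "lo k \<le> x s'" using Suc.prems(3) by auto
          then show ?thesis using 0 s' lo' by (simp add: e_def)
        next
          case (Suc r')
          then show ?thesis using strict_mono_onD[OF x(1), of r' s'] rs c s' by (simp add: e_def)
        qed
      qed
      show "e ` {..?n} \<subseteq> {lo (Suc k)..<?hi}"
        unfolding im0 using Suc.prems(3) lo' loN[OF k] by auto
      show "{lo k..<?hi} - X = {lo (Suc k)..<?hi} - e ` {..?n}"
      proof -
        have "{lo k..<?hi} = {lo (Suc k)..<?hi} - {lo (Suc k)}"
          using atLeastLessThan_Suc_int[of "lo (Suc k)" ?hi] lo' by simp
        then show ?thesis unfolding im0 by blast
      qed
      show "\<Phi> k X = (\<Sum>Y\<in>interlacing e ?n. (\<Prod>j\<in>Y. \<omega> (Suc k) j) * \<Phi> (Suc k) Y)"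
        using down[OF k lo' _ e] im by (simp add: e_def)
      show "j \<in> e ` {..?n} \<and> j + 1 \<in> e ` {..?n}" if "j \<in> D (Suc k)" for j
        unfolding im0 using D[OF k that] Suc.prems(2) by auto
    qed
  qed
  have finG: "finite (G i)" for i by (simp add: G_def)
  have bounds: "Y \<subseteq> {lo (Suc k)..<N - int (Suc k)}" if "Y \<in> interlacing e ?n" for Y
  proof
    fix j assume "j \<in> Y"
    then have "j \<in> {e 0..<e ?n}" using interlacing_subset[OF that] by blast
    moreover have "e 0 \<in> {lo (Suc k)..<?hi}" "e ?n \<in> {lo (Suc k)..<?hi}" using e(2) by auto
    ultimately show "j \<in> {lo (Suc k)..<N - int (Suc k)}" by simp
  qed
  have DY: "D (Suc k) \<subseteq> Y" if "Y \<in> interlacing e ?n" for Y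
    using interlacing_contains[OF e(1) that] De by blast
  have "M w (stack G k h - (\<lambda>j. Up j (int k)) ` (X - D k)) =
      (\<Sum>Y\<in>interlacing e ?n. (\<Prod>j\<in>Y - D (Suc k). w (vert (int k + 1) j)) *
        M w (stack G (Suc k) h - (\<lambda>j. Up j (int k + 1)) ` (Y - D (Suc k))))"
    unfolding strip ups
  proof (rule M_peel[of w "int k", OF w e De])
    show "finite (stack G (Suc k) h)" using finG by (rule finite_stack)
    show "int k < k'" if "Up j k' \<in> stack G (Suc k) h" for j k' using that by (simp add: Up_in_stack)
    show "int k + 1 < k'" if "Down j k' \<in> stack G (Suc k) h" for j k' using that by (simp add: Down_in_stack)
    show "(\<lambda>j. Up j (int k + 1)) ` (Y - D (Suc k)) \<subseteq> stack G (Suc k) h" if Y: "Y \<in> interlacing e ?n" for Y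
    \<comment> \<open>No up-pointing triangle lies above the top line, but there \<open>Y\<close> is
      empty since \<open>c h = 0\<close>.\<close>
    proof (cases "Suc k = h")
      case True
      then have "Y = {}" using Y top(1) by simp
      then show ?thesis by simp
    next
      case False
      have nat1: "nat (int k + 1) = Suc k" by simp
      show ?thesis
      proof
        fix t assume "t \<in> (\<lambda>j. Up j (int k + 1)) ` (Y - D (Suc k))"
        then obtain j where j: "j \<in> Y" "j \<notin> D (Suc k)" "t = Up j (int k + 1)" by auto
        then have "j \<in> G (Suc k)" using bounds[OF Y] unfolding G_def by blast
        then show "t \<in> stack G (Suc k) h" using False k j(3) unfolding j(3) Up_in_stack nat1 by auto
      qed
    qed
  qed
  also have "\<dots> = (\<Sum>Y\<in>interlacing e ?n. (\<Prod>j\<in>Y. \<omega> (Suc k) j) * \<Phi> (Suc k) Y)"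
  proof (rule sum.cong[OF refl])
    fix Y assume Y: "Y \<in> interlacing e ?n"
    have "M w (stack G (Suc k) h - (\<lambda>j. Up j (int (Suc k))) ` (Y - D (Suc k))) = \<Phi> (Suc k) Y"
      using k by (intro Suc.hyps(1)[OF d] DY bounds Y card_interlacing[OF e(1)]) auto
    moreover have "(\<Prod>j\<in>Y - D (Suc k). w (vert (int k + 1) j)) = (\<Prod>j\<in>Y. \<omega> (Suc k) j)"
    proof -
      have "(\<Prod>j\<in>Y - D (Suc k). w (vert (int k + 1) j)) = (\<Prod>j\<in>Y - D (Suc k). \<omega> (Suc k) j)"
        using \<omega>(1)[OF k] by (intro prod.cong refl) (simp add: add.commute)
      also have "\<dots> = (\<Prod>j\<in>Y. \<omega> (Suc k) j)"
        using interlacing_finite[OF Y] \<omega>(2)[OF k] by (intro prod.mono_neutral_left) auto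
      finally show ?thesis .
    qed
    ultimately show "(\<Prod>j\<in>Y - D (Suc k). w (vert (int k + 1) j)) *
        M w (stack G (Suc k) h - (\<lambda>j. Up j (int k + 1)) ` (Y - D (Suc k))) =
        (\<Prod>j\<in>Y. \<omega> (Suc k) j) * \<Phi> (Suc k) Y"
      by (simp add: add.commute)
  qed
  finally show ?case using \<Phi> by simp
qed

section \<open>The two zigzag boundaries\<close>

definition loK :: "nat \<Rightarrow> int" where "loK k = - int (k div 2)"

text \<open>The offset is 0 for the quartered hexagon and 1 for the lower part of the region, whose
  zigzag starts at \<open>[1;0]\<close>. A vertical direction loses one index every two lines
  because the coordinates are slanted.\<close>

definition loQ :: "int \<Rightarrow> nat \<Rightarrow> int" where "loQ c k = c - int ((k + 1) div 2)"

lemma KE_empty [simp]: "KE lo 0 {} = 1" and KO_empty [simp]: "KO lo 0 {} = 1"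
  and QE_empty [simp]: "QE lo 0 {} = 1" and QO_empty [simp]: "QO lo 0 {} = 1"
  by (simp_all add: KE_def KO_def QE_def QO_def vand_def)

text \<open>\<open>KE\<close> and \<open>KO\<close> alternate along the zigzag, and
  \<open>c k\<close> is half the number of strips above height \<open>k\<close>, rounded up. The
  condition on \<open>loK (Suc k)\<close> keeps the dents off the corners, so that no weight
  \<open>1 / 2\<close> meets a removed position. For \<open>n = 0\<close> truncated subtraction
  gives the empty stack.\<close>

lemma M_stack_K:
  fixes D :: "nat \<Rightarrow> int set" and N :: int
  assumes w: "\<And>k j j'. w {Up j k, Down j' (k + 1)} = 1"
    and wv: "\<And>k j. 0 < k \<Longrightarrow> k \<le> 2 * n - 1 \<Longrightarrow> w (vert (int k) j) = (if even k \<and> j = loK k then 1 / 2 else 1)"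
    and D: "\<And>k j. j \<in> D (Suc k) \<Longrightarrow> j + 1 \<in> D k \<and> j \<in> D k" "\<And>k. loK (Suc k) \<notin> D (Suc k)"
    and X: "D 0 \<subseteq> X" "X \<subseteq> {0..<N}" "card X = n"
  shows "M w (stack (\<lambda>i. {loK i..<N - int i} - D i) 0 (2 * n - 1) - (\<lambda>j. Up j 0) ` (X - D 0)) = KE 0 n X"
proof -
  define c where "c = (\<lambda>k. (2 * n - 1 - k + 1) div 2)"
  define \<Phi> where "\<Phi> = (\<lambda>k X. if even k then KE (loK k) (c k) X else KO (loK k) (c k) X)"
  define \<omega> where "\<omega> = (\<lambda>k j. if even k \<and> j = loK k then 1 / 2 else 1 :: real)"
  have even: "loK (Suc k) = loK k" "c k = Suc (c (Suc k))" if k: "k < 2 * n - 1" "even k" for k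
  proof -
    show "loK (Suc k) = loK k" using k(2) by (auto simp: loK_def elim!: evenE)
    obtain i where "k = 2 * i" using k(2) by (auto elim: evenE)
    moreover from this have "i < n" using k(1) by simp
    then obtain r where "n = i + Suc r" by (auto simp: less_iff_Suc_add)
    ultimately have "2 * n - 1 - k = 2 * r + 1" "2 * n - 1 - Suc k = 2 * r" by simp_all
    then show "c k = Suc (c (Suc k))" unfolding c_def by simp
  qed
  have odd: "loK (Suc k) = loK k - 1" "c k = c (Suc k)" if k: "k < 2 * n - 1" "odd k" for k
  proof -
    show "loK (Suc k) = loK k - 1" using k(2) by (auto simp: loK_def elim!: oddE)
    obtain i where "k = 2 * i + 1" using k(2) by (auto elim: oddE)
    moreover from this have "Suc i < n" using k(1) by simp
    then obtain r where "n = Suc i + Suc r" by (auto simp: less_iff_Suc_add)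
    ultimately have "2 * n - 1 - k = 2 * r + 2" "2 * n - 1 - Suc k = 2 * r + 1" by simp_all
    then show "c k = c (Suc k)" unfolding c_def by simp
  qed
  have "n \<le> nat N" using card_mono[OF _ X(2)] X(3) by simp
  have "M w (stack (\<lambda>i. {loK i..<N - int i} - D i) 0 (2 * n - 1) - (\<lambda>j. Up j (int 0)) ` (X - D 0)) = \<Phi> 0 X"
  proof (rule M_stack[where w = w and h = "2 * n - 1" and lo = loK and D = D and N = N and c = c and \<Phi> = \<Phi> and \<omega> = \<omega> and X = X, OF w])
    show "loK (Suc k) = loK k \<and> c k = Suc (c (Suc k)) \<or> loK (Suc k) = loK k - 1 \<and> c k = c (Suc k)" if "k < 2 * n - 1" for k
      using even[OF that] odd[OF that] by blast
    show "loK k \<le> N - int k" if "k < 2 * n - 1" for k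
      using that \<open>n \<le> nat N\<close> by (cases "even k") (auto simp: loK_def elim!: evenE oddE)
    show "j + 1 \<in> D k \<and> (j \<in> D k \<or> j = loK (Suc k) \<and> loK (Suc k) = loK k - 1)" if "j \<in> D (Suc k)" for k j
      using D(1)[OF that] by blast
    show "w (vert (int (Suc k)) j) = \<omega> (Suc k) j" if "k < 2 * n - 1" for k j
      using wv[of "Suc k" j] that by (simp add: \<omega>_def)
    show "\<omega> (Suc k) j = 1" if "j \<in> D (Suc k)" for k j
      using D(2)[of k] that by (auto simp: \<omega>_def)
    show "\<Phi> k (e ` {..c (Suc k)}) = (\<Sum>Y\<in>interlacing e (c (Suc k)). (\<Prod>j\<in>Y. \<omega> (Suc k) j) * \<Phi> (Suc k) Y)"
      if "k < 2 * n - 1" "loK (Suc k) = loK k" "strict_mono_on {..c (Suc k)} e" for k e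
    proof -
      have "even k" using odd[OF that(1)] that(2) by auto
      then show ?thesis using even[OF that(1)] KE_step[OF that(3), of "loK k"] by (simp add: \<Phi>_def \<omega>_def)
    qed
    show "\<Phi> k (e ` {1..c (Suc k)}) = (\<Sum>Y\<in>interlacing e (c (Suc k)). (\<Prod>j\<in>Y. \<omega> (Suc k) j) * \<Phi> (Suc k) Y)"
      if "k < 2 * n - 1" "loK (Suc k) = loK k - 1" "e 0 = loK (Suc k)" "strict_mono_on {..c (Suc k)} e" for k e
    proof -
      have "odd k" using even[OF that(1)] that(2) by auto
      then show ?thesis using odd[OF that(1)] KO_step[OF that(4), of "loK k"] that(3) by (simp add: \<Phi>_def \<omega>_def)
    qed
    show "c (2 * n - 1) = 0" by (simp add: c_def)
    then show "\<Phi> (2 * n - 1) {} = 1" by (cases n) (simp_all add: \<Phi>_def)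
    show "card X = c 0" using X(3) by (cases n) (auto simp: c_def)
  qed (use X in \<open>auto simp: loK_def\<close>)
  moreover have "c 0 = n" by (cases n) (auto simp: c_def)
  ultimately show ?thesis by (simp add: \<Phi>_def loK_def)
qed

text \<open>A dent may touch this zigzag: on a line where the zigzag has just moved west, its corner
  position has the placeholder as lower left neighbour instead of a dent. The half triangle of the
  lower part makes use of this.\<close>

lemma M_stack_Q:
  fixes D :: "nat \<Rightarrow> int set" and N :: int
  assumes w: "\<And>k j j'. w {Up j k, Down j' (k + 1)} = 1" and wv: "\<And>k j. w (vert k j) = 1"
    and D: "\<And>k j. j \<in> D (Suc k) \<Longrightarrow> j + 1 \<in> D k \<and> (j \<in> D k \<or> even k \<and> j = loQ l (Suc k))"
    and X: "D 0 \<subseteq> X" "X \<subseteq> {l..<N}" "card X = n"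
  shows "M w (stack (\<lambda>i. {loQ l i..<N - int i} - D i) 0 (2 * n) - (\<lambda>j. Up j 0) ` (X - D 0)) = QE l n X"
proof -
  define c where "c = (\<lambda>k. (2 * n - k + 1) div 2)"
  define \<Phi> where "\<Phi> = (\<lambda>k X. if even k then QE (loQ l k) (c k) X else QO (loQ l k) (c k) X)"
  have even: "loQ l (Suc k) = loQ l k - 1" "c k = c (Suc k)" if k: "k < 2 * n" "even k" for k
  proof -
    show "loQ l (Suc k) = loQ l k - 1" using k(2) by (auto simp: loQ_def elim!: evenE)
    obtain i where "k = 2 * i" using k(2) by (auto elim: evenE)
    moreover from this have "i < n" using k(1) by simp
    then obtain r where "n = i + Suc r" by (auto simp: less_iff_Suc_add)
    ultimately have "2 * n - k = 2 * r + 2" "2 * n - Suc k = 2 * r + 1" by simp_all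
    then show "c k = c (Suc k)" unfolding c_def by simp
  qed
  have odd: "loQ l (Suc k) = loQ l k" "c k = Suc (c (Suc k))" if k: "k < 2 * n" "odd k" for k
  proof -
    show "loQ l (Suc k) = loQ l k" using k(2) by (auto simp: loQ_def elim!: oddE)
    obtain i where "k = 2 * i + 1" using k(2) by (auto elim: oddE)
    moreover from this have "i < n" using k(1) by simp
    then obtain r where "n = i + Suc r" by (auto simp: less_iff_Suc_add)
    ultimately have "2 * n - k = 2 * r + 1" "2 * n - Suc k = 2 * r" by simp_all
    then show "c k = Suc (c (Suc k))" unfolding c_def by simp
  qed
  have "n \<le> nat (N - l)" using card_mono[OF _ X(2)] X(3) by simp
  have "M w (stack (\<lambda>i. {loQ l i..<N - int i} - D i) 0 (2 * n) - (\<lambda>j. Up j (int 0)) ` (X - D 0)) = \<Phi> 0 X"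
  proof (rule M_stack[where w = w and h = "2 * n" and lo = "loQ l" and D = D and N = N and c = c and \<Phi> = \<Phi> and \<omega> = "\<lambda>_ _. 1" and X = X, OF w])
    show "loQ l (Suc k) = loQ l k \<and> c k = Suc (c (Suc k)) \<or> loQ l (Suc k) = loQ l k - 1 \<and> c k = c (Suc k)" if "k < 2 * n" for k
      using even[OF that] odd[OF that] by blast
    show "loQ l k \<le> N - int k" if "k < 2 * n" for k
      using that \<open>n \<le> nat (N - l)\<close> by (cases "even k") (auto simp: loQ_def elim!: evenE oddE)
    show "j + 1 \<in> D k \<and> (j \<in> D k \<or> j = loQ l (Suc k) \<and> loQ l (Suc k) = loQ l k - 1)"
      if "k < 2 * n" "j \<in> D (Suc k)" for k j
      using D[OF that(2)] even(1)[OF that(1)] by blast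
    show "\<Phi> k (e ` {..c (Suc k)}) = (\<Sum>Y\<in>interlacing e (c (Suc k)). (\<Prod>j\<in>Y. 1) * \<Phi> (Suc k) Y)"
      if "k < 2 * n" "loQ l (Suc k) = loQ l k" "strict_mono_on {..c (Suc k)} e" for k e
    proof -
      have "odd k" using even[OF that(1)] that(2) by auto
      then show ?thesis using odd[OF that(1)] QO_step[OF that(3), of "loQ l k"] by (simp add: \<Phi>_def)
    qed
    show "\<Phi> k (e ` {1..c (Suc k)}) = (\<Sum>Y\<in>interlacing e (c (Suc k)). (\<Prod>j\<in>Y. 1) * \<Phi> (Suc k) Y)"
      if "k < 2 * n" "loQ l (Suc k) = loQ l k - 1" "e 0 = loQ l (Suc k)" "strict_mono_on {..c (Suc k)} e" for k e
    proof -
      have "even k" using odd[OF that(1)] that(2) by auto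
      then show ?thesis using even[OF that(1)] QE_step[OF that(4), of "loQ l k"] that(3) by (simp add: \<Phi>_def)
    qed
    show "c (2 * n) = 0" by (simp add: c_def)
    then show "\<Phi> (2 * n) {} = 1" by (simp add: \<Phi>_def)
    show "card X = c 0" using X(3) by (simp add: c_def)
  qed (use X wv in \<open>auto simp: loQ_def\<close>)
  then show ?thesis by (simp add: \<Phi>_def loQ_def c_def)
qed

section \<open>The regions as stacks of strips\<close>

lemma zigzag_weight_nonvertical [simp]: "zigzag_weight Z {Up j k, Down j' (k + 1)} = 1"
  by (auto simp: zigzag_weight_def doubleton_eq_iff)

lemma zigzag_weight_vert:
  "zigzag_weight Z (vert k j) =
    (if {lattice_point j k, lattice_point j (k + 1), lattice_point (j + 1) (k - 1)} \<subseteq> Z then 1 / 2 else 1)"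
proof -
  have 1: "lattice_point (j + 1) (k - 1) = (of_int j + of_int (k + 1) / 2, k - 1)"
    by (simp add: lattice_point_def field_simps)
  have "(\<exists>j' k'. vert k j = {Up j' k', Down j' k'} \<and> S j' k') \<longleftrightarrow> S j k" for S
    by (auto simp: vert_def doubleton_eq_iff)
  then show ?thesis
    unfolding zigzag_weight_def 1 by (simp add: lattice_point_def)
qed

lemma alpha_le: "\<alpha> k \<le> of_int j + of_int k / 2 \<longleftrightarrow> - (k div 2) \<le> j"
  by (cases "even k") (auto simp: \<alpha>_def field_simps elim!: evenE oddE)

lemma beta_le: "\<beta> k \<le> of_int j + of_int k / 2 \<longleftrightarrow> 1 - (k + 1) div 2 \<le> j"
  by (cases "even k") (auto simp: \<beta>_def field_simps elim!: evenE oddE)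

lemma gamma_le: "\<gamma> k \<le> of_int j + of_int k / 2 \<longleftrightarrow> - ((k + 1) div 2) \<le> j"
  by (cases "even k") (auto simp: \<gamma>_def field_simps elim!: evenE oddE)

lemma alpha_eq: "\<alpha> k = of_int j + of_int k / 2 \<longleftrightarrow> j = - (k div 2)"
  by (cases "even k") (auto simp: \<alpha>_def field_simps elim!: evenE oddE)

lemma lattice_point_in_zigzag:
  "lattice_point j k \<in> \<alpha>_zigzag N \<longleftrightarrow> 0 \<le> k \<and> k \<le> N \<and> j = - (k div 2)"
  using alpha_eq[of k j] by (auto simp: \<alpha>_zigzag_def lattice_point_def)

lemma zigzag_weight_vert_nonpos: "k \<le> 0 \<Longrightarrow> zigzag_weight (\<alpha>_zigzag N) (vert k j) = 1"
  by (simp add: zigzag_weight_vert lattice_point_in_zigzag)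

text \<open>At an odd height the points to the upper and lower right of a zigzag point are off the
  zigzag, so only even heights carry weights. The top height \<open>2 * n - 1\<close> is odd, hence
  the corner above an even height always exists.\<close>

lemma zigzag_weight_vert_pos:
  assumes "0 < k" "k \<le> 2 * n - 1"
  shows "zigzag_weight (\<alpha>_zigzag (2 * int n - 1)) (vert (int k) j) = (if even k \<and> j = loK k then 1 / 2 else 1)"
proof -
  have "{lattice_point j (int k), lattice_point j (int k + 1), lattice_point (j + 1) (int k - 1)} \<subseteq> \<alpha>_zigzag (2 * int n - 1) \<longleftrightarrow>
    even k \<and> j = loK k"
  proof (cases "even k")
    case True
    then obtain i where i: "k = 2 * i" by (auto elim: evenE)
    have "i < n" using assms i by presburger
    then have "int k + 1 \<le> 2 * int n - 1" using i by simp
    then show ?thesis using assms i by (auto simp: lattice_point_in_zigzag loK_def)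
  next
    case False
    then obtain i where "k = 2 * i + 1" by (auto elim: oddE)
    then show ?thesis by (auto simp: lattice_point_in_zigzag)
  qed
  then show ?thesis by (simp add: zigzag_weight_vert)
qed

lemma Up_triangles_in:
  "Up j k \<in> triangles_in P \<longleftrightarrow> lattice_point j k \<in> P \<and> lattice_point (j + 1) k \<in> P \<and> lattice_point j (k + 1) \<in> P"
  unfolding triangles_in_def mem_Collect_eq corners_Up by simp

lemma Down_triangles_in:
  "Down j k \<in> triangles_in P \<longleftrightarrow> lattice_point j k \<in> P \<and> lattice_point (j + 1) k \<in> P \<and> lattice_point (j + 1) (k - 1) \<in> P"
  unfolding triangles_in_def mem_Collect_eq corners_Down by simp

lemma lattice_point_le_left:
  "of_int j + of_int k / 2 \<le> real R - of_int k / 2 \<longleftrightarrow> j + k \<le> int R"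
  by linarith

text \<open>In slanted coordinates the index of the zigzag never rises and drops by at most one from
  line to line, so the boundary condition at the horizontal side of a triangle implies the one at
  its third corner.\<close>

lemma trapezoid_K_eq_stack:
  "triangles_in {(u, k). 0 \<le> k \<and> k \<le> 2 * int n - 1 \<and> \<alpha> k \<le> u \<and> u \<le> real R - of_int k / 2} =
    stack (\<lambda>i. {loK i..<int R - int i}) 0 (2 * n - 1)" (is "triangles_in ?P = _")
proof (rule Set.set_eqI)
  fix t
  have P: "lattice_point j k \<in> ?P \<longleftrightarrow> 0 \<le> k \<and> k \<le> 2 * int n - 1 \<and> - (k div 2) \<le> j \<and> j + k \<le> int R" for j k
    by (simp add: lattice_point_def alpha_le lattice_point_le_left)
  show "t \<in> triangles_in ?P \<longleftrightarrow> t \<in> stack (\<lambda>i. {loK i..<int R - int i}) 0 (2 * n - 1)"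
  proof (cases t)
    case (Up j k)
    show ?thesis
    proof (cases "0 \<le> k")
      case True
      then have "loK (nat k) = - (k div 2)" by (simp add: loK_def zdiv_int)
      moreover have "k div 2 \<le> (k + 1) div 2" by simp
      ultimately show ?thesis
        unfolding Up Up_triangles_in P Up_in_stack using True by auto
    next
      case False
      then show ?thesis unfolding Up Up_triangles_in P Up_in_stack by auto
    qed
  next
    case (Down j k)
    show ?thesis
    proof (cases "0 < k")
      case True
      then have "loK (nat k) = - (k div 2)" by (simp add: loK_def zdiv_int)
      moreover have "k div 2 \<le> (k - 1) div 2 + 1" by simp
      ultimately show ?thesis
        unfolding Down Down_triangles_in P Down_in_stack using True by auto
    next
      case False
      then show ?thesis unfolding Down Down_triangles_in P Down_in_stack by auto
    qed
  qed
qed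

lemma loQ_nat: "0 \<le> k \<Longrightarrow> loQ c (nat k) = c - (k + 1) div 2"
  by (simp add: loQ_def zdiv_int)

lemma trapezoid_Q_eq_stack:
  "triangles_in {(u, k). 0 \<le> k \<and> k \<le> 2 * int n \<and> \<gamma> k \<le> u \<and> u \<le> real R - of_int k / 2} =
    stack (\<lambda>i. {loQ 0 i..<int R - int i}) 0 (2 * n)" (is "triangles_in ?P = _")
proof (rule Set.set_eqI)
  fix t
  have P: "lattice_point j k \<in> ?P \<longleftrightarrow> 0 \<le> k \<and> k \<le> 2 * int n \<and> - ((k + 1) div 2) \<le> j \<and> j + k \<le> int R" for j k
    by (simp add: lattice_point_def gamma_le lattice_point_le_left)
  show "t \<in> triangles_in ?P \<longleftrightarrow> t \<in> stack (\<lambda>i. {loQ 0 i..<int R - int i}) 0 (2 * n)"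
  proof (cases t)
    case (Up j k)
    show ?thesis
    proof (cases "0 \<le> k")
      case True
      have "(k + 1) div 2 \<le> (k + 1 + 1) div 2" by simp
      then show ?thesis
        unfolding Up Up_triangles_in P Up_in_stack using loQ_nat[OF True] True by auto
    next
      case False
      then show ?thesis unfolding Up Up_triangles_in P Up_in_stack by auto
    qed
  next
    case (Down j k)
    show ?thesis
    proof (cases "0 < k")
      case True
      have "(k + 1) div 2 \<le> (k - 1 + 1) div 2 + 1" by simp
      then show ?thesis
        unfolding Down Down_triangles_in P Down_in_stack using loQ_nat[of k] True by auto
    next
      case False
      then show ?thesis unfolding Down Down_triangles_in P Down_in_stack by auto
    qed
  qed
qed

section \<open>Reflection in the line at height 0\<close>

fun reflect :: "utriangle \<Rightarrow> utriangle" where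
  "reflect (Up j k) = Down (j + k) (- k)"
| "reflect (Down j k) = Up (j + k) (- k)"

lemma reflect_reflect [simp]: "reflect (reflect t) = t"
  by (cases t) auto

lemma inj_reflect: "inj reflect"
  by (metis injI reflect_reflect)

lemma in_reflect_image: "t \<in> reflect ` R \<longleftrightarrow> reflect t \<in> R"
  by (metis imageE imageI reflect_reflect)

definition mirror :: "point \<Rightarrow> point" where "mirror p = (fst p, - snd p)"

lemma mirror_lattice_point: "mirror (lattice_point j k) = lattice_point (j + k) (- k)"
  by (simp add: mirror_def lattice_point_def)

lemma inj_mirror: "inj mirror"
  by (auto simp: inj_def mirror_def prod_eq_iff)

lemma corners_reflect: "corners (reflect t) = mirror ` corners t"
proof (cases t)
  case (Up j k)
  have eq: "- (k + 1) = - k - 1" by simp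
  show ?thesis
    unfolding Up reflect.simps corners_Up corners_Down image_insert image_empty mirror_lattice_point eq
    by (simp add: add_ac)
next
  case (Down j k)
  have eq: "- (k - 1) = - k + 1" by simp
  show ?thesis
    unfolding Down reflect.simps corners_Up corners_Down image_insert image_empty mirror_lattice_point eq
    by (simp add: add_ac)
qed

lemma triangles_in_reflect: "t \<in> triangles_in P \<longleftrightarrow> reflect t \<in> triangles_in {p. mirror p \<in> P}"
proof -
  have "mirror (mirror p) = p" for p by (simp add: mirror_def)
  then show ?thesis by (auto simp: triangles_in_def corners_reflect)
qed

lemma lozenge_reflect: "lozenge (reflect ` l) \<longleftrightarrow> lozenge l"
proof -
  have *: "lozenge (reflect ` l)" if loz: "lozenge l" for l
  proof -
    obtain s t where l: "s \<noteq> t" "card (corners s \<inter> corners t) = 2" "l = {s, t}"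
      using loz by (auto simp: lozenge_def)
    have "reflect s \<noteq> reflect t" using l(1) by (metis reflect_reflect)
    moreover have "corners (reflect s) \<inter> corners (reflect t) = mirror ` (corners s \<inter> corners t)"
      unfolding corners_reflect by (rule image_Int[OF inj_mirror, symmetric])
    then have "card (corners (reflect s) \<inter> corners (reflect t)) = 2"
      using l(2) card_image[OF inj_on_subset[OF inj_mirror subset_UNIV]] by simp
    ultimately show ?thesis unfolding l(3) lozenge_def by auto
  qed
  have "reflect ` reflect ` l = l" by (simp add: image_image)
  then show ?thesis using *[of l] *[of "reflect ` l"] by auto
qed

lemma tilings_reflect:
  assumes "P \<in> tilings R"
  shows "(`) reflect ` P \<in> tilings (reflect ` R)"
proof (rule tilingsI)
  show "\<Union> ((`) reflect ` P) = reflect ` R" using tilingsD(1)[OF assms] by auto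
  show "lozenge l" if "l \<in> (`) reflect ` P" for l
    using that tilingsD(2)[OF assms] lozenge_reflect by auto
  show "l = l'" if l: "l \<in> (`) reflect ` P" "l' \<in> (`) reflect ` P" "x \<in> l" "x \<in> l'" for l l' x
  proof -
    obtain m m' where m: "m \<in> P" "l = reflect ` m" "m' \<in> P" "l' = reflect ` m'" using l(1,2) by auto
    then have "reflect x \<in> m" "reflect x \<in> m'" using l(3,4) in_reflect_image by auto
    then have "m = m'" by (rule tilingsD(4)[OF assms m(1,3)])
    then show ?thesis using m by simp
  qed
qed

lemma card_tilings_reflect: "card (tilings (reflect ` R)) = card (tilings R)"
proof -
  have rr: "reflect ` reflect ` A = A" for A by (simp add: image_image)
  have rrr: "(`) reflect ` (`) reflect ` P = P" for P by (simp add: image_image)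
  have "bij_betw (\<lambda>P. (`) reflect ` P) (tilings R) (tilings (reflect ` R))"
  proof (rule bij_betw_byWitness[where f' = "\<lambda>P. (`) reflect ` P"])
    show "(\<lambda>P. (`) reflect ` P) ` tilings R \<subseteq> tilings (reflect ` R)" using tilings_reflect by blast
    show "(\<lambda>P. (`) reflect ` P) ` tilings (reflect ` R) \<subseteq> tilings R"
      using tilings_reflect[of _ "reflect ` R"] unfolding rr by blast
  qed (simp_all only: rrr, simp_all)
  then show ?thesis using bij_betw_same_card by fastforce
qed

lemma M_one: "(\<And>l. l \<in> \<Union> (tilings R) \<Longrightarrow> w l = 1) \<Longrightarrow> M w R = real (card (tilings R))"
proof -
  assume "\<And>l. l \<in> \<Union> (tilings R) \<Longrightarrow> w l = 1"
  then have "(\<Prod>l\<in>P. w l) = 1" if "P \<in> tilings R" for P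
    using that by (intro prod.neutral) blast
  then show ?thesis by (simp add: M_def)
qed

text \<open>After reflection the side from \<open>[L;0]\<close> to \<open>[L + z/2;-z]\<close> is
  the western side of an up-pointing triangle with base from \<open>L\<close> to
  \<open>L + z\<close>. The lower part is thus a trapezoid of width \<open>L + z\<close> with one
  more dent, which is the origin of the last entry \<open>z\<close> of
  \<open>t_minus\<close>.\<close>

lemma lower_eq_stack:
  "triangles_in {(u, k). - (2 * int n) \<le> k \<and> k \<le> 0 \<and> \<beta> k \<le> u \<and> u \<le> real L - of_int k / 2 \<and> u \<le> real (L + z) + of_int k / 2} =
    reflect ` stack (\<lambda>i. {loQ 1 i..<int (L + z) - int i} - {int L..}) 0 (2 * n)" (is "triangles_in ?P = _")
proof (rule Set.set_eqI)
  fix t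
  let ?P' = "{p. mirror p \<in> ?P}"
  have beta: "\<beta> (- k) = \<beta> k" for k by (simp add: \<beta>_def)
  have P: "lattice_point j k \<in> ?P' \<longleftrightarrow> 0 \<le> k \<and> k \<le> 2 * int n \<and> 1 - (k + 1) div 2 \<le> j \<and> j \<le> int L \<and> j + k \<le> int (L + z)" for j k
  proof -
    have "of_int j + of_int k / 2 \<le> real L + of_int k / 2 \<longleftrightarrow> j \<le> int L" by linarith
    then show ?thesis
      using lattice_point_le_left[of j k "L + z"] beta_le[of k j]
      by (auto simp: lattice_point_def mirror_def beta)
  qed
  have "t \<in> triangles_in ?P \<longleftrightarrow> reflect t \<in> triangles_in ?P'" by (rule triangles_in_reflect)
  also have "\<dots> \<longleftrightarrow> reflect t \<in> stack (\<lambda>i. {loQ 1 i..<int (L + z) - int i} - {int L..}) 0 (2 * n)"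
  proof (cases "reflect t")
    case (Up j k)
    show ?thesis
    proof (cases "0 \<le> k")
      case True
      have "(k + 1) div 2 \<le> (k + 1 + 1) div 2" by simp
      then show ?thesis
        unfolding Up Up_triangles_in P Up_in_stack using loQ_nat[OF True, of 1] True by auto
    next
      case False
      then show ?thesis unfolding Up Up_triangles_in P Up_in_stack by auto
    qed
  next
    case (Down j k)
    show ?thesis
    proof (cases "0 < k")
      case True
      have "(k + 1) div 2 \<le> (k - 1 + 1) div 2 + 1" by simp
      then show ?thesis
        unfolding Down Down_triangles_in P Down_in_stack using loQ_nat[of k 1] True by auto
    next
      case False
      then show ?thesis unfolding Down Down_triangles_in P Down_in_stack by auto
    qed
  qed
  finally show "t \<in> triangles_in ?P \<longleftrightarrow> t \<in> reflect ` stack (\<lambda>i. {loQ 1 i..<int (L + z) - int i} - {int L..}) 0 (2 * n)"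
    by (simp add: in_reflect_image)
qed

lemma lattice_point_up_triangle:
  "lattice_point j k \<in> up_triangle p q \<longleftrightarrow> 0 \<le> k \<and> int p \<le> j \<and> j + k \<le> int q"
proof -
  have "real p \<le> of_int j \<longleftrightarrow> int p \<le> j" by linarith
  then show ?thesis by (simp add: lattice_point_def up_triangle_def lattice_point_le_left)
qed

lemma up_triangle_triangles:
  "Up j k \<in> triangles_in (up_triangle p q) \<longleftrightarrow> 0 \<le> k \<and> int p \<le> j \<and> j + k < int q"
  "Down j k \<in> triangles_in (up_triangle p q) \<longleftrightarrow> 0 < k \<and> int p \<le> j \<and> j + k < int q"
  unfolding Up_triangles_in Down_triangles_in lattice_point_up_triangle by auto

lemma down_triangle_triangles:
  "t \<in> triangles_in (down_triangle p q) \<longleftrightarrow> reflect t \<in> triangles_in (up_triangle p q)"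
proof -
  have "{u. mirror u \<in> down_triangle p q} = up_triangle p q"
    by (auto simp: mirror_def down_triangle_def up_triangle_def)
  then show ?thesis using triangles_in_reflect[of t "down_triangle p q"] by simp
qed

lemma half_triangle_triangles:
  "t \<in> triangles_in {(u, k). k \<le> 0 \<and> u \<le> real a + of_int k / 2} \<longleftrightarrow>
    (case reflect t of Up j k \<Rightarrow> 0 \<le> k \<and> j + k < int a | Down j k \<Rightarrow> 0 < k \<and> j + k < int a)" (is "t \<in> triangles_in ?P \<longleftrightarrow> _")
proof -
  let ?P' = "{p. mirror p \<in> ?P}"
  have P: "lattice_point j k \<in> ?P' \<longleftrightarrow> 0 \<le> k \<and> j + k \<le> int a" for j k
    using lattice_point_le_left[of j k a] by (auto simp: lattice_point_def mirror_def)
  have *: "t \<in> triangles_in ?P \<longleftrightarrow> reflect t \<in> triangles_in ?P'" by (rule triangles_in_reflect)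
  show ?thesis
  proof (cases "reflect t")
    case (Up j k)
    then show ?thesis unfolding * Up Up_triangles_in P by auto
  next
    case (Down j k)
    then show ?thesis unfolding * Down Down_triangles_in P by auto
  qed
qed

section \<open>Positions of the removed triangles\<close>

text \<open>The horizontal sections at level \<open>k\<close> of the triangles removed along the line, where the Boolean
  tells whether the first triangle lies on the side considered.\<close>

fun blocks :: "bool \<Rightarrow> int \<Rightarrow> int \<Rightarrow> nat list \<Rightarrow> int set" where
  "blocks f s k [] = {}"
| "blocks f s k (t # ts) = (if f then {j. s \<le> j \<and> j + k < s + int t} else {}) \<union> blocks (\<not> f) (s + int t) k ts"

fun rblocks :: "bool \<Rightarrow> int \<Rightarrow> int \<Rightarrow> nat list \<Rightarrow> int set" where
  "rblocks g L k [] = {}"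
| "rblocks g L k (b # bs) = (if g then {j. L - int b \<le> j \<and> j + k < L} else {}) \<union> rblocks (\<not> g) (L - int b) k bs"

lemma seq_Cons: "seq (t # ts) (Suc (Suc i)) = seq ts (Suc i)" "seq (t # ts) (Suc 0) = t"
  by (simp_all add: seq_def)

lemma psum_0 [simp]: "psum ts 0 = 0"
  by (simp add: psum_def)

lemma psum_Suc: "psum ts (Suc i) = psum ts i + seq ts (Suc i)"
  by (simp add: psum_def)

lemma psum_Cons [simp]: "psum (t # ts) (Suc i) = t + psum ts i"
  by (induction i) (simp_all add: psum_Suc seq_Cons)

lemma psum_eq_sum_take: "psum ts k = sum_list (take k ts)"
proof (induction ts arbitrary: k)
  case Nil
  then show ?case by (simp add: psum_def seq_def)
next
  case (Cons t ts)
  then show ?case by (cases k) simp_all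
qed

lemma osum_Cons: "osum (t # ts) = t + esum ts" and esum_Cons: "esum (t # ts) = osum ts"
proof -
  have "{i \<in> {1..length (t # ts)}. odd i} = insert 1 (Suc ` {i \<in> {1..length ts}. even i})"
    "{i \<in> {1..length (t # ts)}. even i} = Suc ` {i \<in> {1..length ts}. odd i}"
    by (rule Set.set_eqI, rename_tac x, case_tac x; auto simp: image_iff Suc_le_eq odd_pos)+
  moreover have "seq (t # ts) (Suc i) = seq ts i" if "i \<in> {1..length ts}" for i
    using that by (cases i) (auto simp: seq_Cons)
  moreover have "1 \<notin> Suc ` {i \<in> {1..length ts}. even i}" by auto
  ultimately show "osum (t # ts) = t + esum ts" "esum (t # ts) = osum ts"
    by (simp_all add: osum_def esum_def sum.reindex seq_def)
qed

lemma osum_Nil [simp]: "osum [] = 0" and esum_Nil [simp]: "esum [] = 0"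
  by (simp_all add: osum_def esum_def)

lemma osum_plus_esum: "osum ts + esum ts = sum_list ts"
  by (induction ts) (auto simp: osum_Cons esum_Cons)

lemma blocks_iff:
  "j \<in> blocks f s k ts \<longleftrightarrow> (\<exists>i<length ts. (even i \<longleftrightarrow> f) \<and> s + int (psum ts i) \<le> j \<and> j + k < s + int (psum ts (Suc i)))"
proof (induction ts arbitrary: f s)
  case Nil
  then show ?case by simp
next
  case (Cons t ts)
  show ?case
    unfolding list.size(4) add_0_right add_Suc_right Ex_less_Suc2 blocks.simps Un_iff Cons.IH
    by (auto simp: add.assoc)
qed

lemma rblocks_iff:
  "j \<in> rblocks g L k bs \<longleftrightarrow> (\<exists>i<length bs. (even i \<longleftrightarrow> g) \<and> L - int (psum bs (Suc i)) \<le> j \<and> j + k < L - int (psum bs i))"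
proof (induction bs arbitrary: g L)
  case Nil
  then show ?case by simp
next
  case (Cons b bs)
  show ?case
    unfolding list.size(4) add_0_right add_Suc_right Ex_less_Suc2 rblocks.simps Un_iff Cons.IH
    by (auto simp: algebra_simps)
qed

lemma blocks_append:
  "blocks f s k (xs @ ys) = blocks f s k xs \<union> blocks (if even (length xs) then f else \<not> f) (s + int (sum_list xs)) k ys"
  by (induction xs arbitrary: f s) (auto simp: add.assoc)

lemma rblocks_append:
  "rblocks g L k (xs @ ys) = rblocks g L k xs \<union> rblocks (if even (length xs) then g else \<not> g) (L - int (sum_list xs)) k ys"
  by (induction xs arbitrary: g L) (auto simp: algebra_simps)

text \<open>Read from left to right, the dents on the right are those of the reversed sequence; the
  parity of the length decides whether its first block counts.\<close>

lemma rblocks_eq_blocks_rev: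
  "rblocks g L 0 bs = blocks (odd (length bs) \<longleftrightarrow> g) (L - int (sum_list bs)) 0 (rev bs)"
proof (induction bs arbitrary: g L)
  case (Cons b bs)
  have s: "L - int b - int (sum_list bs) = L - int (sum_list (b # bs))" by simp
  show ?case
    unfolding rblocks.simps Cons.IH rev.simps blocks_append s by (auto simp: algebra_simps)
qed simp

lemma blocks_subset: "blocks f s 0 ts \<subseteq> {s..<s + int (sum_list ts)}"
proof (induction ts arbitrary: f s)
  case (Cons t ts)
  have "blocks (\<not> f) (s + int t) 0 ts \<subseteq> {s + int t..<s + int t + int (sum_list ts)}" by (rule Cons.IH)
  also have "\<dots> \<subseteq> {s..<s + int (sum_list (t # ts))}" by auto
  finally show ?case by auto
qed simp

lemma finite_blocks [simp]: "finite (blocks f s 0 ts)"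
  by (rule finite_subset[OF blocks_subset]) simp

text \<open>Consecutive blocks abut at level 0 and alternate in parity. This is the reason why a
  position covered by the sequence is removed on exactly one side of the line.\<close>

lemma blocks_partition:
  "blocks f s 0 ts \<union> blocks (\<not> f) s 0 ts = {s..<s + int (sum_list ts)} \<and> blocks f s 0 ts \<inter> blocks (\<not> f) s 0 ts = {}"
proof (induction ts arbitrary: f s)
  case (Cons t ts)
  have split: "{s..<s + int (sum_list (t # ts))} = {s..<s + int t} \<union> {s + int t..<s + int t + int (sum_list ts)}"
    by auto
  have first: "{j. s \<le> j \<and> j + 0 < s + int t} = {s..<s + int t}" by auto
  have "blocks g (s + int t) 0 ts \<inter> {s..<s + int t} = {}" for g
    using blocks_subset[of g "s + int t" ts] by fastforce
  then show ?case
    unfolding split blocks.simps first using Cons.IH[of f "s + int t"] by (cases f) (simp_all, blast+)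
qed auto

lemmas blocks_complement = conjunct1[OF blocks_partition] conjunct2[OF blocks_partition]

lemma card_blocks_both: "card (blocks True s 0 ts) = osum ts \<and> card (blocks False s 0 ts) = esum ts"
proof (induction ts arbitrary: s)
  case (Cons t ts)
  have "{s..<s + int t} \<inter> blocks False (s + int t) 0 ts = {}"
    using blocks_subset[of False "s + int t" ts] by fastforce
  moreover have "{j. s \<le> j \<and> j + 0 < s + int t} = {s..<s + int t}" by auto
  ultimately show ?case
    using Cons.IH[of "s + int t"] by (simp add: osum_Cons esum_Cons card_Un_disjoint)
qed auto

lemmas card_blocks = conjunct1[OF card_blocks_both] conjunct2[OF card_blocks_both]

lemma rblocks_subset: "rblocks g L 0 bs \<subseteq> {L - int (sum_list bs)..<L}"
  using blocks_subset[of _ "L - int (sum_list bs)" "rev bs"] by (simp add: rblocks_eq_blocks_rev)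

lemma finite_rblocks [simp]: "finite (rblocks g L 0 bs)"
  by (simp add: rblocks_eq_blocks_rev)

lemma rblocks_complement:
  "rblocks g L 0 bs \<union> rblocks (\<not> g) L 0 bs = {L - int (sum_list bs)..<L}"
  "rblocks g L 0 bs \<inter> rblocks (\<not> g) L 0 bs = {}"
proof -
  have "(odd (length bs) \<longleftrightarrow> \<not> g) \<longleftrightarrow> \<not> (odd (length bs) \<longleftrightarrow> g)" by blast
  then show "rblocks g L 0 bs \<union> rblocks (\<not> g) L 0 bs = {L - int (sum_list bs)..<L}"
    "rblocks g L 0 bs \<inter> rblocks (\<not> g) L 0 bs = {}"
    using blocks_complement[of "odd (length bs) \<longleftrightarrow> g" "L - int (sum_list bs)" "rev bs"]
    unfolding rblocks_eq_blocks_rev by simp_all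
qed

lemma card_rblocks_both: "card (rblocks True L 0 bs) = osum bs \<and> card (rblocks False L 0 bs) = esum bs"
proof (induction bs arbitrary: L)
  case (Cons b bs)
  have "{L - int b..<L} \<inter> rblocks False (L - int b) 0 bs = {}"
    using rblocks_subset[of False "L - int b" bs] by fastforce
  moreover have "{j. L - int b \<le> j \<and> j + 0 < L} = {L - int b..<L}" by auto
  ultimately show ?case
    using Cons.IH[of "L - int b"] by (simp add: osum_Cons esum_Cons card_Un_disjoint)
qed auto

lemmas card_rblocks = conjunct1[OF card_rblocks_both] conjunct2[OF card_rblocks_both]

lemma blocks_shift: "j \<in> blocks f (s + 1) k ts \<longleftrightarrow> j - 1 \<in> blocks f s k ts"
  unfolding blocks_iff by (simp add: algebra_simps)

text \<open>In slanted coordinates an up-pointing triangle loses one index per line, at its right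
  end; so each position of a section rests on two adjacent positions of the section below.\<close>

lemma blocks_level:
  assumes "j \<in> blocks f s (int (Suc k)) ts"
  shows "j \<in> blocks f s (int k) ts" "j + 1 \<in> blocks f s (int k) ts"
  using assms unfolding blocks_iff by force+

lemma rblocks_level:
  assumes "j \<in> rblocks g L (int (Suc k)) bs"
  shows "j \<in> rblocks g L (int k) bs" "j + 1 \<in> rblocks g L (int k) bs"
  using assms unfolding rblocks_iff by force+

lemma psum_mono: "i \<le> k \<Longrightarrow> psum ts i \<le> psum ts k"
  unfolding psum_def by (rule sum_mono2) auto

lemma blocks_False_ge: "j \<in> blocks False s k ts \<Longrightarrow> s + int (seq ts 1) \<le> j"
proof -
  assume "j \<in> blocks False s k ts"
  then obtain i where i: "odd i" "s + int (psum ts i) \<le> j" unfolding blocks_iff by auto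
  then have "psum ts 1 \<le> psum ts i" by (intro psum_mono) (auto elim: oddE)
  then show ?thesis using i(2) by (simp add: psum_Suc)
qed

lemma dents_iff:
  "Up j (int k) \<in> dents ts \<longleftrightarrow> j \<in> blocks False 0 (int k) ts"
  "0 < k \<Longrightarrow> Down j (int k) \<in> dents ts \<longleftrightarrow> j \<in> blocks False 0 (int k) ts"
proof -
  have "(\<exists>i\<in>{1..length ts div 2}. int (psum ts (2 * i - 1)) \<le> j \<and> j + int k < int (psum ts (2 * i))) \<longleftrightarrow>
    (\<exists>i<length ts. odd i \<and> int (psum ts i) \<le> j \<and> j + int k < int (psum ts (Suc i)))" (is "?l \<longleftrightarrow> ?r")
  proof
    assume ?l
    then obtain i where i: "i \<in> {1..length ts div 2}" "int (psum ts (2 * i - 1)) \<le> j" "j + int k < int (psum ts (2 * i))" by blast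
    then have "2 * i - 1 < length ts" "odd (2 * i - 1)" "Suc (2 * i - 1) = 2 * i" by auto
    then show ?r using i(2,3) by (intro exI[of _ "2 * i - 1"]) simp
  next
    assume ?r
    then obtain i where i: "i < length ts" "odd i" "int (psum ts i) \<le> j" "j + int k < int (psum ts (Suc i))" by blast
    then obtain l where l: "i = 2 * l + 1" by (auto elim: oddE)
    then have "Suc l \<in> {1..length ts div 2}" using i(1) by simp
    then show ?l using i(3,4) l by (intro bexI[of _ "Suc l"]) auto
  qed
  then show "Up j (int k) \<in> dents ts \<longleftrightarrow> j \<in> blocks False 0 (int k) ts"
    "0 < k \<Longrightarrow> Down j (int k) \<in> dents ts \<longleftrightarrow> j \<in> blocks False 0 (int k) ts"
    by (simp_all add: dents_def up_triangle_triangles blocks_iff)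
qed

lemma stack_minus:
  assumes "\<And>j i. Up j (int i) \<in> S \<longleftrightarrow> j \<in> D i" "\<And>j i. 0 < i \<Longrightarrow> Down j (int i) \<in> S \<longleftrightarrow> j \<in> D i"
  shows "stack G 0 h - S = stack (\<lambda>i. G i - D i) 0 h"
proof (rule Set.set_eqI)
  fix t
  show "t \<in> stack G 0 h - S \<longleftrightarrow> t \<in> stack (\<lambda>i. G i - D i) 0 h"
  proof (cases t)
    case (Up j k)
    then show ?thesis using assms(1)[of j "nat k"] by (cases "0 \<le> k") (auto simp: Up_in_stack)
  next
    case (Down j k)
    then show ?thesis using assms(2)[of "nat k" j] by (cases "0 < k") (auto simp: Down_in_stack)
  qed
qed

text \<open>A positive first entry keeps all dents away from the zigzag, as \<open>M_stack_K\<close>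
  demands for its weighted corners.\<close>

lemma K'_eq_KE:
  assumes "seq ts 1 \<ge> 1"
  shows "K' ts = KE 0 (esum ts) (blocks False 0 0 ts)"
proof (cases "esum ts = 0")
  case True
  then have "blocks False 0 0 ts = {}" using card_blocks(2)[of 0 ts] by simp
  then show ?thesis using True by (simp add: K'_def)
next
  case False
  let ?D = "\<lambda>k. blocks False 0 (int k) ts"
  have "K'_region ts = stack (\<lambda>i. {loK i..<int (osum ts + esum ts) - int i} - ?D i) 0 (2 * esum ts - 1)"
    unfolding K'_region_def trapezoid_K_eq_stack by (rule stack_minus) (simp_all add: dents_iff)
  also have "M (zigzag_weight (\<alpha>_zigzag (2 * int (esum ts) - 1))) \<dots> = KE 0 (esum ts) (blocks False 0 0 ts)"
  proof -
    have "loK (Suc k) \<notin> ?D (Suc k)" for k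
      using blocks_False_ge[of "loK (Suc k)" 0 "int (Suc k)" ts] assms by (auto simp: loK_def)
    moreover have "blocks False 0 0 ts \<subseteq> {0..<int (osum ts + esum ts)}"
      using blocks_subset[of False 0 ts] by (simp add: osum_plus_esum)
    ultimately show ?thesis
      using M_stack_K[of "zigzag_weight (\<alpha>_zigzag (2 * int (esum ts) - 1))" "esum ts" ?D "blocks False 0 0 ts" "int (osum ts + esum ts)"]
        zigzag_weight_vert_pos blocks_level card_blocks(2)[of 0 ts] by simp
  qed
  finally show ?thesis using False by (simp add: K'_def)
qed

lemma Q_eq_QE: "real (Q ts) = QE 0 (esum ts) (blocks False 0 0 ts)"
proof -
  let ?D = "\<lambda>k. blocks False 0 (int k) ts"
  have "Q_region ts = stack (\<lambda>i. {loQ 0 i..<int (osum ts + esum ts) - int i} - ?D i) 0 (2 * esum ts)"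
    unfolding Q_region_def trapezoid_Q_eq_stack by (rule stack_minus) (simp_all add: dents_iff)
  also have "M (\<lambda>_. 1) \<dots> = QE 0 (esum ts) (blocks False 0 0 ts)"
  proof -
    have "blocks False 0 0 ts \<subseteq> {0..<int (osum ts + esum ts)}"
      using blocks_subset[of False 0 ts] by (simp add: osum_plus_esum)
    then show ?thesis
      using M_stack_Q[of "\<lambda>_. 1" ?D 0 "blocks False 0 0 ts" "int (osum ts + esum ts)" "esum ts"]
        blocks_level card_blocks(2)[of 0 ts] by simp
  qed
  finally show ?thesis by (simp add: Q_def M_one)
qed

section \<open>The dents of the two quartered hexagons\<close>

lemma floor_index_eq: "floor_index n = 2 * ((n + 1) div 2)"
proof -
  have "\<lfloor>(real n + 1) / 2\<rfloor> = int ((n + 1) div 2)"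
    using floor_divide_of_nat_eq[of "n + 1" 2] by (simp add: add.commute)
  then show ?thesis by (simp add: floor_index_def)
qed

lemma ceiling_index_eq: "ceiling_index n = 2 * (n div 2)"
proof -
  have "\<lceil>(real n - 1) / 2\<rceil> = int (n div 2)"
    by (cases "even n") (auto simp: ceiling_eq_iff elim!: evenE oddE)
  then show ?thesis by (simp add: ceiling_index_def)
qed

lemma map_seq_take: "k \<le> length ts \<Longrightarrow> map (seq ts) [1..<k + 1] = take k ts"
  by (rule nth_equalityI) (auto simp: seq_def simp del: upt_Suc)

lemma sum_take_seq: "length ts \<le> Suc k \<Longrightarrow> sum_list (take k ts) + seq ts (Suc k) = sum_list ts"
  using psum_Suc[of ts k] by (simp add: psum_eq_sum_take)

lemma blocks_short: "length ts \<le> 1 \<Longrightarrow> blocks False s k ts = {}"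
  by (cases ts) auto

lemma rblocks_short: "length ts \<le> 1 \<Longrightarrow> rblocks False s k ts = {}"
  by (cases ts) auto

text \<open>After an even number of entries a single further entry is a gap and contributes no
  block. This absorbs the rounding of lengths to even numbers in both sequences.\<close>

lemma blocks_take:
  assumes "even k" "k \<le> length ts" "length ts \<le> Suc k"
  shows "blocks False s l (take k ts) = blocks False s l ts"
  using blocks_append[of False s l "take k ts" "drop k ts"] blocks_short[of "drop k ts"] assms by simp

lemma rblocks_take:
  assumes "even k \<longleftrightarrow> \<not> g" "k \<le> length ts" "length ts \<le> Suc k"
  shows "rblocks g s l (take k ts) = rblocks g s l ts"
  using rblocks_append[of g s l "take k ts" "drop k ts"] rblocks_short[of "drop k ts"] assms by auto

text \<open>The middle entry merges the free segment with the last entries of \<open>as\<close> and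
  \<open>bs\<close> when these do not carry up-pointing triangles. What remains are exactly the
  up-pointing triangles on the line of the region.\<close>

lemma blocks_t_plus:
  assumes "length as \<ge> 1"
  shows "blocks False 0 0 (t_plus x y as bs) = blocks False 0 0 as \<union> rblocks True (int (x + y + sum_list as + sum_list bs)) 0 bs"
proof -
  define bs' where "bs' = nonempty_seq bs"
  define \<mu> where "\<mu> = 2 * (length as div 2)"
  define k where "k = 2 * ((length bs' + 1) div 2) - 1"
  have bs': "1 \<le> length bs'" "sum_list bs' = sum_list bs"
    by (cases bs; simp add: bs'_def nonempty_seq_def)+
  have k: "floor_index (length bs') = Suc k" "odd k" "k \<le> length bs'" "length bs' \<le> Suc k"
    using bs'(1) unfolding floor_index_eq k_def by presburger+
  have \<mu>: "even \<mu>" "\<mu> \<le> length as" "length as \<le> Suc \<mu>" by (auto simp: \<mu>_def)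
  have "t_plus x y as bs = take \<mu> as @ [seq as (Suc \<mu>) + x + y + seq bs' (Suc k)] @ rev (take k bs')"
    unfolding t_plus_def Let_def bs'_def[symmetric] k(1) ceiling_index_eq \<mu>_def[symmetric]
    using map_seq_take[OF \<mu>(2)] map_seq_take[OF k(3)] by (simp add: rev_map[symmetric])
  then have "blocks False 0 0 (t_plus x y as bs) = blocks False 0 0 (take \<mu> as) \<union>
      blocks True (int (sum_list (take \<mu> as) + (seq as (Suc \<mu>) + x + y + seq bs' (Suc k)))) 0 (rev (take k bs'))"
    using \<mu> by (simp add: blocks_append add.assoc)
  also have "blocks False 0 0 (take \<mu> as) = blocks False 0 0 as"
    by (rule blocks_take) (use \<mu> in auto)
  also have "blocks True (int (sum_list (take \<mu> as) + (seq as (Suc \<mu>) + x + y + seq bs' (Suc k)))) 0 (rev (take k bs')) =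
      rblocks True (int (x + y + sum_list as + sum_list bs)) 0 (take k bs')"
  proof -
    have E: "int (sum_list (take \<mu> as) + (seq as (Suc \<mu>) + x + y + seq bs' (Suc k))) =
        int (x + y + sum_list as + sum_list bs) - int (sum_list (take k bs'))"
      using sum_take_seq[OF \<mu>(3)] sum_take_seq[OF k(4)] bs'(2) by simp
    show ?thesis
      unfolding E rblocks_eq_blocks_rev using k by simp
  qed
  also have "\<dots> = rblocks True (int (x + y + sum_list as + sum_list bs)) 0 bs'"
    by (rule rblocks_take) (use k in auto)
  also have "\<dots> = rblocks True (int (x + y + sum_list as + sum_list bs)) 0 bs"
    by (auto simp: bs'_def nonempty_seq_def)
  finally show ?thesis .
qed

text \<open>The leading entries \<open>0, a - 1\<close> stand for the half triangle as far as it
  lies east of the zigzag. The lower zigzag starts one unit further east than that of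
  \<open>Q\<close>, so all positions are those of the lower part minus 1.\<close>

lemma blocks_t_minus:
  "blocks False 0 0 (t_minus x y z (a # as) bs) = {0..<int (a - 1)} \<union> blocks False (int (a - 1)) 0 as \<union>
    rblocks False (int (a - 1 + x + y + sum_list as + sum_list bs)) 0 bs \<union>
    {int (a - 1 + x + y + sum_list as + sum_list bs)..<int (a - 1 + x + y + sum_list as + sum_list bs + z)}"
proof -
  define bs' where "bs' = nonempty_seq bs"
  define \<mu> where "\<mu> = 2 * (length as div 2)"
  define k where "k = 2 * (length bs' div 2)"
  have bs': "1 \<le> length bs'" "sum_list bs' = sum_list bs"
    by (cases bs; simp add: bs'_def nonempty_seq_def)+
  have k: "even k" "k \<le> length bs'" "length bs' \<le> Suc k" by (auto simp: k_def)
  have \<mu>: "even \<mu>" "\<mu> \<le> length as" "length as \<le> Suc \<mu>" by (auto simp: \<mu>_def)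
  have fl: "floor_index (length (a # as)) = Suc (Suc \<mu>)"
    by (simp add: floor_index_eq \<mu>_def)
  have "map (seq (a # as)) [2..<Suc (Suc \<mu>)] = take \<mu> as"
    by (rule nth_equalityI) (use \<mu> in \<open>auto simp: seq_def simp del: upt_Suc\<close>)
  moreover have "seq (a # as) (Suc (Suc \<mu>)) = seq as (Suc \<mu>)" by (rule seq_Cons)
  moreover have "seq (a # as) 1 = a" by (simp add: seq_def)
  ultimately have "t_minus x y z (a # as) bs = [0, a - 1] @ take \<mu> as @ [seq as (Suc \<mu>) + x + y + seq bs' (Suc k)] @ rev (take k bs') @ [z]"
    unfolding t_minus_def Let_def bs'_def[symmetric] fl ceiling_index_eq k_def[symmetric]
    using map_seq_take[OF k(2)] by (simp add: rev_map[symmetric])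
  then have "blocks False 0 0 (t_minus x y z (a # as) bs) = {j. 0 \<le> j \<and> j < int (a - 1)} \<union> blocks False (int (a - 1)) 0 (take \<mu> as) \<union>
      blocks True (int (a - 1 + sum_list (take \<mu> as) + (seq as (Suc \<mu>) + x + y + seq bs' (Suc k)))) 0 (rev (take k bs')) \<union>
      blocks True (int (a - 1 + sum_list (take \<mu> as) + (seq as (Suc \<mu>) + x + y + seq bs' (Suc k)) + sum_list (take k bs'))) 0 [z]"
    using \<mu> k by (simp add: blocks_append add.assoc Un_assoc)
  also have "{j. 0 \<le> j \<and> j < int (a - 1)} = {0..<int (a - 1)}" by auto
  also have "blocks False (int (a - 1)) 0 (take \<mu> as) = blocks False (int (a - 1)) 0 as"
    by (rule blocks_take) (use \<mu> in auto)
  also have "a - 1 + sum_list (take \<mu> as) + (seq as (Suc \<mu>) + x + y + seq bs' (Suc k)) + sum_list (take k bs') =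
      a - 1 + x + y + sum_list as + sum_list bs"
    using sum_take_seq[OF \<mu>(3)] sum_take_seq[OF k(3)] bs'(2) by simp
  also have "blocks True (int (a - 1 + sum_list (take \<mu> as) + (seq as (Suc \<mu>) + x + y + seq bs' (Suc k)))) 0 (rev (take k bs')) =
      rblocks False (int (a - 1 + x + y + sum_list as + sum_list bs)) 0 (take k bs')"
  proof -
    have E: "int (a - 1 + sum_list (take \<mu> as) + (seq as (Suc \<mu>) + x + y + seq bs' (Suc k))) =
        int (a - 1 + x + y + sum_list as + sum_list bs) - int (sum_list (take k bs'))"
      using sum_take_seq[OF \<mu>(3)] sum_take_seq[OF k(3)] bs'(2) by simp
    show ?thesis
      unfolding E rblocks_eq_blocks_rev using k by simp
  qed
  also have "\<dots> = rblocks False (int (a - 1 + x + y + sum_list as + sum_list bs)) 0 bs'"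
    by (rule rblocks_take) (use k in auto)
  also have "\<dots> = rblocks False (int (a - 1 + x + y + sum_list as + sum_list bs)) 0 bs"
    by (simp add: bs'_def nonempty_seq_def)
  also have "blocks True (int (a - 1 + x + y + sum_list as + sum_list bs)) 0 [z] =
      {int (a - 1 + x + y + sum_list as + sum_list bs)..<int (a - 1 + x + y + sum_list as + sum_list bs + z)}"
    by auto
  finally show ?thesis .
qed

lemma QE_shift: "QE (lo + 1) n ((\<lambda>j. j + 1) ` X) = QE lo n X"
proof -
  have inj: "inj_on (\<lambda>j :: int. j + 1) A" for A by (simp add: inj_on_def)
  have "{y \<in> (\<lambda>j. j + 1) ` X. y < x + 1} = (\<lambda>j. j + 1) ` {y \<in> X. y < x}" for x :: int
    by auto
  then have "vand t ((\<lambda>j. j + 1) ` X) = vand (\<lambda>j. t (j + 1)) X" for t :: "int \<Rightarrow> real"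
    unfolding vand_def by (simp add: prod.reindex[OF inj])
  then show ?thesis
    by (simp add: QE_def prod.reindex[OF inj] algebra_simps)
qed

section \<open>The region split along the line \<open>k = 0\<close>\<close>

text \<open>Triangles above the line are addressed by the index and height of their horizontal side,
  those below as \<open>reflect t\<close>. Both kinds of unit triangle then obey the same inequality
  for each dent.\<close>

definition triangle_at :: "utriangle \<Rightarrow> int \<Rightarrow> nat \<Rightarrow> bool" where
  "triangle_at t j l \<longleftrightarrow> t = Up j (int l) \<or> 0 < l \<and> t = Down j (int l)"

lemma triangle_at_dents:
  assumes "triangle_at t j l"
  shows "t \<in> triangles_in (up_triangle p q) \<longleftrightarrow> int p \<le> j \<and> j + int l < int q"
    "t \<notin> triangles_in (down_triangle p q)"
    "reflect t \<notin> triangles_in (up_triangle p q)"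
    "reflect t \<in> triangles_in (down_triangle p q) \<longleftrightarrow> int p \<le> j \<and> j + int l < int q"
    "t \<notin> triangles_in {(u, k). k \<le> 0 \<and> u \<le> real a + of_int k / 2}"
    "reflect t \<in> triangles_in {(u, k). k \<le> 0 \<and> u \<le> real a + of_int k / 2} \<longleftrightarrow> j + int l < int a"
  using assms unfolding triangle_at_def down_triangle_triangles half_triangle_triangles
  by (elim disjE conjE; simp add: up_triangle_triangles)+

lemma left_dents_upper:
  assumes "triangle_at t j l"
  shows "t \<in> NR4_left_dents as \<longleftrightarrow> j \<in> blocks False 0 (int l) as"
proof -
  have "t \<in> NR4_left_dents as \<longleftrightarrow> (\<exists>i\<in>{2..length as}. even i \<and> int (psum as (i - 1)) \<le> j \<and> j + int l < int (psum as i))"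
    unfolding NR4_left_dents_def UN_iff
    by (rule bex_cong[OF refl]) (simp add: triangle_at_dents[OF assms])
  also have "\<dots> \<longleftrightarrow> j \<in> blocks False 0 (int l) as"
  proof
    assume "\<exists>i\<in>{2..length as}. even i \<and> int (psum as (i - 1)) \<le> j \<and> j + int l < int (psum as i)"
    then obtain i where i: "i \<in> {2..length as}" "even i" "int (psum as (i - 1)) \<le> j" "j + int l < int (psum as i)" by blast
    then have "i - 1 < length as" "odd (i - 1)" "Suc (i - 1) = i" by auto
    then show "j \<in> blocks False 0 (int l) as" unfolding blocks_iff using i by (intro exI[of _ "i - 1"]) simp
  next
    assume "j \<in> blocks False 0 (int l) as"
    then obtain i where i: "i < length as" "odd i" "int (psum as i) \<le> j" "j + int l < int (psum as (Suc i))"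
      unfolding blocks_iff by auto
    moreover have "i \<noteq> 0" using i(2) by (cases i) auto
    ultimately show "\<exists>i\<in>{2..length as}. even i \<and> int (psum as (i - 1)) \<le> j \<and> j + int l < int (psum as i)"
      by (intro bexI[of _ "Suc i"]) auto
  qed
  finally show ?thesis .
qed

text \<open>Splitting off the first entry, which belongs to the half triangle, turns the dents with
  odd index into those with even index of the tail, starting at \<open>a\<close>.\<close>

lemma left_dents_lower:
  assumes "triangle_at t j l"
  shows "reflect t \<in> NR4_left_dents (a # as) \<longleftrightarrow> j \<in> blocks False (int a) (int l) as"
proof -
  have "reflect t \<in> NR4_left_dents (a # as) \<longleftrightarrow>
      (\<exists>i\<in>{2..length (a # as)}. odd i \<and> int (psum (a # as) (i - 1)) \<le> j \<and> j + int l < int (psum (a # as) i))"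
    unfolding NR4_left_dents_def UN_iff
    by (rule bex_cong[OF refl]) (simp add: triangle_at_dents[OF assms])
  also have "\<dots> \<longleftrightarrow> j \<in> blocks False (int a) (int l) as"
  proof
    assume "\<exists>i\<in>{2..length (a # as)}. odd i \<and> int (psum (a # as) (i - 1)) \<le> j \<and> j + int l < int (psum (a # as) i)"
    then obtain i where i: "i \<in> {2..length (a # as)}" "odd i" "int (psum (a # as) (i - 1)) \<le> j" "j + int l < int (psum (a # as) i)" by blast
    then obtain i' where i': "i = Suc (Suc i')" by (metis One_nat_def Suc_le_D atLeastAtMost_iff numeral_2_eq_2 Suc_le_mono)
    then show "j \<in> blocks False (int a) (int l) as"
      unfolding blocks_iff using i by (intro exI[of _ i']) auto
  next
    assume "j \<in> blocks False (int a) (int l) as"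
    then obtain i where "i < length as" "odd i" "int a + int (psum as i) \<le> j" "j + int l < int a + int (psum as (Suc i))"
      unfolding blocks_iff by auto
    then show "\<exists>i\<in>{2..length (a # as)}. odd i \<and> int (psum (a # as) (i - 1)) \<le> j \<and> j + int l < int (psum (a # as) i)"
      by (intro bexI[of _ "Suc (Suc i)"]) auto
  qed
  finally show ?thesis .
qed

lemma psum_le: "psum ts k \<le> sum_list ts"
  unfolding psum_eq_sum_take by (metis append_take_drop_id le_add1 sum_list_append)

lemma right_dents:
  assumes t: "triangle_at t j l" and L: "sum_list bs \<le> L"
  shows "t \<in> NR4_right_dents L bs \<longleftrightarrow> j \<in> rblocks True (int L) (int l) bs"
    and "reflect t \<in> NR4_right_dents L bs \<longleftrightarrow> j \<in> rblocks False (int L) (int l) bs"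
proof -
  have diff: "int (L - psum bs i) = int L - int (psum bs i)" for i
    using psum_le[of bs i] L by simp
  have *: "(\<exists>i\<in>{1..length bs}. (odd i \<longleftrightarrow> g) \<and> int (L - psum bs i) \<le> j \<and> j + int l < int (L - psum bs (i - 1))) \<longleftrightarrow>
    j \<in> rblocks g (int L) (int l) bs" for g
  proof
    assume "\<exists>i\<in>{1..length bs}. (odd i \<longleftrightarrow> g) \<and> int (L - psum bs i) \<le> j \<and> j + int l < int (L - psum bs (i - 1))"
    then obtain i where i: "i \<in> {1..length bs}" "odd i \<longleftrightarrow> g" "int (L - psum bs i) \<le> j" "j + int l < int (L - psum bs (i - 1))" by blast
    then obtain i' where "i = Suc i'" by (cases i) auto
    then show "j \<in> rblocks g (int L) (int l) bs"
      unfolding rblocks_iff using i by (intro exI[of _ i']) (auto simp: diff)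
  next
    assume "j \<in> rblocks g (int L) (int l) bs"
    then obtain i where "i < length bs" "even i \<longleftrightarrow> g" "int L - int (psum bs (Suc i)) \<le> j" "j + int l < int L - int (psum bs i)"
      unfolding rblocks_iff by auto
    then show "\<exists>i\<in>{1..length bs}. (odd i \<longleftrightarrow> g) \<and> int (L - psum bs i) \<le> j \<and> j + int l < int (L - psum bs (i - 1))"
      by (intro bexI[of _ "Suc i"]) (auto simp: diff)
  qed
  have "t \<in> NR4_right_dents L bs \<longleftrightarrow> (\<exists>i\<in>{1..length bs}. (odd i \<longleftrightarrow> True) \<and> int (L - psum bs i) \<le> j \<and> j + int l < int (L - psum bs (i - 1)))"
    unfolding NR4_right_dents_def UN_iff
    by (rule bex_cong[OF refl]) (simp add: triangle_at_dents[OF t])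
  then show "t \<in> NR4_right_dents L bs \<longleftrightarrow> j \<in> rblocks True (int L) (int l) bs"
    unfolding * .
  have "reflect t \<in> NR4_right_dents L bs \<longleftrightarrow> (\<exists>i\<in>{1..length bs}. (odd i \<longleftrightarrow> False) \<and> int (L - psum bs i) \<le> j \<and> j + int l < int (L - psum bs (i - 1)))"
    unfolding NR4_right_dents_def UN_iff
    by (rule bex_cong[OF refl]) (simp add: triangle_at_dents[OF t])
  then show "reflect t \<in> NR4_right_dents L bs \<longleftrightarrow> j \<in> rblocks False (int L) (int l) bs"
    unfolding * .
qed

lemma stack_minus_triangle_at:
  assumes "\<And>t j i. triangle_at t j i \<Longrightarrow> t \<in> S \<longleftrightarrow> j \<in> D i"
  shows "stack G 0 h - S = stack (\<lambda>i. G i - D i) 0 h"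
  by (rule stack_minus) (use assms in \<open>auto simp: triangle_at_def\<close>)

lemma vand_pos:
  assumes "\<And>x y. x \<in> X \<Longrightarrow> y \<in> X \<Longrightarrow> y < x \<Longrightarrow> t y < t x"
  shows "vand t X > 0"
  unfolding vand_def by (intro prod_pos) (use assms in auto)

text \<open>Squaring is strictly increasing on nonnegative positions. Positivity guarantees a tiling
  from which the number of crossings is read off, and nonzero denominators at the end.\<close>

lemma KE_pos:
  assumes "X \<subseteq> {0..}"
  shows "KE 0 n X > 0"
proof -
  have "vand (\<lambda>x. (of_int (x - 0))\<^sup>2) X > 0"
    by (rule vand_pos) (use assms in \<open>auto intro!: power_strict_mono\<close>)
  then show ?thesis unfolding KE_def by (intro divide_pos_pos prod_pos) auto
qed

lemma QE_pos:
  assumes "X \<subseteq> {1..}"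
  shows "QE 1 n X > 0"
proof -
  have X: "1 \<le> x" if "x \<in> X" for x using assms that by auto
  have "vand (\<lambda>x. (of_int (x - 1 + 1))\<^sup>2) X > 0"
  proof (rule vand_pos)
    fix x y assume "x \<in> X" "y \<in> X" "y < x"
    then show "(real_of_int (y - 1 + 1))\<^sup>2 < (real_of_int (x - 1 + 1))\<^sup>2"
      using X[of y] by (intro power_strict_mono) auto
  qed
  moreover have "(\<Prod>x\<in>X. real_of_int (x - 1 + 1)) > 0"
    by (rule prod_pos) (use X in force)
  moreover have "(\<Prod>j<n. fact (2 * j + 1) :: real) > 0" by (rule prod_pos) simp
  ultimately show ?thesis unfolding QE_def by (intro divide_pos_pos mult_pos_pos)
qed

text \<open>\<open>U0\<close> and \<open>D0\<close> are the positions removed on the upper and the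
  lower side; \<open>D0\<close> includes the half triangle and the triangle beyond \<open>L\<close>
  that completes the lower part. A crossing lozenge removes its position on both sides, hence
  \<open>V\<close> in both factors. Only sets of size \<open>y\<close> occur because the upper part
  is balanced for no other number of crossings.\<close>

lemma M_NR4_eq_sum:
  fixes x y z a :: nat and as bs :: "nat list"
  assumes a: "a \<ge> 1"
  defines "L \<equiv> x + y + (a + sum_list as) + sum_list bs"
  defines "U0 \<equiv> blocks False 0 0 (a # as) \<union> rblocks True (int L) 0 bs"
  defines "D0 \<equiv> {1..<int a} \<union> blocks False (int a) 0 as \<union> rblocks False (int L) 0 bs \<union> {int L..<int (L + z)}"
  defines "n \<equiv> y + esum (a # as) + osum bs"
  defines "n' \<equiv> y + (a - 1) + esum as + esum bs + z"
  shows "M_NR4 x y z (a # as) bs =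
    (\<Sum>V | V \<subseteq> {int (a + sum_list as)..<int (a + sum_list as + (x + y))} \<and> card V = y.
      KE 0 n (U0 \<union> V) * QE 1 n' (D0 \<union> V))"
    and "U0 \<union> D0 = {1..<int (a + sum_list as)} \<union> {int (a + sum_list as + (x + y))..<int (L + z)}"
    and "U0 \<inter> D0 = {}"
    and "card U0 = esum (a # as) + osum bs" and "card D0 = (a - 1) + esum as + esum bs + z"
proof -
  define F where "F = {int (a + sum_list as)..<int (a + sum_list as + (x + y))}"
  define DU where "DU = (\<lambda>k. blocks False 0 (int k) (a # as) \<union> rblocks True (int L) (int k) bs)"
  define DL where "DL = (\<lambda>k. {j. j + int k < int a} \<union> blocks False (int a) (int k) as \<union> rblocks False (int L) (int k) bs)"
  \<comment> \<open>\<open>DL\<close> is what the definition of the region removes;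
    \<open>D'\<close> cuts the half triangle off at the zigzag and adds the triangle that completes
    the lower part to a trapezoid.\<close>
  define D' where "D' = (\<lambda>k. {j. loQ 1 k \<le> j \<and> j + int k < int a} \<union> blocks False (int a) (int k) as \<union> rblocks False (int L) (int k) bs \<union> {j. int L \<le> j \<and> j + int k < int (L + z)})"
  define w where "w = zigzag_weight (\<alpha>_zigzag (2 * int n - 1))"
  define R2 where "R2 = stack (\<lambda>i. {loK i..<int L - int i} - DU i) 0 (2 * n - 1)"
  define RL where "RL = stack (\<lambda>i. {loQ 1 i..<int (L + z) - int i} - D' i) 0 (2 * n')"
  define S where "S = NR4_half_triangle (a # as) \<union> NR4_left_dents (a # as) \<union> NR4_right_dents L bs"
  have LL: "NR4_L x y (a # as) bs = L" by (simp add: NR4_L_def L_def)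
  have A: "NR4_A y (a # as) bs = 2 * int n - 1" by (simp add: NR4_A_def n_def)
  have B: "NR4_B y z (a # as) bs = 2 * int n'" using a by (simp add: NR4_B_def n'_def osum_Cons)
  have bsL: "sum_list bs \<le> L" by (simp add: L_def)

  have SU: "t \<in> S \<longleftrightarrow> j \<in> DU i" if t: "triangle_at t j i" for t j i
    unfolding S_def DU_def NR4_half_triangle_def Un_iff left_dents_upper[OF t] right_dents(1)[OF t bsL]
    using triangle_at_dents(5)[OF t] by blast
  have SL: "reflect t \<in> S \<longleftrightarrow> j \<in> DL i" if t: "triangle_at t j i" for t j i
    unfolding S_def DL_def NR4_half_triangle_def Un_iff left_dents_lower[OF t] right_dents(2)[OF t bsL] triangle_at_dents(6)[OF t]
    by (simp add: seq_def)
  have upper: "NR4_upper x y (a # as) bs - S = R2"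
    unfolding NR4_upper_def LL A trapezoid_K_eq_stack R2_def by (rule stack_minus_triangle_at[OF SU])
  have lower: "NR4_lower x y z (a # as) bs - S = reflect ` RL"
  proof -
    let ?G = "\<lambda>i. {loQ 1 i..<int (L + z) - int i} - {int L..}"
    have "NR4_lower x y z (a # as) bs - S = reflect ` stack ?G 0 (2 * n') - S"
      unfolding NR4_lower_def LL B lower_eq_stack ..
    also have "\<dots> = reflect ` (stack ?G 0 (2 * n') - reflect ` S)"
    proof -
      have "reflect ` reflect ` S = S" by (simp add: image_image)
      then show ?thesis by (simp add: image_set_diff[OF inj_reflect])
    qed
    also have "stack ?G 0 (2 * n') - reflect ` S = stack (\<lambda>i. ?G i - DL i) 0 (2 * n')"
      by (rule stack_minus_triangle_at) (simp add: in_reflect_image SL)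
    also have "(\<lambda>i. ?G i - DL i) = (\<lambda>i. {loQ 1 i..<int (L + z) - int i} - D' i)"
      by (rule ext) (auto simp: DL_def D'_def)
    finally show ?thesis by (simp add: RL_def)
  qed
  have NR: "NR4 x y z (a # as) bs = reflect ` RL \<union> R2"
  proof -
    have "NR4 x y z (a # as) bs = (NR4_upper x y (a # as) bs - S) \<union> (NR4_lower x y z (a # as) bs - S)"
      unfolding NR4_def LL S_def by blast
    then show ?thesis unfolding upper lower by blast
  qed

  have DU0: "DU 0 = U0" by (simp add: DU_def U0_def)
  have D'0: "D' 0 = D0"
  proof -
    have "{j. loQ 1 0 \<le> j \<and> j + int 0 < int a} = {1..<int a}" by (auto simp: loQ_def)
    moreover have "{j. int L \<le> j \<and> j + int 0 < int (L + z)} = {int L..<int (L + z)}" by auto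
    ultimately show ?thesis unfolding D'_def D0_def by simp
  qed
  have asU: "blocks False 0 0 (a # as) = blocks True (int a) 0 as" by simp
  note compl_a = blocks_complement[of False "int a" as, simplified]
  note compl_b = rblocks_complement[of False "int L" bs, simplified]
  have s1: "blocks f (int a) 0 as \<subseteq> {int a..<int (a + sum_list as)}" for f
    using blocks_subset[of f "int a" as] by simp
  have aL: "int L - int (sum_list bs) = int (a + sum_list as + (x + y))" by (simp add: L_def)
  have s2: "rblocks g (int L) 0 bs \<subseteq> {int (a + sum_list as + (x + y))..<int L}" for g
    using rblocks_subset[of g "int L" bs] unfolding aL .
  have "U0 \<union> D0 = {1..<int a} \<union> {int a..<int (a + sum_list as)} \<union> {int (a + sum_list as + (x + y))..<int L} \<union> {int L..<int (L + z)}"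
    unfolding U0_def D0_def asU using compl_a(1) compl_b(1) unfolding aL by auto
  also have "\<dots> = {1..<int (a + sum_list as)} \<union> {int (a + sum_list as + (x + y))..<int (L + z)}"
    using a by (auto simp: L_def)
  finally show union: "U0 \<union> D0 = {1..<int (a + sum_list as)} \<union> {int (a + sum_list as + (x + y))..<int (L + z)}" .
  have p1: "{1..<int a} \<inter> blocks f (int a) 0 as = {}" for f using s1[of f] by fastforce
  have p2: "{1..<int a} \<inter> rblocks g (int L) 0 bs = {}" for g using s2[of g] by fastforce
  have p3: "blocks f (int a) 0 as \<inter> rblocks g (int L) 0 bs = {}" for f g using s1[of f] s2[of g] by fastforce
  have p4: "blocks f (int a) 0 as \<inter> {int L..<int (L + z)} = {}" for f using s1[of f] by (fastforce simp: L_def)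
  have p5: "rblocks g (int L) 0 bs \<inter> {int L..<int (L + z)} = {}" for g using s2[of g] by fastforce
  have p6: "{1..<int a} \<inter> {int L..<int (L + z)} = {}" by (auto simp: L_def)
  show disj: "U0 \<inter> D0 = {}"
    unfolding U0_def D0_def asU using p1[of True] p2[of True] p3[of True False] p3[of False True] p4[of True] p5[of True]
      compl_a(2) compl_b(2) by blast
  show cU: "card U0 = esum (a # as) + osum bs"
    unfolding U0_def asU using p3[of True True] by (simp add: card_Un_disjoint card_blocks card_rblocks esum_Cons)
  show cD: "card D0 = (a - 1) + esum as + esum bs + z"
  proof -
    have "card D0 = card ({1..<int a} \<union> blocks False (int a) 0 as \<union> rblocks False (int L) 0 bs) + card {int L..<int (L + z)}"
      unfolding D0_def using p4[of False] p5[of False] p6 by (intro card_Un_disjoint) (simp, simp, blast)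
    also have "card ({1..<int a} \<union> blocks False (int a) 0 as \<union> rblocks False (int L) 0 bs) =
        card ({1..<int a} \<union> blocks False (int a) 0 as) + card (rblocks False (int L) 0 bs)"
      using p2[of False] p3[of False False] by (intro card_Un_disjoint) (simp, simp, blast)
    also have "card ({1..<int a} \<union> blocks False (int a) 0 as) = card {1..<int a} + card (blocks False (int a) 0 as)"
      using p1[of False] by (intro card_Un_disjoint) simp_all
    finally show ?thesis by (simp add: card_blocks card_rblocks)
  qed
  have fin0: "finite U0" "finite D0" by (simp_all add: U0_def D0_def)
  have U0sub: "U0 \<subseteq> {0..<int L}"
  proof -
    have "blocks True (int a) 0 as \<subseteq> {0..<int L}" using s1[of True] by (rule order_trans) (auto simp: L_def)
    moreover have "rblocks True (int L) 0 bs \<subseteq> {0..<int L}" using s2[of True] by (rule order_trans) auto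
    ultimately show ?thesis unfolding U0_def asU by blast
  qed
  have D0sub: "D0 \<subseteq> {1..<int (L + z)}"
  proof -
    have "D0 \<subseteq> {1..<int (a + sum_list as)} \<union> {int (a + sum_list as + (x + y))..<int (L + z)}" using union by blast
    also have "\<dots> \<subseteq> {1..<int (L + z)}" using a by (auto simp: L_def)
    finally show ?thesis .
  qed
  have FU: "F \<inter> U0 = {}" "F \<inter> D0 = {}" "F \<subseteq> {1..<int L}"
  proof -
    have "F \<inter> (U0 \<union> D0) = {}" unfolding union F_def by auto
    then show "F \<inter> U0 = {}" "F \<inter> D0 = {}" by blast+
    show "F \<subseteq> {1..<int L}" using a by (auto simp: F_def L_def)
  qed

  define W where "W = {j. Down j 0 \<in> reflect ` RL \<and> Up j 0 \<in> R2}"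
  \<comment> \<open>If one of the two parts is empty there are no triangles along the line on that
    side and nothing can cross.\<close>
  have W: "j \<in> W \<longleftrightarrow> 0 < n \<and> 0 < n' \<and> j \<in> F" for j
  proof -
    have "Down j 0 \<in> reflect ` RL \<longleftrightarrow> 0 < n' \<and> j \<in> {1..<int (L + z)} - D0"
      unfolding in_reflect_image RL_def using D'0 by (auto simp: Up_in_stack loQ_def)
    moreover have "Up j 0 \<in> R2 \<longleftrightarrow> 0 < n \<and> j \<in> {0..<int L} - U0"
      unfolding R2_def using DU0 by (auto simp: Up_in_stack loK_def)
    moreover have "j \<in> {1..<int (L + z)} - D0 \<and> j \<in> {0..<int L} - U0 \<longleftrightarrow> j \<in> F"
    proof
      assume *: "j \<in> {1..<int (L + z)} - D0 \<and> j \<in> {0..<int L} - U0"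
      then have "j \<notin> U0 \<union> D0" by blast
      then show "j \<in> F" unfolding union F_def using * by auto
    next
      assume "j \<in> F"
      then have "j \<in> {1..<int L}" "j \<notin> U0" "j \<notin> D0" using FU by blast+
      then show "j \<in> {1..<int (L + z)} - D0 \<and> j \<in> {0..<int L} - U0" by simp
    qed
    ultimately show ?thesis unfolding W_def by blast
  qed
  have finR2: "finite R2" unfolding R2_def by (rule finite_stack) simp
  have finRL: "finite RL" unfolding RL_def by (rule finite_stack) simp
  have R2_above: "0 \<le> k" if "Up j k \<in> R2" for j k using that by (simp add: R2_def Up_in_stack)
  have R2_above': "0 < k" if "Down j k \<in> R2" for j k using that by (simp add: R2_def Down_in_stack)
  have R1_below: "k < 0" if "Up j k \<in> reflect ` RL" for j k using that by (simp add: in_reflect_image RL_def Down_in_stack)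
  have R1_below': "k \<le> 0" if "Down j k \<in> reflect ` RL" for j k using that by (simp add: in_reflect_image RL_def Up_in_stack)
  have w1: "w {Up j k, Down j' (k + 1)} = 1" for j k j' by (simp add: w_def)

  have yn: "y \<le> n" "y \<le> n'" by (simp_all add: n_def n'_def)
  \<comment> \<open>An empty part forces \<open>y = 0\<close>, and then the empty set is the only
    candidate for \<open>V\<close>.\<close>
  have FW: "V \<subseteq> W" if "V \<subseteq> F" "card V = y" for V
  proof (cases "y = 0")
    case True
    have "finite V" using that(1) finite_subset[of V F] by (simp add: F_def)
    then show ?thesis using True that(2) by simp
  next
    case False
    then show ?thesis using yn W that(1) by auto
  qed
  have K: "M w (R2 - (\<lambda>j. Up j 0) ` V) = KE 0 n (U0 \<union> V)" if V: "V \<subseteq> F" "card V = y" for V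
  proof -
    have finV: "finite V" using V(1) finite_subset[of V F] by (simp add: F_def)
    have disjV: "U0 \<inter> V = {}" using V(1) FU(1) by blast
    have "M w (stack (\<lambda>i. {loK i..<int L - int i} - DU i) 0 (2 * n - 1) - (\<lambda>j. Up j 0) ` ((U0 \<union> V) - DU 0)) = KE 0 n (U0 \<union> V)"
    proof (rule M_stack_K)
      show "w {Up j k, Down j' (k + 1)} = 1" for j k j' by (rule w1)
      show "w (vert (int k) j) = (if even k \<and> j = loK k then 1 / 2 else 1)" if "0 < k" "k \<le> 2 * n - 1" for k j
        unfolding w_def using that by (rule zigzag_weight_vert_pos)
      show "j + 1 \<in> DU k \<and> j \<in> DU k" if j: "j \<in> DU (Suc k)" for k j
        using j blocks_level[of j False 0 k "a # as"] rblocks_level[of j True "int L" k bs] unfolding DU_def by blast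
      show "loK (Suc k) \<notin> DU (Suc k)" for k
      proof
        assume "loK (Suc k) \<in> DU (Suc k)"
        then consider "loK (Suc k) \<in> blocks False 0 (int (Suc k)) (a # as)" | "loK (Suc k) \<in> rblocks True (int L) (int (Suc k)) bs"
          unfolding DU_def by blast
        then show False
        proof cases
          case 1
          then have "int a \<le> loK (Suc k)" using blocks_False_ge[OF 1] by (simp add: seq_def)
          then show False using a by (simp add: loK_def)
        next
          case 2
          then obtain i where "int L - int (psum bs (Suc i)) \<le> loK (Suc k)" unfolding rblocks_iff by blast
          moreover have "psum bs (Suc i) \<le> sum_list bs" by (rule psum_le)
          ultimately show False using a by (simp add: loK_def L_def)
        qed
      qed
      show "DU 0 \<subseteq> U0 \<union> V" using DU0 by simp
      show "U0 \<union> V \<subseteq> {0..<int L}"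
      proof -
        have "{1..<int L} \<subseteq> {0..<int L}" by auto
        then show ?thesis using U0sub V(1) FU(3) by blast
      qed
      show "card (U0 \<union> V) = n" using card_Un_disjoint[OF fin0(1) finV disjV] cU V(2) by (simp add: n_def)
    qed
    moreover have "(U0 \<union> V) - DU 0 = V" using DU0 disjV by blast
    ultimately show ?thesis by (simp add: R2_def)
  qed
  have QV: "M w (reflect ` RL - (\<lambda>j. Down j 0) ` V) = QE 1 n' (D0 \<union> V)" if V: "V \<subseteq> F" "card V = y" for V
  proof -
    have finV: "finite V" using V(1) finite_subset[of V F] by (simp add: F_def)
    have disjV: "D0 \<inter> V = {}" using V(1) FU(2) by blast
    have "(\<lambda>j. Down j 0) ` V = reflect ` (\<lambda>j. Up j 0) ` V" by (simp add: image_image)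
    then have R: "reflect ` RL - (\<lambda>j. Down j 0) ` V = reflect ` (RL - (\<lambda>j. Up j 0) ` V)"
      by (simp add: image_set_diff[OF inj_reflect])
    \<comment> \<open>No lozenge of the lower part lies on the upper zigzag, so all weights are 1
      and the count can be taken after reflection.\<close>
    have "M w (reflect ` RL - (\<lambda>j. Down j 0) ` V) = real (card (tilings (reflect ` RL - (\<lambda>j. Down j 0) ` V)))"
    proof (rule M_one)
      fix l assume "l \<in> \<Union> (tilings (reflect ` RL - (\<lambda>j. Down j 0) ` V))"
      then obtain P where P: "P \<in> tilings (reflect ` RL - (\<lambda>j. Down j 0) ` V)" "l \<in> P" by blast
      then have "lozenge l" "l \<subseteq> reflect ` RL" using tilingsD(2,3)[OF P] by blast+
      then obtain s t where st: "l = {s, t}" "adjacent s t" by (auto elim: lozengeE)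
      then obtain j k where s: "s = Up j k" and t: "t = Down j k \<or> t = Down j (k + 1) \<or> t = Down (j - 1) (k + 1)"
        by (auto simp: adjacent_def)
      have "k < 0" using \<open>l \<subseteq> reflect ` RL\<close> st(1) s R1_below[of j k] by simp
      then have "w (vert k j) = 1" unfolding w_def by (intro zigzag_weight_vert_nonpos) simp
      then show "w l = 1" using t unfolding st(1) s vert_def by (elim disjE) (simp_all add: w1)
    qed
    also have "\<dots> = M (\<lambda>_. 1) (RL - (\<lambda>j. Up j 0) ` V)"
      unfolding R card_tilings_reflect by (rule M_one[symmetric]) simp
    also have "\<dots> = QE 1 n' (D0 \<union> V)"
    proof -
      have "M (\<lambda>_. 1) (stack (\<lambda>i. {loQ 1 i..<int (L + z) - int i} - D' i) 0 (2 * n') - (\<lambda>j. Up j 0) ` ((D0 \<union> V) - D' 0)) = QE 1 n' (D0 \<union> V)"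
      proof (rule M_stack_Q)
        show "j + 1 \<in> D' k \<and> (j \<in> D' k \<or> even k \<and> j = loQ 1 (Suc k))" if j: "j \<in> D' (Suc k)" for k j
        proof -
          have lo: "loQ 1 k \<le> loQ 1 (Suc k) + 1" "odd k \<Longrightarrow> loQ 1 k = loQ 1 (Suc k)"
            by (auto simp: loQ_def elim!: oddE)
          consider "loQ 1 (Suc k) \<le> j" "j + int (Suc k) < int a" | "j \<in> blocks False (int a) (int (Suc k)) as"
            | "j \<in> rblocks False (int L) (int (Suc k)) bs" | "int L \<le> j" "j + int (Suc k) < int (L + z)"
            using j unfolding D'_def by blast
          then show ?thesis
          proof cases
            case 1
            have 2: "loQ 1 k \<le> j \<or> even k \<and> j = loQ 1 (Suc k)" using 1(1) lo by (cases "even k") auto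
            have 3: "j + int k < int a" "j + 1 + int k < int a" "loQ 1 k \<le> j + 1" using 1 lo(1) by auto
            then have 4: "j + 1 \<in> D' k" unfolding D'_def by blast
            from 2 show ?thesis
            proof
              assume "loQ 1 k \<le> j"
              then have "j \<in> D' k" unfolding D'_def using 3(1) by blast
              then show ?thesis using 4 by blast
            qed (use 4 in blast)
          next
            case 2
            then show ?thesis using blocks_level[OF 2] unfolding D'_def by blast
          next
            case 3
            then show ?thesis using rblocks_level[OF 3] unfolding D'_def by blast
          next
            case 4
            then have "int L \<le> j + 1" "j + 1 + int k < int (L + z)" "j + int k < int (L + z)" by auto
            then show ?thesis unfolding D'_def using 4(1) by blast
          qed
        qed
        show "D' 0 \<subseteq> D0 \<union> V" using D'0 by simp
        show "D0 \<union> V \<subseteq> {1..<int (L + z)}"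
        proof -
          have "{1..<int L} \<subseteq> {1..<int (L + z)}" by auto
          then show ?thesis using D0sub V(1) FU(3) by blast
        qed
        show "card (D0 \<union> V) = n'" using card_Un_disjoint[OF fin0(2) finV disjV] cD V(2) by (simp add: n'_def)
      qed simp_all
      moreover have "(D0 \<union> V) - D' 0 = V" using D'0 disjV by blast
      ultimately show ?thesis by (simp add: RL_def)
    qed
    finally show ?thesis .
  qed
  \<comment> \<open>The triangles of \<open>R2\<close> are not counted explicitly: one tileable set
    \<open>V0\<close> of size \<open>y\<close>, which exists by positivity, already determines the
    excess of up-pointing triangles.\<close>
  have zero: "M w (R2 - (\<lambda>j. Up j 0) ` V) = 0" if V: "V \<subseteq> W" "card V \<noteq> y" for V
  proof (rule ccontr)
    assume nz: "M w (R2 - (\<lambda>j. Up j 0) ` V) \<noteq> 0"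
    have "y \<le> card F" by (simp add: F_def)
    then obtain V0 where V0: "V0 \<subseteq> F" "card V0 = y" by (rule obtain_subset_with_card_n) blast
    have "U0 \<union> V0 \<subseteq> {0..}"
    proof
      fix v assume "v \<in> U0 \<union> V0"
      then have "v \<in> {0..<int L} \<or> v \<in> {1..<int L}" using U0sub V0(1) FU(3) by blast
      then show "v \<in> {0..}" by auto
    qed
    then have "M w (R2 - (\<lambda>j. Up j 0) ` V0) > 0" unfolding K[OF V0] by (rule KE_pos)
    then have nz0: "M w (R2 - (\<lambda>j. Up j 0) ` V0) \<noteq> 0" by simp
    have balance: "card {t \<in> R2. \<exists>j k. t = Up j k} = card {t \<in> R2. \<exists>j k. t = Down j k} + card V'"
      if V': "V' \<subseteq> W" "M w (R2 - (\<lambda>j. Up j 0) ` V') \<noteq> 0" for V'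
    proof -
      have "tilings (R2 - (\<lambda>j. Up j 0) ` V') \<noteq> {}" using V'(2) by (auto simp: M_def)
      then obtain P where P: "P \<in> tilings (R2 - (\<lambda>j. Up j 0) ` V')" by blast
      have sub: "(\<lambda>j. Up j 0) ` V' \<subseteq> {t \<in> R2. \<exists>j k. t = Up j k}" using V'(1) by (auto simp: W_def)
      have fin: "finite {t \<in> R2. \<exists>j k. t = Up j k}" using finR2 by simp
      have "{t \<in> R2 - (\<lambda>j. Up j 0) ` V'. \<exists>j k. t = Up j k} = {t \<in> R2. \<exists>j k. t = Up j k} - (\<lambda>j. Up j 0) ` V'"
        "{t \<in> R2 - (\<lambda>j. Up j 0) ` V'. \<exists>j k. t = Down j k} = {t \<in> R2. \<exists>j k. t = Down j k}" by auto
      then have "card ({t \<in> R2. \<exists>j k. t = Up j k} - (\<lambda>j. Up j 0) ` V') = card {t \<in> R2. \<exists>j k. t = Down j k}"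
        using tilings_balanced[OF P] finR2 by simp
      moreover have "card ((\<lambda>j. Up j 0) ` V') = card V'" by (rule card_image) (simp add: inj_on_def)
      moreover have "card ((\<lambda>j. Up j 0) ` V') \<le> card {t \<in> R2. \<exists>j k. t = Up j k}" by (rule card_mono[OF fin sub])
      ultimately show ?thesis using card_Diff_subset[OF finite_subset[OF sub fin] sub] by simp
    qed
    show False using balance[OF V(1) nz] balance[OF FW[OF V0] nz0] V(2) V0(2) by simp
  qed

  have "M_NR4 x y z (a # as) bs = (\<Sum>V\<in>Pow W. (\<Prod>j\<in>V. w (vert 0 j)) * M w (reflect ` RL - (\<lambda>j. Down j 0) ` V) * M w (R2 - (\<lambda>j. Up j 0) ` V))"
    unfolding M_NR4_def A NR w_def[symmetric] W_def
  proof (rule M_split)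
    show "reflect ` RL \<inter> R2 = {}"
    proof (rule ccontr)
      assume "reflect ` RL \<inter> R2 \<noteq> {}"
      then obtain t where t: "t \<in> reflect ` RL" "t \<in> R2" by blast
      show False
      proof (cases t)
        case (Up j k)
        then show False using t R1_below[of j k] R2_above[of j k] by simp
      next
        case (Down j k)
        then show False using t R1_below'[of j k] R2_above'[of j k] by simp
      qed
    qed
    show "\<exists>j. s = Down j 0 \<and> t = Up j 0" if st: "s \<in> reflect ` RL" "t \<in> R2" "lozenge {s, t}" for s t
    proof (cases s)
      case (Up j k)
      show ?thesis
      proof (cases t)
        case (Up j2 k2)
        then show ?thesis using st(3) \<open>s = Up j k\<close> by (simp add: lozenge_same_kind)
      next
        case (Down j2 k2)
        then show ?thesis
          using st \<open>s = Up j k\<close> R1_below[of j k] R2_above'[of j2 k2] by (auto simp: lozenge_Up_Down)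
      qed
    next
      case (Down j k)
      show ?thesis
      proof (cases t)
        case (Up j2 k2)
        then have "lozenge {Up j2 k2, Down j k}" using st(3) Down by (simp add: insert_commute)
        then show ?thesis
          using st Up Down R1_below'[of j k] R2_above[of j2 k2] by (auto simp: lozenge_Up_Down)
      next
        case (Down j2 k2)
        then show ?thesis using st(3) \<open>s = Down j k\<close> by (simp add: lozenge_same_kind)
      qed
    qed
  qed (use finRL finR2 in auto)
  also have "\<dots> = (\<Sum>V\<in>Pow W. M w (reflect ` RL - (\<lambda>j. Down j 0) ` V) * M w (R2 - (\<lambda>j. Up j 0) ` V))"
    by (simp add: w_def zigzag_weight_vert_nonpos)
  also have "\<dots> = (\<Sum>V | V \<subseteq> F \<and> card V = y. M w (reflect ` RL - (\<lambda>j. Down j 0) ` V) * M w (R2 - (\<lambda>j. Up j 0) ` V))"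
  proof (rule sum.mono_neutral_right)
    have "W \<subseteq> F" using W by blast
    then show "finite (Pow W)" using finite_subset[of W F] by (simp add: F_def)
    show "{V. V \<subseteq> F \<and> card V = y} \<subseteq> Pow W" using FW by blast
    show "\<forall>V\<in>Pow W - {V. V \<subseteq> F \<and> card V = y}. M w (reflect ` RL - (\<lambda>j. Down j 0) ` V) * M w (R2 - (\<lambda>j. Up j 0) ` V) = 0"
    proof
      fix V assume V: "V \<in> Pow W - {V. V \<subseteq> F \<and> card V = y}"
      then have "V \<subseteq> W" "card V \<noteq> y" using \<open>W \<subseteq> F\<close> by auto
      then show "M w (reflect ` RL - (\<lambda>j. Down j 0) ` V) * M w (R2 - (\<lambda>j. Up j 0) ` V) = 0" using zero by simp
    qed
  qed
  also have "\<dots> = (\<Sum>V | V \<subseteq> F \<and> card V = y. KE 0 n (U0 \<union> V) * QE 1 n' (D0 \<union> V))"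
    by (rule sum.cong[OF refl]) (simp add: K QV)
  finally show "M_NR4 x y z (a # as) bs = (\<Sum>V | V \<subseteq> {int (a + sum_list as)..<int (a + sum_list as + (x + y))} \<and> card V = y.
      KE 0 n (U0 \<union> V) * QE 1 n' (D0 \<union> V))"
    unfolding F_def .
qed

section \<open>Evaluation\<close>

lemma vand_Un:
  fixes t :: "'a::linorder \<Rightarrow> real"
  assumes fin: "finite U" "finite V" and disj: "U \<inter> V = {}"
  shows "vand t (U \<union> V) = vand t U * vand t V * (\<Prod>v\<in>V. \<Prod>u\<in>U. if u < v then t v - t u else t u - t v)"
proof -
  define g where "g = (\<lambda>x y. if y < x then t x - t y else 1)"
  have filter: "(\<Prod>y\<in>{y \<in> X. y < x}. t x - t y) = (\<Prod>y\<in>X. g x y)" if "finite X" for x X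
    unfolding g_def using prod.inter_filter[OF that, of "\<lambda>y. t x - t y" "\<lambda>y. y < x"] by simp
  have g: "vand t X = (\<Prod>x\<in>X. \<Prod>y\<in>X. g x y)" if "finite X" for X
    unfolding vand_def by (rule prod.cong[OF refl]) (rule filter[OF that])
  have split: "(\<Prod>y\<in>U \<union> V. h y) = (\<Prod>y\<in>U. h y) * (\<Prod>y\<in>V. h y)" for h :: "'a \<Rightarrow> real"
    by (rule prod.union_disjoint[OF fin disj])
  have "vand t (U \<union> V) = (\<Prod>x\<in>U. (\<Prod>y\<in>U. g x y) * (\<Prod>y\<in>V. g x y)) * (\<Prod>x\<in>V. (\<Prod>y\<in>U. g x y) * (\<Prod>y\<in>V. g x y))"
    using fin by (simp only: g finite_Un split simp_thms)
  also have "\<dots> = vand t U * vand t V * ((\<Prod>v\<in>V. \<Prod>u\<in>U. g u v) * (\<Prod>v\<in>V. \<Prod>u\<in>U. g v u))"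
    unfolding g[OF fin(1)] g[OF fin(2)] prod.distrib prod.swap[of "\<lambda>u v. g u v" V U] by (simp add: mult_ac)
  also have "(\<Prod>v\<in>V. \<Prod>u\<in>U. g u v) * (\<Prod>v\<in>V. \<Prod>u\<in>U. g v u) = (\<Prod>v\<in>V. \<Prod>u\<in>U. if u < v then t v - t u else t u - t v)"
    unfolding prod.distrib[symmetric]
  proof (intro prod.cong refl)
    fix v u assume "v \<in> V" "u \<in> U"
    then have "u \<noteq> v" using disj by blast
    then show "g u v * g v u = (if u < v then t v - t u else t u - t v)" by (auto simp: g_def)
  qed
  finally show ?thesis .
qed

definition sq :: "int \<Rightarrow> real" where "sq v = (of_int v)\<^sup>2"

text \<open>This matches the two blocks outside the free segment with the parameters of the Selberg
  sum. As \<open>v\<close> lies between the blocks, each cross factor has the orientation used in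
  \<open>selw\<close>. The left block starts at 1, where the lower zigzag starts and below which
  there is no upper dent.\<close>

lemma prod_union_selw:
  assumes "v \<in> {int A..<int (A + N)}"
  shows "of_int v * (\<Prod>u\<in>{1..<int A} \<union> {int (A + N)..<int (A + N + c)}. if u < v then sq v - sq u else sq u - sq v) = selw A N c v"
proof -
  let ?d = "\<lambda>u. if u < v then sq v - sq u else sq u - sq v"
  have "(\<Prod>u\<in>{1..<int A} \<union> {int (A + N)..<int (A + N + c)}. ?d u) = (\<Prod>u\<in>{1..<int A}. ?d u) * (\<Prod>u\<in>{int (A + N)..<int (A + N + c)}. ?d u)"
    by (rule prod.union_disjoint) auto
  also have "(\<Prod>u\<in>{1..<int A}. ?d u) = (\<Prod>p=1..<A. (of_int v)\<^sup>2 - (real p)\<^sup>2)"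
  proof -
    have "{1..<int A} = int ` {1..<A}" using image_int_atLeastLessThan[of 1 A] by simp
    then have "(\<Prod>u\<in>{1..<int A}. ?d u) = (\<Prod>p=1..<A. ?d (int p))"
      by (simp only:) (subst prod.reindex, auto simp: inj_on_def)
    also have "\<dots> = (\<Prod>p=1..<A. (of_int v)\<^sup>2 - (real p)\<^sup>2)"
      using assms by (intro prod.cong) (auto simp: sq_def)
    finally show ?thesis .
  qed
  also have "(\<Prod>u\<in>{int (A + N)..<int (A + N + c)}. ?d u) = (\<Prod>p=A + N..<A + N + c. (real p)\<^sup>2 - (of_int v)\<^sup>2)"
  proof -
    have "{int (A + N)..<int (A + N + c)} = int ` {A + N..<A + N + c}" by (rule image_int_atLeastLessThan[symmetric])
    then have "(\<Prod>u\<in>{int (A + N)..<int (A + N + c)}. ?d u) = (\<Prod>p=A + N..<A + N + c. ?d (int p))"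
      by (simp only:) (subst prod.reindex, auto simp: inj_on_def)
    also have "\<dots> = (\<Prod>p=A + N..<A + N + c. (real p)\<^sup>2 - (of_int v)\<^sup>2)"
      using assms by (intro prod.cong) (auto simp: sq_def)
    finally show ?thesis .
  qed
  finally show ?thesis by (simp add: selw_def mult.assoc)
qed

text \<open>\<open>V\<close> is present on both sides, which squares its Vandermonde product. The
  cross factors involve \<open>U \<union> D\<close> only, so how the dents are distributed between
  the sides affects nothing but the constant.\<close>

lemma KE_QE_Un:
  assumes fin: "finite U" "finite D" "finite V" and disj: "U \<inter> D = {}" "U \<inter> V = {}" "D \<inter> V = {}"
    and V: "V \<subseteq> {int A..<int (A + N)}"
    and UD: "U \<union> D = {1..<int A} \<union> {int (A + N)..<int (A + N + c)}"
  shows "KE 0 n (U \<union> V) * QE 1 n' (D \<union> V) =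
    vand sq U * ((\<Prod>x\<in>D. of_int x) * vand sq D) / ((\<Prod>j<n. fact (2 * j)) * (\<Prod>j<n'. fact (2 * j + 1))) *
    ((\<Prod>v\<in>V. selw A N c v) * (vand sq V)\<^sup>2)"
proof -
  let ?d = "\<lambda>u v. if u < v then sq v - sq u else sq u - sq v"
  have cross: "(\<Prod>v\<in>V. of_int v) * (\<Prod>v\<in>V. \<Prod>u\<in>U. ?d u v) * (\<Prod>v\<in>V. \<Prod>u\<in>D. ?d u v) = (\<Prod>v\<in>V. selw A N c v)"
    unfolding prod.distrib[symmetric]
  proof (rule prod.cong[OF refl])
    fix v assume "v \<in> V"
    have "(\<Prod>u\<in>U \<union> D. ?d u v) = (\<Prod>u\<in>U. ?d u v) * (\<Prod>u\<in>D. ?d u v)"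
      by (rule prod.union_disjoint[OF fin(1,2) disj(1)])
    then show "of_int v * (\<Prod>u\<in>U. ?d u v) * (\<Prod>u\<in>D. ?d u v) = selw A N c v"
      using prod_union_selw[of v A N c] V \<open>v \<in> V\<close> UD by (auto simp: mult.assoc)
  qed
  have "KE 0 n (U \<union> V) = vand sq (U \<union> V) / (\<Prod>j<n. fact (2 * j))"
    by (simp add: KE_def sq_def[abs_def])
  moreover have "QE 1 n' (D \<union> V) = (\<Prod>x\<in>D \<union> V. of_int x) * vand sq (D \<union> V) / (\<Prod>j<n'. fact (2 * j + 1))"
    by (simp add: QE_def sq_def[abs_def])
  moreover have "(\<Prod>x\<in>D \<union> V. real_of_int x) = (\<Prod>x\<in>D. of_int x) * (\<Prod>x\<in>V. of_int x)"
    by (rule prod.union_disjoint[OF fin(2,3) disj(3)])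
  moreover have "a * b * (p / k * ((d * e) * (a' * b' * p') / l)) = (a * (d * a') / (k * l)) * ((e * p * p') * (b * b'))"
    for a b p k d e a' b' p' l :: real
    by (simp add: field_simps)
  ultimately have "KE 0 n (U \<union> V) * QE 1 n' (D \<union> V) =
    vand sq U * ((\<Prod>x\<in>D. of_int x) * vand sq D) / ((\<Prod>j<n. fact (2 * j)) * (\<Prod>j<n'. fact (2 * j + 1))) *
    (((\<Prod>v\<in>V. of_int v) * (\<Prod>v\<in>V. \<Prod>u\<in>U. ?d u v) * (\<Prod>v\<in>V. \<Prod>u\<in>D. ?d u v)) * (vand sq V * vand sq V))"
    by (simp only: vand_Un[OF fin(1,3) disj(2)] vand_Un[OF fin(2,3) disj(3)]) (simp add: field_simps)
  then show ?thesis unfolding cross power2_eq_square .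
qed

section \<open>Rewriting the evaluated sum in terms of H, H2 and T\<close>

lemma H_add: "H (m + y) = H m * (\<Prod>k<y. fact (m + k))"
  by (induction y) (simp_all add: H_def)

lemma H_pos: "H m > 0"
  unfolding H_def by (rule prod_pos) simp

lemma H2_even: "H2 (2 * m) = (\<Prod>j<m. fact (2 * j))"
proof -
  have "H2 (2 * m) = (\<Prod>i=1..m. fact (2 * m - 2 * i))" by (simp add: H2_def)
  also have "\<dots> = (\<Prod>i<m. fact (2 * m - 2 * Suc i))"
    by (rule prod.reindex_bij_witness[where i = Suc and j = "\<lambda>i. i - 1"]) auto
  also have "\<dots> = (\<Prod>i<m. fact (2 * (m - Suc i)))" by (simp add: diff_mult_distrib2)
  also have "\<dots> = (\<Prod>j<m. fact (2 * j))" by (rule prod.nat_diff_reindex)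
  finally show ?thesis .
qed

lemma H2_odd: "H2 (2 * m + 1) = (\<Prod>j<m. fact (2 * j + 1))"
proof -
  have "H2 (2 * m + 1) = (\<Prod>i=1..m. fact (2 * m + 1 - 2 * i))" by (simp add: H2_def)
  also have "\<dots> = (\<Prod>i<m. fact (2 * m + 1 - 2 * Suc i))"
    by (rule prod.reindex_bij_witness[where i = Suc and j = "\<lambda>i. i - 1"]) auto
  also have "\<dots> = (\<Prod>i<m. fact (2 * (m - Suc i) + 1))"
    by (intro prod.cong refl arg_cong[where f = fact]) auto
  also have "\<dots> = (\<Prod>j<m. fact (2 * j + 1))" by (rule prod.nat_diff_reindex)
  finally show ?thesis .
qed

lemma pochhammer_real_fact: "pochhammer (real (Suc m)) d = fact (m + d) / fact m"
proof -
  have "fact m * pochhammer (real (Suc m)) d = fact (m + d)"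
    using pochhammer_product'[of "1 :: real" m d] by (simp add: pochhammer_fact)
  then show ?thesis by (subst eq_divide_eq) (simp add: mult.commute)
qed

text \<open>\<open>T\<close> runs through its Pochhammer lengths in decreasing order, the Selberg
  product in increasing order. The integer argument keeps the statement meaningful for
  \<open>y = 0\<close>.\<close>

lemma T_reindex:
  "T p (int (m + 2 * y) - 2) y = (\<Prod>k<y. pochhammer (real (p + (y - Suc k))) (m + 2 * k))"
proof -
  have "T p (int (m + 2 * y) - 2) y = (\<Prod>i<y. pochhammer (real (p + (y - Suc (y - Suc i)))) (m + 2 * (y - Suc i)))"
    unfolding T_def
  proof (rule prod.cong[OF refl])
    fix i assume "i \<in> {..<y}"
    then have "nat (int (m + 2 * y) - 2 - 2 * int i) = m + 2 * (y - Suc i)" "y - Suc (y - Suc i) = i" by auto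
    then show "pochhammer (real (p + i)) (nat (int (m + 2 * y) - 2 - 2 * int i)) =
        pochhammer (real (p + (y - Suc (y - Suc i)))) (m + 2 * (y - Suc i))" by simp
  qed
  also have "\<dots> = (\<Prod>k<y. pochhammer (real (p + (y - Suc k))) (m + 2 * k))"
    by (rule prod.nat_diff_reindex)
  finally show ?thesis .
qed

lemma prod_lessThan_add:
  fixes F :: "nat \<Rightarrow> real"
  shows "(\<Prod>k<m + n. F k) = (\<Prod>k<m. F k) * (\<Prod>k<n. F (m + k))"
  by (induction n) simp_all

lemma prod_lessThan_double:
  fixes F :: "nat \<Rightarrow> real"
  shows "(\<Prod>k<2 * m. F k) = (\<Prod>k<m. F (2 * k + 1) * F (2 * k))"
  by (induction m) simp_all

text \<open>The Pochhammer products containing \<open>x\<close> are the numerators \<open>T\<close>.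
  At \<open>x = 0\<close> they become quotients of factorials, which is what the denominators are;
  the factorials that remain extend \<open>H\<close> or cancel.\<close>

lemma selberg_product_eq:
  fixes a c x y :: nat
  assumes a: "a \<ge> 1"
  shows "(\<Prod>k<y. fact (c + k) * fact k * fact (a + k - 1) / 2 *
      pochhammer (real (x + y - k)) (2 * a + c + 2 * k) * pochhammer (real (x + y + a - k)) (c + 2 * k) *
      (fact (a + c + k - 1) / (fact (a + c + 2 * k) * fact (a + c + 2 * k - 1)))) =
    1 / 2 ^ y * (fact (a - 1) / fact (a + y - 1)) *
    ((H (2 * a + c + 2 * y - 1) * H (c + y)) / (H (2 * a + c + y - 1) * H c)) *
    ((T (x + 1) (int (2 * a + c + 2 * y) - 2) y * T (x + a + 1) (int (c + 2 * y) - 2) y)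
      / (T 1 (int (2 * a + c + 2 * y) - 2) y * T (a + 1) (int (c + 2 * y) - 2) y))"
proof -
  define P1 P2 where "P1 = (\<Prod>k<y. pochhammer (real (x + y - k)) (2 * a + c + 2 * k))"
    and "P2 = (\<Prod>k<y. pochhammer (real (x + y + a - k)) (c + 2 * k))"
  define Fc Fy Fa Fa' where "Fc = (\<Prod>k<y. fact (c + k) :: real)" and "Fy = (\<Prod>k<y. fact k :: real)"
    and "Fa = (\<Prod>k<y. fact (a + k - 1) :: real)" and "Fa' = (\<Prod>k<y. fact (a + k) :: real)"
  define G1 G2 G3 where "G1 = (\<Prod>k<y. fact (a + c + k - 1) :: real)" and "G2 = (\<Prod>k<y. fact (a + c + y - 1 + k) :: real)"
    and "G3 = (\<Prod>k<y. fact (a + c + 2 * k) * fact (a + c + 2 * k - 1) :: real)"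
  define E where "E = (\<Prod>k<y. fact (2 * a + c + y - 1 + k) :: real)"
  have pos: "Fc > 0" "Fy > 0" "Fa > 0" "Fa' > 0" "G1 > 0" "G2 > 0" "G3 > 0" "E > 0"
    by (simp_all add: Fc_def Fy_def Fa_def Fa'_def G1_def G2_def G3_def E_def prod_pos)
  have T1: "T (x + 1) (int (2 * a + c + 2 * y) - 2) y = P1"
    unfolding T_reindex P1_def
  proof (rule prod.cong[OF refl])
    fix k assume "k \<in> {..<y}"
    then have "x + 1 + (y - Suc k) = x + y - k" by auto
    then show "pochhammer (real (x + 1 + (y - Suc k))) (2 * a + c + 2 * k) = pochhammer (real (x + y - k)) (2 * a + c + 2 * k)"
      by (simp only:)
  qed
  have T2: "T (x + a + 1) (int (c + 2 * y) - 2) y = P2"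
    unfolding T_reindex P2_def
  proof (rule prod.cong[OF refl])
    fix k assume "k \<in> {..<y}"
    then have "x + a + 1 + (y - Suc k) = x + y + a - k" by auto
    then show "pochhammer (real (x + a + 1 + (y - Suc k))) (c + 2 * k) = pochhammer (real (x + y + a - k)) (c + 2 * k)"
      by (simp only:)
  qed
  have T3: "T 1 (int (2 * a + c + 2 * y) - 2) y = E / Fy"
  proof -
    have "T 1 (int (2 * a + c + 2 * y) - 2) y = (\<Prod>k<y. fact (2 * a + c + y - 1 + k) / fact (y - Suc k))"
      unfolding T_reindex
    proof (rule prod.cong[OF refl])
      fix k assume "k \<in> {..<y}"
      then have eq: "y - Suc k + (2 * a + c + 2 * k) = 2 * a + c + y - 1 + k" by auto
      show "pochhammer (real (1 + (y - Suc k))) (2 * a + c + 2 * k) = fact (2 * a + c + y - 1 + k) / fact (y - Suc k)"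
        using pochhammer_real_fact[of "y - Suc k" "2 * a + c + 2 * k", unfolded eq] by simp
    qed
    also have "\<dots> = E / (\<Prod>k<y. fact (y - Suc k))" by (simp add: E_def prod_dividef)
    also have "(\<Prod>k<y. fact (y - Suc k) :: real) = Fy" unfolding Fy_def by (rule prod.nat_diff_reindex)
    finally show ?thesis .
  qed
  have T4: "T (a + 1) (int (c + 2 * y) - 2) y = G2 / Fa'"
  proof -
    have "T (a + 1) (int (c + 2 * y) - 2) y = (\<Prod>k<y. fact (a + c + y - 1 + k) / fact (a + (y - Suc k)))"
      unfolding T_reindex
    proof (rule prod.cong[OF refl])
      fix k assume "k \<in> {..<y}"
      then have eq: "a + (y - Suc k) + (c + 2 * k) = a + c + y - 1 + k" by auto
      show "pochhammer (real (a + 1 + (y - Suc k))) (c + 2 * k) = fact (a + c + y - 1 + k) / fact (a + (y - Suc k))"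
        using pochhammer_real_fact[of "a + (y - Suc k)" "c + 2 * k", unfolded eq] by simp
    qed
    also have "\<dots> = G2 / (\<Prod>k<y. fact (a + (y - Suc k)))" by (simp add: G2_def prod_dividef)
    also have "(\<Prod>k<y. fact (a + (y - Suc k)) :: real) = Fa'"
      unfolding Fa'_def by (rule prod.nat_diff_reindex)
    finally show ?thesis .
  qed
  have H1: "H (2 * a + c + 2 * y - 1) = H (2 * a + c + y - 1) * E"
  proof -
    have eq: "2 * a + c + 2 * y - 1 = 2 * a + c + y - 1 + y" using a by simp
    show ?thesis unfolding eq E_def by (rule H_add)
  qed
  have H2: "H (c + y) = H c * Fc" unfolding Fc_def by (rule H_add)
  \<comment> \<open>The two products range over factorials shifted by one, so they differ in their
    end factors only; this is the origin of \<open>fact (a - 1) / fact (a + y - 1)\<close>.\<close>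
  have A: "fact (a - 1) * Fa' = Fa * fact (a + y - 1)"
    unfolding Fa_def Fa'_def using a by (induction y) (simp_all add: mult_ac)
  \<comment> \<open>Factorials of \<open>2 * y\<close> consecutive arguments, split once into halves
    and once by parity.\<close>
  have G: "G1 * G2 = G3"
  proof -
    define F where "F = (\<lambda>k. fact (a + c - 1 + k) :: real)"
    have "G1 = (\<Prod>k<y. F k)" "G2 = (\<Prod>k<y. F (y + k))"
      unfolding G1_def G2_def F_def using a by (intro prod.cong refl arg_cong[where f = fact]; simp)+
    then have "G1 * G2 = (\<Prod>k<2 * y. F k)"
      using prod_lessThan_add[of F y y] by (simp add: mult_2)
    also have "\<dots> = (\<Prod>k<y. F (2 * k + 1) * F (2 * k))" by (rule prod_lessThan_double)
    also have "\<dots> = G3"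
      unfolding G3_def F_def using a by (intro prod.cong refl arg_cong2[where f = "(*)"] arg_cong[where f = fact]; simp)
    finally show ?thesis .
  qed
  have "(\<Prod>k<y. fact (c + k) * fact k * fact (a + k - 1) / 2 *
      pochhammer (real (x + y - k)) (2 * a + c + 2 * k) * pochhammer (real (x + y + a - k)) (c + 2 * k) *
      (fact (a + c + k - 1) / (fact (a + c + 2 * k) * fact (a + c + 2 * k - 1)))) =
      Fc * Fy * Fa / 2 ^ y * P1 * P2 * (G1 / G3)"
    by (simp add: Fc_def Fy_def Fa_def P1_def P2_def G1_def G3_def prod.distrib prod_dividef)
  also have "Fa = fact (a - 1) / fact (a + y - 1) * Fa'" using A by (simp add: field_simps)
  also have "G1 / G3 = 1 / G2" unfolding G[symmetric] using pos by simp
  also have "Fc * Fy * (fact (a - 1) / fact (a + y - 1) * Fa') / 2 ^ y * P1 * P2 * (1 / G2) =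
    1 / 2 ^ y * (fact (a - 1) / fact (a + y - 1)) *
    (((H (2 * a + c + y - 1) * E) * (H c * Fc)) / (H (2 * a + c + y - 1) * H c)) * ((P1 * P2) / ((E / Fy) * (G2 / Fa')))"
    using pos H_pos[of c] H_pos[of "2 * a + c + y - 1"] by (simp add: field_simps)
  finally show ?thesis unfolding T1 T2 T3 T4 H1 H2 .
qed

lemma rblocks_shift: "j \<in> rblocks g (L + 1) k bs \<longleftrightarrow> j - 1 \<in> rblocks g L k bs"
  unfolding rblocks_iff by (simp add: algebra_simps)

text \<open>Transfers the positivity of the first entry to \<open>t_plus\<close>, for
  \<open>K'_eq_KE\<close>. It is an inequality because for a single entry of \<open>as\<close> the
  first entry of \<open>t_plus\<close> is the merged middle one.\<close>

lemma seq_t_plus_1: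
  assumes "length as \<ge> 1"
  shows "seq as 1 \<le> seq (t_plus x y as bs) 1"
proof (cases "length as div 2")
  case 0
  then have "t_plus x y as bs = (seq as 1 + x + y + seq (nonempty_seq bs) (floor_index (length (nonempty_seq bs)))) #
      map (seq (nonempty_seq bs)) (rev [1..<floor_index (length (nonempty_seq bs))])"
    unfolding t_plus_def Let_def ceiling_index_eq by simp
  then show ?thesis by (simp add: seq_def)
next
  case (Suc i)
  then have "[1..<ceiling_index (length as) + 1] = 1 # [2..<ceiling_index (length as) + 1]"
    unfolding ceiling_index_eq by (simp add: upt_conv_Cons numeral_2_eq_2 del: upt_Suc)
  then have "\<exists>r. t_plus x y as bs = seq as 1 # r"
    unfolding t_plus_def Let_def by simp
  then show ?thesis by (auto simp: seq_def)
qed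

text \<open>The ratio of the Selberg sum to its value at \<open>x = 0\<close>, with
  \<open>a\<close>, \<open>c\<close> and \<open>y\<close> fixed; the right block has length
  \<open>c\<close>, which is \<open>b + z\<close> in the application.\<close>

definition shift_factor :: "nat \<Rightarrow> nat \<Rightarrow> nat \<Rightarrow> nat \<Rightarrow> real" where
  "shift_factor a c x y = (T (x + 1) (int (2 * a + c + 2 * y) - 2) y * T (x + a + 1) (int (c + 2 * y) - 2) y)
    / (T 1 (int (2 * a + c + 2 * y) - 2) y * T (a + 1) (int (c + 2 * y) - 2) y)"

lemma T_pos: "p \<ge> 1 \<Longrightarrow> T p m y > 0"
  unfolding T_def by (intro prod_pos ballI pochhammer_pos) auto

lemma shift_factor_0: "shift_factor a c 0 y = 1" "shift_factor a c x 0 = 1"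
proof -
  have "T 1 (int (2 * a + c + 2 * y) - 2) y > 0" "T (a + 1) (int (c + 2 * y) - 2) y > 0" by (simp_all add: T_pos)
  then show "shift_factor a c 0 y = 1" by (simp add: shift_factor_def)
  show "shift_factor a c x 0 = 1" by (simp add: shift_factor_def T_def)
qed

text \<open>All that depends on \<open>y\<close> but not on \<open>x\<close>: the Selberg sum at
  \<open>x = 0\<close>, and the change in the normalising factorials between \<open>y\<close>
  crossings and none.\<close>

definition constant_factor :: "nat list \<Rightarrow> nat list \<Rightarrow> nat \<Rightarrow> nat \<Rightarrow> real" where
  "constant_factor as bs y z = 1 / 2 ^ y * (fact (sum_list as - 1) / fact (sum_list as + y - 1))
    * ((H2 (2 * esum as + 2 * osum bs) * H2 (2 * osum as + 2 * esum bs + 2 * z - 1))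
       / (H2 (2 * esum as + 2 * osum bs + 2 * y) * H2 (2 * osum as + 2 * esum bs + 2 * y + 2 * z - 1)))
    * ((H (2 * sum_list as + (sum_list bs + z) + 2 * y - 1) * H (sum_list bs + z + y))
       / (H (2 * sum_list as + (sum_list bs + z) + y - 1) * H (sum_list bs + z)))"

text \<open>\<open>K'\<close> and \<open>Q\<close> are the normalised Vandermonde products of the
  dents alone, hence the constant of \<open>KE_QE_Un\<close> up to normalisation; the quotient of
  \<open>H2\<close> values corrects for the \<open>y\<close> additional positions on each
  side.\<close>

lemma M_NR4_formula:
  assumes as: "length as \<ge> 1" "seq as 1 \<ge> 1"
  shows "M_NR4 x y z as bs = K' (t_plus x y as bs) * real (Q (t_minus x y z as bs)) * constant_factor as bs y z * shift_factor (sum_list as) (sum_list bs + z) x y"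
    and "K' (t_plus x y as bs) > 0" and "real (Q (t_minus x y z as bs)) > 0"
proof -
  obtain a as' where as': "as = a # as'" using as(1) by (cases as) auto
  have a: "a \<ge> 1" using as(2) by (simp add: as' seq_def)
  define L where "L = x + y + (a + sum_list as') + sum_list bs"
  define U0 where "U0 = blocks False 0 0 (a # as') \<union> rblocks True (int L) 0 bs"
  define D0 where "D0 = {1..<int a} \<union> blocks False (int a) 0 as' \<union> rblocks False (int L) 0 bs \<union> {int L..<int (L + z)}"
  define n where "n = y + esum (a # as') + osum bs"
  define n' where "n' = y + (a - 1) + esum as' + esum bs + z"
  define A where "A = a + sum_list as'"
  define N where "N = x + y"
  define c where "c = sum_list bs + z"
  note NR1 = M_NR4_eq_sum(1)[OF a, where x = x and y = y and z = z and as = as' and bs = bs,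
      folded L_def, folded U0_def D0_def n_def n'_def A_def N_def]
  note NR2 = M_NR4_eq_sum(2)[OF a, where x = x and y = y and z = z and as = as' and bs = bs,
      folded L_def, folded U0_def D0_def n_def n'_def A_def N_def]
  note NR3 = M_NR4_eq_sum(3)[OF a, where x = x and y = y and z = z and as = as' and bs = bs,
      folded L_def, folded U0_def D0_def n_def n'_def A_def N_def]
  note NR5 = M_NR4_eq_sum(4)[OF a, where x = x and y = y and as = as' and bs = bs,
      folded L_def, folded U0_def D0_def n_def n'_def A_def N_def]
  note NR6 = M_NR4_eq_sum(5)[OF a, where x = x and y = y and z = z and as = as' and bs = bs,
      folded L_def, folded U0_def D0_def n_def n'_def A_def N_def]
  have sumA: "sum_list as = A" by (simp add: as' A_def)
  have A1: "A \<ge> 1" using a by (simp add: A_def)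
  have Lc: "int (L + z) = int (A + N + c)" by (simp add: L_def A_def N_def c_def)
  note UD = NR2[unfolded Lc]
  have fin: "finite U0" "finite D0" by (simp_all add: U0_def D0_def)
  have U0pos: "U0 \<subseteq> {0..}" and D0pos: "D0 \<subseteq> {1..}"
  proof -
    have "U0 \<union> D0 \<subseteq> {1..}" unfolding UD using A1 by auto
    then show "D0 \<subseteq> {1..}" "U0 \<subseteq> {0..}" by auto
  qed
  have "M_NR4 x y z as bs = (\<Sum>V | V \<subseteq> {int A..<int (A + N)} \<and> card V = y.
      vand sq U0 * ((\<Prod>x\<in>D0. of_int x) * vand sq D0) / ((\<Prod>j<n. fact (2 * j)) * (\<Prod>j<n'. fact (2 * j + 1))) *
      ((\<Prod>v\<in>V. selw A N c v) * (vand sq V)\<^sup>2))"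
    unfolding as' NR1
  proof (rule sum.cong[OF refl])
    fix V assume "V \<in> {V. V \<subseteq> {int A..<int (A + N)} \<and> card V = y}"
    then have V: "V \<subseteq> {int A..<int (A + N)}" by simp
    have "{int A..<int (A + N)} \<inter> (U0 \<union> D0) = {}" unfolding UD by auto
    then have "U0 \<inter> V = {}" "D0 \<inter> V = {}" using V by blast+
    moreover have "finite V" using V finite_subset by blast
    ultimately show "KE 0 n (U0 \<union> V) * QE 1 n' (D0 \<union> V) =
      vand sq U0 * ((\<Prod>x\<in>D0. of_int x) * vand sq D0) / ((\<Prod>j<n. fact (2 * j)) * (\<Prod>j<n'. fact (2 * j + 1))) *
      ((\<Prod>v\<in>V. selw A N c v) * (vand sq V)\<^sup>2)"
      using fin NR3 V UD by (intro KE_QE_Un) auto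
  qed
  also have "\<dots> = vand sq U0 * ((\<Prod>x\<in>D0. of_int x) * vand sq D0) / ((\<Prod>j<n. fact (2 * j)) * (\<Prod>j<n'. fact (2 * j + 1))) *
      (\<Sum>V | V \<subseteq> {int A..<int (A + N)} \<and> card V = y. (\<Prod>v\<in>V. selw A N c v) * (vand sq V)\<^sup>2)"
    by (rule sum_distrib_left[symmetric])
  finally have M: "M_NR4 x y z as bs = \<dots>" .

  have plus: "blocks False 0 0 (t_plus x y as bs) = U0"
    using blocks_t_plus[OF as(1), of x y bs] by (simp add: U0_def L_def as' add_ac)
  have eplus: "esum (t_plus x y as bs) = esum as + osum bs"
    using card_blocks(2)[of 0 "t_plus x y as bs"] NR5 unfolding plus by (simp add: as')
  have K: "K' (t_plus x y as bs) = KE 0 (esum as + osum bs) U0"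
    using K'_eq_KE[of "t_plus x y as bs"] seq_t_plus_1[OF as(1), of x y bs] as(2) by (simp add: plus eplus)
  have L1: "int (a - 1 + x + y + sum_list as' + sum_list bs) = int L - 1" using a by (simp add: L_def)
  have minus: "(\<lambda>j. j + 1) ` blocks False 0 0 (t_minus x y z as bs) = D0"
  proof -
    have "(\<lambda>j. j + 1) ` X = D0" if "\<And>j. j \<in> D0 \<longleftrightarrow> j - 1 \<in> X" for X :: "int set"
    proof -
      have "j \<in> (\<lambda>j. j + 1) ` X \<longleftrightarrow> j - 1 \<in> X" for j by (force simp: image_iff)
      then show ?thesis using that by blast
    qed
    moreover have "j \<in> D0 \<longleftrightarrow> j - 1 \<in> blocks False 0 0 (t_minus x y z as bs)" for j
    proof -
      have 1: "j \<in> blocks False (int a) 0 as' \<longleftrightarrow> j - 1 \<in> blocks False (int (a - 1)) 0 as'"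
        using blocks_shift[of j False "int (a - 1)" 0 as'] a by simp
      have 2: "j \<in> rblocks False (int L) 0 bs \<longleftrightarrow> j - 1 \<in> rblocks False (int L - 1) 0 bs"
        using rblocks_shift[of j False "int L - 1" 0 bs] by simp
      have 3: "int (a - 1 + x + y + sum_list as' + sum_list bs + z) = int L - 1 + int z" using L1 by simp
      have 4: "j \<in> {1..<int a} \<longleftrightarrow> j - 1 \<in> {0..<int (a - 1)}" using a by auto
      have 5: "j \<in> {int L..<int (L + z)} \<longleftrightarrow> j - 1 \<in> {int L - 1..<int L - 1 + int z}" by auto
      show ?thesis unfolding as' blocks_t_minus D0_def Un_iff L1 3 1 2 4 5 by blast
    qed
    ultimately show ?thesis by blast
  qed
  have eminus: "esum (t_minus x y z as bs) = (a - 1) + esum as' + esum bs + z"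
  proof -
    have "card D0 = card (blocks False 0 0 (t_minus x y z as bs))"
      unfolding minus[symmetric] by (rule card_image) (simp add: inj_on_def)
    then show ?thesis using card_blocks(2)[of 0 "t_minus x y z as bs"] NR6 by simp
  qed
  have QQ: "real (Q (t_minus x y z as bs)) = QE 1 ((a - 1) + esum as' + esum bs + z) D0"
    using Q_eq_QE[of "t_minus x y z as bs"] QE_shift[of 0 _ "blocks False 0 0 (t_minus x y z as bs)"] by (simp add: minus eminus)
  show "K' (t_plus x y as bs) > 0" unfolding K using U0pos by (rule KE_pos)
  show "real (Q (t_minus x y z as bs)) > 0" unfolding QQ using D0pos by (rule QE_pos)

  have osum: "osum as = a + esum as'" by (simp add: as' osum_Cons)
  define k0 k1 q0 q1 where "k0 = H2 (2 * esum as + 2 * osum bs)" and "k1 = H2 (2 * esum as + 2 * osum bs + 2 * y)"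
    and "q0 = H2 (2 * osum as + 2 * esum bs + 2 * z - 1)" and "q1 = H2 (2 * osum as + 2 * esum bs + 2 * y + 2 * z - 1)"
  have k0: "k0 = (\<Prod>j<esum as + osum bs. fact (2 * j))"
    using H2_even[of "esum as + osum bs"] by (simp add: k0_def algebra_simps)
  have k1: "k1 = (\<Prod>j<n. fact (2 * j))"
    using H2_even[of n] by (simp add: k1_def n_def as' algebra_simps)
  have q0: "q0 = (\<Prod>j<(a - 1) + esum as' + esum bs + z. fact (2 * j + 1))"
  proof -
    have "2 * osum as + 2 * esum bs + 2 * z - 1 = 2 * ((a - 1) + esum as' + esum bs + z) + 1" using a osum by simp
    then show ?thesis unfolding q0_def by (simp only: H2_odd)
  qed
  have q1: "q1 = (\<Prod>j<n'. fact (2 * j + 1))"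
  proof -
    have "2 * osum as + 2 * esum bs + 2 * y + 2 * z - 1 = 2 * n' + 1" using a osum by (simp add: n'_def)
    then show ?thesis unfolding q1_def by (simp only: H2_odd)
  qed
  have "k0 > 0" "q0 > 0" unfolding k0 q0 by (simp_all add: prod_pos)
  then have KQ: "vand sq U0 * ((\<Prod>x\<in>D0. of_int x) * vand sq D0) = K' (t_plus x y as bs) * real (Q (t_minus x y z as bs)) * (k0 * q0)"
    unfolding K QQ KE_def QE_def k0[symmetric] q0[symmetric] by (simp add: sq_def[abs_def])
  have "(\<Sum>V | V \<subseteq> {int A..<int (A + N)} \<and> card V = y. (\<Prod>v\<in>V. selw A N c v) * (vand sq V)\<^sup>2) =
    1 / 2 ^ y * (fact (A - 1) / fact (A + y - 1)) *
    ((H (2 * A + c + 2 * y - 1) * H (c + y)) / (H (2 * A + c + y - 1) * H c)) * shift_factor A c x y"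
    unfolding sq_def[abs_def] shift_factor_def selberg_product_eq[OF A1, symmetric] N_def
    by (rule selberg_sum[OF A1]) simp
  then show "M_NR4 x y z as bs = K' (t_plus x y as bs) * real (Q (t_minus x y z as bs)) * constant_factor as bs y z * shift_factor (sum_list as) (sum_list bs + z) x y"
    unfolding M KQ k1[symmetric] q1[symmetric] constant_factor_def sumA c_def[symmetric]
      k0_def[symmetric] k1_def[symmetric] q0_def[symmetric] q1_def[symmetric]
    by (simp add: mult_ac)
qed

theorem theorem2p19:
  fixes x y z :: nat and as bs :: "nat list"
  assumes "length as \<ge> 1" and "seq as 1 \<ge> 1"
  shows "let a = sum_list as; b = sum_list bs;
             oa = osum as; ea = esum as; ob = osum bs; eb = esum bs;
             TT = (T (x + 1) (int (2*a + b + 2*y + z) - 2) y * T (x + a + 1) (int (b + 2*y + z) - 2) y)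
                / (T 1 (int (2*a + b + 2*y + z) - 2) y * T (a + 1) (int (b + 2*y + z) - 2) y)
         in M_NR4 y 0 z as bs \<noteq> 0 \<and>
            M_NR4 x y z as bs
              = M_NR4 (x + y) 0 z as bs * M_NR4 0 y z as bs / M_NR4 y 0 z as bs * TT \<and>
            M_NR4 x y z as bs
              = 1 / 2 ^ y * K' (t_plus x y as bs) * real (Q (t_minus x y z as bs))
                * (fact (a - 1) / fact (a + y - 1))
                * ((H2 (2*ea + 2*ob) * H2 (2*oa + 2*eb + 2*z - 1))
                   / (H2 (2*ea + 2*ob + 2*y) * H2 (2*oa + 2*eb + 2*y + 2*z - 1)))
                * ((H (2*a + b + 2*y + z - 1) * H (b + y + z))
                   / (H (2*a + b + y + z - 1) * H (b + z)))
                * TT"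
proof -
  let ?TT = "shift_factor (sum_list as) (sum_list bs + z)"
  note formula = M_NR4_formula(1)[OF assms] and pos = M_NR4_formula(2,3)[OF assms]
  \<comment> \<open>Both sequences involve \<open>x\<close> and \<open>y\<close> through their sum
    only, so trading \<open>y\<close> for \<open>x\<close> leaves \<open>K'\<close> and
    \<open>Q\<close> unchanged.\<close>
  have t: "t_plus (x + y) 0 as bs = t_plus x y as bs" "t_minus (x + y) 0 z as bs = t_minus x y z as bs" for x y
    by (simp_all add: t_plus_def t_minus_def Let_def add.assoc)
  have H2_pos: "H2 m > 0" for m unfolding H2_def by (rule prod_pos) simp
  have CC0: "constant_factor as bs 0 z = 1"
    using H2_pos[of "2 * esum as + 2 * osum bs"] H2_pos[of "2 * osum as + 2 * esum bs + 2 * z - 1"]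
      H_pos[of "sum_list bs + z"] H_pos[of "2 * sum_list as + (sum_list bs + z) - 1"] by (simp add: constant_factor_def)
  define KQ where "KQ = (\<lambda>x y. K' (t_plus x y as bs) * real (Q (t_minus x y z as bs)))"
  have KQ: "KQ x y > 0" "KQ (x + y) 0 = KQ x y" for x y
    using pos by (simp_all add: KQ_def t)
  have M: "M_NR4 x y z as bs = KQ x y * constant_factor as bs y z * ?TT x y" for x y
    unfolding KQ_def by (rule formula)
  have "M_NR4 y 0 z as bs \<noteq> 0"
    using KQ(1)[of y 0] by (simp add: M CC0 shift_factor_0)
  \<comment> \<open>The counts with second index 0 are plain values of \<open>KQ\<close>, and the
    one with \<open>x = 0\<close> has shift factor 1. Since \<open>KQ 0 y\<close> cancels, the
    quotient is \<open>KQ x y\<close> times the constant factor.\<close>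
  moreover have "M_NR4 x y z as bs = M_NR4 (x + y) 0 z as bs * M_NR4 0 y z as bs / M_NR4 y 0 z as bs * ?TT x y"
    using KQ(1)[of y 0] KQ(2)[of x y] KQ(2)[of 0 y] by (simp add: M CC0 shift_factor_0)
  moreover have e: "2 * sum_list as + (sum_list bs + z) + 2 * y = 2 * sum_list as + sum_list bs + 2 * y + z"
    "2 * sum_list as + (sum_list bs + z) + y = 2 * sum_list as + sum_list bs + y + z"
    "sum_list bs + z + y = sum_list bs + y + z" "sum_list bs + z + 2 * y = sum_list bs + 2 * y + z" by simp_all
  moreover have "M_NR4 x y z as bs
      = 1 / 2 ^ y * K' (t_plus x y as bs) * real (Q (t_minus x y z as bs))
        * (fact (sum_list as - 1) / fact (sum_list as + y - 1))
        * ((H2 (2 * esum as + 2 * osum bs) * H2 (2 * osum as + 2 * esum bs + 2 * z - 1))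
           / (H2 (2 * esum as + 2 * osum bs + 2 * y) * H2 (2 * osum as + 2 * esum bs + 2 * y + 2 * z - 1)))
        * ((H (2 * sum_list as + sum_list bs + 2 * y + z - 1) * H (sum_list bs + y + z))
           / (H (2 * sum_list as + sum_list bs + y + z - 1) * H (sum_list bs + z)))
        * ?TT x y"
    unfolding formula constant_factor_def e by (simp only: mult_ac)
  ultimately show ?thesis
    unfolding Let_def shift_factor_def e by blast
qed

end
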